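(* Let $N$ and $M$ be finitely generated torsion-free nilpotent groups and let $\Psi:N\to M$ be a quasi-isometry. Suppose $\Psi$ is coarsely affine on the Abelianization: there exist a linear map $L:N_{\mathrm{ab}}\otimes_{\mathbb Z}\mathbb R\to M_{\mathrm{ab}}\otimes_{\mathbb Z}\mathbb R$, a vector $v_0\in M_{\mathrm{ab}}\otimes_{\mathbb Z}\mathbb R$ and a constant $C\ge0$ such that $$\big\|\pi_M(\Psi(x))-\big(L(\pi_N(x))+v_0\big)\big\|\le C\qquad\text{for all }x\in N.$$ Then $\Psi$ has bounded Abelian defect, i.e. $$\Delta_{\mathrm{ab}}(\Psi):=\sup_{x,y\in N}\big\|\pi_M(\Psi(xy))-\pi_M(\Psi(x))-\pi_M(\Psi(y))\big\|<\infty.$$ In particular, the following conclusions (those of the algebraic linearization theorem for quasi-isometries with bounded Abelian defect) hold for $\Psi$. (1) There exists a unique group homomorphism $H:N\to M_{\mathrm{ab}}\otimes_{\mathbb Z}\mathbb R$ such that $\sup_{x\in N}\|\pi_M(\Psi(x))-H(x)\|<\infty$. In particular $H$ factors through the Abelianization of $N$, so there is a unique linear map $L_{ab}:N_{\mathrm{ab}}\otimes_{\mathbb Z}\mathbb R\to M_{\mathrm{ab}}\otimes_{\mathbb Z}\mathbb R$ with $H(x)=L_{ab}(\pi_N(x))$ for all $x\in N$, and $$\sup_{x\in N}\big\|\pi_M(\Psi(x))-L_{ab}(\pi_N(x))\big\|<\infty.$$ (2) The linear map $L_{ab}$ is an isomorphism. Consequently one defines $T_\Psi:\operatorname{Hom}(N_{\mathrm{ab}},\mathbb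 R)\to\operatorname{Hom}(M_{\mathrm{ab}},\mathbb R)$ by $T_\Psi(\varphi):=\varphi\circ L_{ab}^{-1}$, i.e. $T_\Psi=(L_{ab}^{-1})^{\ast}$. (3) Let $r=\dim_{\mathbb R}\operatorname{Hom}(N_{\mathrm{ab}},\mathbb R)$, let $\{\varphi_i\}_{i=1}^r$ be a basis of $\operatorname{Hom}(N_{\mathrm{ab}},\mathbb R)$, and put $\psi_i:=T_\Psi(\varphi_i)$ for $i=1,\dots,r$. Define coarse harmonic coordinates $F_N:N\to\mathbb R^r$ and $F_M:M\to\mathbb R^r$ by $$F_N(x):=\big(\varphi_i(\pi_N(x))\big)_{i=1}^r,\qquad F_M(y):=\big(\psi_i(\pi_M(y))\big)_{i=1}^r.$$ Then $$\sup_{x\in N}\big\|F_M(\Psi(x))-F_N(x)\big\|<\infty.$$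
   Context: $N_{\mathrm{ab}}=N/[N,N]$ and $M_{\mathrm{ab}}=M/[M,M]$. $\pi_N:N\to N_{\mathrm{ab}}\otimes_{\mathbb Z}\mathbb R$ is the composition of the Abelianization $N\to N_{\mathrm{ab}}$ with the canonical map $N_{\mathrm{ab}}\to N_{\mathrm{ab}}\otimes_{\mathbb Z}\mathbb R$; $\pi_M$ is defined similarly. A norm $\|\cdot\|$ is fixed on the finite-dimensional space $M_{\mathrm{ab}}\otimes_{\mathbb Z}\mathbb R$, and a norm on $\mathbb R^r$. Elements of $\operatorname{Hom}(N_{\mathrm{ab}},\mathbb R)$ and $\operatorname{Hom}(M_{\mathrm{ab}},\mathbb R)$ are identified with linear functionals on $N_{\mathrm{ab}}\otimes_{\mathbb Z}\mathbb R$ and $M_{\mathrm{ab}}\otimes_{\mathbb Z}\mathbb R$ respectively. Quasi-isometries are with respect to word metrics for finite generating sets. *)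

theory Defs
  imports
    "HOL-Algebra.Free_Abelian_Groups"
    "HOL-Algebra.Generated_Groups"
    "HOL-Algebra.Module"
    "HOL-Library.Extended_Real"
begin

section \<open>Finitely generated, torsion-free and nilpotent groups\<close>

definition finite_generating_set :: "('a, 'x) monoid_scheme \<Rightarrow> 'a set \<Rightarrow> bool" where
  "finite_generating_set G S \<longleftrightarrow> finite S \<and> S \<subseteq> carrier G \<and> generate G S = carrier G"

definition torsion_free_group :: "('a, 'x) monoid_scheme \<Rightarrow> bool" where
  "torsion_free_group G \<longleftrightarrow>
     (\<forall>x\<in>carrier G. \<forall>n::nat. 0 < n \<longrightarrow> x [^]\<^bsub>G\<^esub> n = \<one>\<^bsub>G\<^esub> \<longrightarrow> x = \<one>\<^bsub>G\<^esub>)"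

primrec lower_central :: "('a, 'x) monoid_scheme \<Rightarrow> nat \<Rightarrow> 'a set" where
  "lower_central G 0 = carrier G"
| "lower_central G (Suc n) =
     generate G {x \<otimes>\<^bsub>G\<^esub> y \<otimes>\<^bsub>G\<^esub> inv\<^bsub>G\<^esub> x \<otimes>\<^bsub>G\<^esub> inv\<^bsub>G\<^esub> y | x y. x \<in> lower_central G n \<and> y \<in> carrier G}"

definition nilpotent_group :: "('a, 'x) monoid_scheme \<Rightarrow> bool" where
  "nilpotent_group G \<longleftrightarrow> (\<exists>n. lower_central G n = {\<one>\<^bsub>G\<^esub>})"


section \<open>Word metrics and quasi-isometries\<close>

definition word_length :: "('a, 'x) monoid_scheme \<Rightarrow> 'a set \<Rightarrow> 'a \<Rightarrow> nat" where
  "word_length G S g = (LEAST n. \<exists>ws. length ws = n \<and> set ws \<subseteq> S \<union> m_inv G ` S \<and>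
     g = foldr (\<otimes>\<^bsub>G\<^esub>) ws \<one>\<^bsub>G\<^esub>)"

definition word_dist :: "('a, 'x) monoid_scheme \<Rightarrow> 'a set \<Rightarrow> 'a \<Rightarrow> 'a \<Rightarrow> real" where
  "word_dist G S x y = real (word_length G S (inv\<^bsub>G\<^esub> x \<otimes>\<^bsub>G\<^esub> y))"

definition quasi_isometry ::
  "'a set \<Rightarrow> ('a \<Rightarrow> 'a \<Rightarrow> real) \<Rightarrow> 'b set \<Rightarrow> ('b \<Rightarrow> 'b \<Rightarrow> real) \<Rightarrow> ('a \<Rightarrow> 'b) \<Rightarrow> bool" where
  "quasi_isometry A d B e f \<longleftrightarrow> f \<in> A \<rightarrow> B \<and>
     (\<exists>k\<ge>1. \<exists>c\<ge>0.
        (\<forall>x\<in>A. \<forall>x'\<in>A. d x x' / k - c \<le> e (f x) (f x') \<and> e (f x) (f x') \<le> k * d x x' + c) \<and>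
        (\<forall>y\<in>B. \<exists>x\<in>A. e y (f x) \<le> c))"


section \<open>Real vector spaces with explicit carrier\<close>

text \<open>
  Real vector spaces are represented by the \<open>module\<close> records of HOL-Algebra. Only the fields
  \<open>carrier\<close>, \<open>add\<close>, \<open>zero\<close> and \<open>smult\<close> are meaningful; the ring multiplication and the
  ring unit which these records also contain are never used.
\<close>

definition linear_on :: "(real, 'v) module \<Rightarrow> (real, 'w) module \<Rightarrow> ('v \<Rightarrow> 'w) \<Rightarrow> bool" where
  "linear_on V W f \<longleftrightarrow> f \<in> carrier V \<rightarrow> carrier W \<and>
     (\<forall>u\<in>carrier V. \<forall>v\<in>carrier V. f (u \<oplus>\<^bsub>V\<^esub> v) = f u \<oplus>\<^bsub>W\<^esub> f v) \<and>
     (\<forall>a. \<forall>v\<in>carrier V. f (a \<odot>\<^bsub>V\<^esub> v) = a \<odot>\<^bsub>W\<^esub> f v)"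

definition linear_iso_on :: "(real, 'v) module \<Rightarrow> (real, 'w) module \<Rightarrow> ('v \<Rightarrow> 'w) \<Rightarrow> bool" where
  "linear_iso_on V W f \<longleftrightarrow> linear_on V W f \<and> bij_betw f (carrier V) (carrier W)"

definition norm_on :: "(real, 'v) module \<Rightarrow> ('v \<Rightarrow> real) \<Rightarrow> bool" where
  "norm_on V nrm \<longleftrightarrow>
     (\<forall>v\<in>carrier V. 0 \<le> nrm v \<and> (nrm v = 0 \<longleftrightarrow> v = \<zero>\<^bsub>V\<^esub>)) \<and>
     (\<forall>a. \<forall>v\<in>carrier V. nrm (a \<odot>\<^bsub>V\<^esub> v) = \<bar>a\<bar> * nrm v) \<and>
     (\<forall>u\<in>carrier V. \<forall>v\<in>carrier V. nrm (u \<oplus>\<^bsub>V\<^esub> v) \<le> nrm u + nrm v)"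

definition functional_on :: "(real, 'v) module \<Rightarrow> ('v \<Rightarrow> real) \<Rightarrow> bool" where
  "functional_on V \<phi> \<longleftrightarrow>
     (\<forall>u\<in>carrier V. \<forall>v\<in>carrier V. \<phi> (u \<oplus>\<^bsub>V\<^esub> v) = \<phi> u + \<phi> v) \<and>
     (\<forall>a. \<forall>v\<in>carrier V. \<phi> (a \<odot>\<^bsub>V\<^esub> v) = a * \<phi> v)"

text \<open>
  The functionals \<open>\<phi> 0, \<dots>, \<phi> (r - 1)\<close> form a basis of the dual space of \<open>V\<close>; in
  particular \<open>r\<close> is its dimension. Functionals matter only through their values on \<open>carrier V\<close>.
\<close>

definition dual_basis :: "(real, 'v) module \<Rightarrow> nat \<Rightarrow> (nat \<Rightarrow> 'v \<Rightarrow> real) \<Rightarrow> bool" where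
  "dual_basis V r \<phi> \<longleftrightarrow>
     (\<forall>i<r. functional_on V (\<phi> i)) \<and>
     (\<forall>c. (\<forall>v\<in>carrier V. (\<Sum>i<r. c i * \<phi> i v) = 0) \<longrightarrow> (\<forall>i<r. c i = 0)) \<and>
     (\<forall>f. functional_on V f \<longrightarrow> (\<exists>c. \<forall>v\<in>carrier V. f v = (\<Sum>i<r. c i * \<phi> i v)))"

text \<open>The space \<open>\<real>\<close>$^r$, as the functions on \<open>nat\<close> supported in \<open>{..<r}\<close>.\<close>

definition coord_space :: "nat \<Rightarrow> (real, nat \<Rightarrow> real) module" where
  "coord_space r =
     \<lparr>carrier = {f. \<forall>i\<ge>r. f i = 0}, mult = undefined, one = undefined,
      zero = (\<lambda>i. 0), add = (\<lambda>f g i. f i + g i), smult = (\<lambda>a f i. a * f i)\<rparr>"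

definition coord_vec :: "nat \<Rightarrow> (nat \<Rightarrow> real) \<Rightarrow> nat \<Rightarrow> real" where
  "coord_vec r c = (\<lambda>i. if i < r then c i else 0)"


section \<open>The tensor product of an abelian group with the reals\<close>

text \<open>
  For an abelian group \<open>A\<close> (written multiplicatively), \<open>A \<otimes>\<^sub>\<int> \<real>\<close> is the quotient of the
  free abelian group on the pairs \<open>(a, s)\<close> by the subgroup generated by the bilinearity relations.
\<close>

definition tensor_free :: "('a, 'x) monoid_scheme \<Rightarrow> ('a \<times> real \<Rightarrow>\<^sub>0 int) monoid" where
  "tensor_free A = free_Abelian_group (carrier A \<times> UNIV)"

definition tensor_relations :: "('a, 'x) monoid_scheme \<Rightarrow> ('a \<times> real \<Rightarrow>\<^sub>0 int) set" where
  "tensor_relations A =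
     {frag_of (a \<otimes>\<^bsub>A\<^esub> b, s) - frag_of (a, s) - frag_of (b, s) | a b s.
        a \<in> carrier A \<and> b \<in> carrier A} \<union>
     {frag_of (a, s + t) - frag_of (a, s) - frag_of (a, t) | a s t. a \<in> carrier A}"

definition tensor_kernel :: "('a, 'x) monoid_scheme \<Rightarrow> ('a \<times> real \<Rightarrow>\<^sub>0 int) set" where
  "tensor_kernel A = generate (tensor_free A) (tensor_relations A)"

definition pure_tensor :: "('a, 'x) monoid_scheme \<Rightarrow> 'a \<Rightarrow> real \<Rightarrow> ('a \<times> real \<Rightarrow>\<^sub>0 int) set" where
  "pure_tensor A a s = tensor_kernel A #>\<^bsub>tensor_free A\<^esub> frag_of (a, s)"

text \<open>
  Scalar multiplication is induced by \<open>(a, s) \<mapsto> (a, t * s)\<close>. This preserves the relations, so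
  all representatives \<open>c\<close> of a coset \<open>X\<close> contribute the same coset to the union below.
\<close>

definition real_tensor :: "('a, 'x) monoid_scheme \<Rightarrow> (real, ('a \<times> real \<Rightarrow>\<^sub>0 int) set) module" where
  "real_tensor A =
     (let Q = tensor_free A Mod tensor_kernel A in
      \<lparr>carrier = carrier Q, mult = undefined, one = undefined,
       zero = \<one>\<^bsub>Q\<^esub>, add = (\<otimes>\<^bsub>Q\<^esub>),
       smult = (\<lambda>t X. \<Union>c\<in>X. tensor_kernel A #>\<^bsub>tensor_free A\<^esub>
                              frag_extend (\<lambda>(a, s). frag_of (a, t * s)) c)\<rparr>)"


section \<open>Abelianization, Abelian defect\<close>

definition abelianization :: "('a, 'x) monoid_scheme \<Rightarrow> 'a set monoid" where
  "abelianization G = G Mod derived G (carrier G)"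

definition abelian_class :: "('a, 'x) monoid_scheme \<Rightarrow> 'a \<Rightarrow> 'a set" where
  "abelian_class G x = derived G (carrier G) #>\<^bsub>G\<^esub> x"

abbreviation real_ab ::
  "('a, 'x) monoid_scheme \<Rightarrow> (real, ('a set \<times> real \<Rightarrow>\<^sub>0 int) set) module" where
  "real_ab G \<equiv> real_tensor (abelianization G)"

definition ab_proj :: "('a, 'x) monoid_scheme \<Rightarrow> 'a \<Rightarrow> ('a set \<times> real \<Rightarrow>\<^sub>0 int) set" where
  "ab_proj G x = pure_tensor (abelianization G) (abelian_class G x) 1"

definition abelian_defect ::
  "('a, 'x) monoid_scheme \<Rightarrow> ('b, 'y) monoid_scheme \<Rightarrow>
   (('b set \<times> real \<Rightarrow>\<^sub>0 int) set \<Rightarrow> real) \<Rightarrow> ('a \<Rightarrow> 'b) \<Rightarrow> ereal" where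
  "abelian_defect N M nrm \<Psi> =
     (SUP (x, y) \<in> carrier N \<times> carrier N.
        ereal (nrm (ab_proj M (\<Psi> (x \<otimes>\<^bsub>N\<^esub> y)) \<ominus>\<^bsub>real_ab M\<^esub> ab_proj M (\<Psi> x)
                    \<ominus>\<^bsub>real_ab M\<^esub> ab_proj M (\<Psi> y))))"

text \<open>
  Elements of \<open>Hom(G\<^sub>a\<^sub>b, \<real>)\<close> are identified with linear functionals on
  \<open>real_ab G\<close>; under this identification \<open>dual_transport V L\<close> is the operator
  \<open>\<phi> \<mapsto> \<phi> \<circ> L\<close>$^{-1}$ attached to a linear isomorphism \<open>L\<close> defined on \<open>V\<close>.
\<close>

definition dual_transport :: "(real, 'v) module \<Rightarrow> ('v \<Rightarrow> 'w) \<Rightarrow> ('v \<Rightarrow> real) \<Rightarrow> 'w \<Rightarrow> real" where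
  "dual_transport V L \<phi> = \<phi> \<circ> inv_into (carrier V) L"

definition harmonic_coords ::
  "('a, 'x) monoid_scheme \<Rightarrow> nat \<Rightarrow> (nat \<Rightarrow> ('a set \<times> real \<Rightarrow>\<^sub>0 int) set \<Rightarrow> real) \<Rightarrow> 'a \<Rightarrow> nat \<Rightarrow> real"
  where "harmonic_coords G r \<phi> x = coord_vec r (\<lambda>i. \<phi> i (ab_proj G x))"

end

theory Submission
  imports Defs
begin

text \<open>
  The linear map in question is \<open>L\<close> itself; the point is that it is bijective. It is onto since its image
  is a closed subspace which is coarsely dense. For injectivity, suppose \<open>L v = 0\<close> with \<open>v \<noteq> 0\<close>, and let
  \<open>x\<^sub>n\<close> be a path in \<open>N\<close> with bounded steps whose projection stays close to \<open>n v\<close>; then \<open>\<bar>x\<^sub>n\<bar>\<close> grows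
  linearly. The path \<open>\<Psi> x\<^sub>n\<close> has bounded steps and bounded projection to \<open>M\<^sub>a\<^sub>b \<otimes> \<real>\<close>, so up to finitely
  many coset representatives it is a path in \<open>[M, M]\<close> with finitely many different steps. But products of
  \<open>n\<close> elements of a finite subset of \<open>[M, M]\<close> have length \<open>o(n)\<close> in the nilpotent group \<open>M\<close>: going down
  the lower central series this comes from the identity \<open>[x\<^sup>p, y\<^sup>p] = [x, y]\<close> to the power \<open>p\<^sup>2\<close>, valid when
  the commutator is central.
\<close>

section \<open>Words and the lower central series\<close>

text \<open>A quasi-isometry need not respect products, and its coarse inverse sees N_ab \<otimes>
  \<real> only modulo the kernel of \<open>L\<close>; so injectivity cannot be had by exchanging the
  two groups. Equality of the two dimensions would suffice, but that is a deep invariance theorem;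
  the distortion of commutators in \<open>M\<close> takes its place, set against the lower bound in
  the quasi-isometry inequality. Sublinear growth is always expressed thus: for every \<epsilon>
  there is A such that n steps give length at most \<epsilon> n + A. This form survives products and
  inverses, and the final contradiction needs a single \<epsilon>. Commutators can be collected only
  where they are central, that is, modulo the next term of the lower central series. So a product is
  compared with a short element up to an error in the series, and the error is pushed down one term
  at a time. The abelianization of a torsion-free nilpotent group may have torsion, so its map to
  the tensor product need not be injective. Finiteness of the set of classes with bounded projection
  is therefore proved in the abelianization itself, with rational coordinates that determine a class
  up to a finite set.\<close>

abbreviation list_prod :: "('a, 'x) monoid_scheme \<Rightarrow> 'a list \<Rightarrow> 'a" where
  "list_prod G ws \<equiv> foldr (\<otimes>\<^bsub>G\<^esub>) ws \<one>\<^bsub>G\<^esub>"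

declare lower_central.simps(2) [simp del]

context group
begin

lemma list_prod_closed [simp]: "set ws \<subseteq> carrier G \<Longrightarrow> list_prod G ws \<in> carrier G"
  by (induction ws) auto

lemma list_prod_append:
  "set us \<subseteq> carrier G \<Longrightarrow> set ws \<subseteq> carrier G \<Longrightarrow>
     list_prod G (us @ ws) = list_prod G us \<otimes> list_prod G ws"
  by (induction us) (auto simp: m_assoc simp del: foldr_append)

lemma list_prod_subgroup: "subgroup H G \<Longrightarrow> set ws \<subseteq> H \<Longrightarrow> list_prod G ws \<in> H"
  by (induction ws) (auto simp: subgroup.one_closed subgroup.m_closed)

lemma list_prod_rev_inv:
  "set ws \<subseteq> carrier G \<Longrightarrow> list_prod G (rev (map (m_inv G) ws)) = inv (list_prod G ws)"
proof (induction ws)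
  case (Cons w ws)
  have "list_prod G (rev (map (m_inv G) ws) @ [inv w]) = inv (list_prod G ws) \<otimes> inv w"
    using Cons by (subst list_prod_append) auto
  then show ?case using Cons by (simp add: inv_mult_group)
qed auto

text \<open>Moving p letters x past r letters y takes pr transpositions, and each releases one
  factor z, which commutes with both letters. With r = p this computes the commutator of two p-th
  powers.\<close>

lemma pow_mult_central:
  assumes "x \<in> carrier G" "y \<in> carrier G" "z \<in> carrier G"
    and "z \<otimes> x = x \<otimes> z" "z \<otimes> y = y \<otimes> z" "x \<otimes> y = z \<otimes> (y \<otimes> x)"
  shows "x [^] (p::nat) \<otimes> y [^] (r::nat) = z [^] (p * r) \<otimes> (y [^] r \<otimes> x [^] p)"
proof -
  have 1: "x \<otimes> y [^] r = z [^] r \<otimes> (y [^] r \<otimes> x)"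
  proof (induction r)
    case (Suc r)
    have "x \<otimes> y [^] Suc r = (x \<otimes> y [^] r) \<otimes> y" using assms by (simp add: m_assoc)
    also have "\<dots> = z [^] r \<otimes> (y [^] r \<otimes> (x \<otimes> y))" using assms(1-3) by (simp add: Suc m_assoc)
    also have "\<dots> = z [^] r \<otimes> ((y [^] r \<otimes> z) \<otimes> (y \<otimes> x))" using assms by (simp add: m_assoc)
    also have "y [^] r \<otimes> z = z \<otimes> y [^] r"
      by (rule group_commutes_pow) (use assms in auto)
    also have "z [^] r \<otimes> (z \<otimes> y [^] r \<otimes> (y \<otimes> x)) = z [^] Suc r \<otimes> (y [^] Suc r \<otimes> x)"
      using assms(1-3) by (simp add: m_assoc)
    finally show ?case .
  qed (use assms in auto)
  \<comment> \<open>With Y and Z in the roles of y and z, the relation just proved has the shape of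
    the hypothesis, and a second induction runs over p.\<close>
  define Y Z where "Y = y [^] r" and "Z = z [^] r"
  have [simp]: "Y \<in> carrier G" "Z \<in> carrier G" using assms by (auto simp: Y_def Z_def)
  have Zx: "Z \<otimes> x = x \<otimes> Z"
    unfolding Z_def by (rule group_commutes_pow) (use assms in auto)
  have "x [^] p \<otimes> Y = Z [^] p \<otimes> (Y \<otimes> x [^] p)"
  proof (induction p)
    case (Suc p)
    have "x [^] Suc p \<otimes> Y = (x [^] p \<otimes> Z) \<otimes> (Y \<otimes> x)"
      using assms(1-3) 1 by (simp add: m_assoc Y_def Z_def)
    also have "x [^] p \<otimes> Z = Z \<otimes> x [^] p"
      by (rule group_commutes_pow) (use assms Zx in auto)
    also have "Z \<otimes> x [^] p \<otimes> (Y \<otimes> x) = Z \<otimes> (x [^] p \<otimes> Y) \<otimes> x"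
      using assms(1-3) by (simp add: m_assoc)
    also have "\<dots> = (Z \<otimes> Z [^] p) \<otimes> (Y \<otimes> x [^] Suc p)"
      using assms(1-3) by (simp add: Suc m_assoc)
    also have "Z \<otimes> Z [^] p = Z [^] Suc p"
      by (rule nat_pow_Suc2[symmetric]) simp
    finally show ?case .
  qed (use assms in auto)
  then show ?thesis using assms by (simp add: Y_def Z_def nat_pow_pow mult.commute)
qed

section \<open>The lower central series: normality, descent and the commutator subgroup\<close>

lemma lower_central_subset: "lower_central G n \<subseteq> carrier G"
proof (induction n)
  case (Suc n)
  show ?case unfolding lower_central.simps
    by (rule generate_incl) (use Suc in auto)
qed auto

lemma commutator_in_lower_central:
  assumes "x \<in> lower_central G n" "y \<in> carrier G"
  shows "x \<otimes> y \<otimes> inv x \<otimes> inv y \<in> lower_central G (Suc n)"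
  using assms by (auto simp: lower_central.simps intro!: generate.incl)

text \<open>Conjugation carries the commutator of x and y to the commutator of their conjugates, and
  the conjugate of x stays in the previous term by induction. So the generating set itself is stable
  under conjugation.\<close>

lemma normal_lower_central: "lower_central G n \<lhd> G"
proof (induction n)
  case (Suc n)
  note sub = lower_central_subset[of n]
  show ?case unfolding lower_central.simps
  proof (rule normal_generateI)
    fix h g assume "h \<in> {x \<otimes> y \<otimes> inv x \<otimes> inv y | x y. x \<in> lower_central G n \<and> y \<in> carrier G}"
      and g: "g \<in> carrier G"
    then obtain x y where h: "h = x \<otimes> y \<otimes> inv x \<otimes> inv y" "x \<in> lower_central G n" "y \<in> carrier G"
      by auto
    have x: "x \<in> carrier G" using h sub by auto
    define x' y' where "x' = g \<otimes> x \<otimes> inv g" and "y' = g \<otimes> y \<otimes> inv g"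
    have "x' \<in> lower_central G n"
      using normal.inv_op_closed2[OF Suc g h(2)] by (simp add: x'_def)
    moreover have "y' \<in> carrier G" using g h by (auto simp: y'_def)
    moreover have "g \<otimes> h \<otimes> inv g = x' \<otimes> y' \<otimes> inv x' \<otimes> inv y'"
      using g h(3) x unfolding h(1) x'_def y'_def
      by (simp add: m_assoc inv_mult_group inv_solve_left' )
        (simp flip: m_assoc)
    ultimately show "g \<otimes> h \<otimes> inv g \<in>
      {x \<otimes> y \<otimes> inv x \<otimes> inv y | x y. x \<in> lower_central G n \<and> y \<in> carrier G}"
      by blast
  qed (use sub in auto)
qed (simp add: normal_self)

text \<open>The commutator of x and y is x times a conjugate of the inverse of x, hence lies in any
  normal subgroup containing x.\<close>

lemma lower_central_Suc_subset: "lower_central G (Suc n) \<subseteq> lower_central G n"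
proof -
  interpret K: normal "lower_central G n" G by (rule normal_lower_central)
  have "x \<otimes> y \<otimes> inv x \<otimes> inv y \<in> lower_central G n"
    if "x \<in> lower_central G n" "y \<in> carrier G" for x y
  proof -
    have "x \<otimes> (y \<otimes> inv x \<otimes> inv y) \<in> lower_central G n"
      using that by (intro K.m_closed K.inv_op_closed2) auto
    then show ?thesis using that K.subset by (auto simp: m_assoc)
  qed
  then show ?thesis unfolding lower_central.simps
    by (intro generate_subgroup_incl K.is_subgroup) auto
qed

text \<open>The abelianization is defined through \<open>derived\<close>, while the distortion
  estimate descends along \<open>lower_central\<close>; this is the bridge. Index 0 is the whole
  group, so the commutator subgroup has index 1.\<close>

lemma lower_central_one_eq_derived: "lower_central G 1 = derived G (carrier G)"
  unfolding derived_def by (simp add: lower_central.simps, rule arg_cong[where f = "generate G"]) auto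

end

section \<open>Sublinear distortion of the commutator subgroup\<close>

text \<open>These are the properties of word length on which the distortion estimates rest; the
  instance is \<open>group_length_word_length\<close>.\<close>

locale group_length = group G for G (structure) +
  fixes len :: "'a \<Rightarrow> real"
  assumes len_nonneg: "x \<in> carrier G \<Longrightarrow> 0 \<le> len x"
    and len_one: "len \<one> = 0"
    and len_mult: "x \<in> carrier G \<Longrightarrow> y \<in> carrier G \<Longrightarrow> len (x \<otimes> y) \<le> len x + len y"
    and len_inv: "x \<in> carrier G \<Longrightarrow> len (inv x) = len x"
begin

lemma len_pow: "x \<in> carrier G \<Longrightarrow> len (x [^] (n::nat)) \<le> n * len x"
proof (induction n)
  case (Suc n)
  then have "len (x [^] n \<otimes> x) \<le> n * len x + len x"
    using len_mult[of "x [^] n" x] by simp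
  then show ?case by (simp add: algebra_simps)
qed (simp add: len_one)

lemma len_list_prod:
  fixes B :: real
  assumes "set ws \<subseteq> carrier G" "\<And>w. w \<in> set ws \<Longrightarrow> len w \<le> B"
  shows "len (list_prod G ws) \<le> length ws * B"
  using assms
proof (induction ws)
  case (Cons w ws)
  then have "len (list_prod G (w # ws)) \<le> len w + len (list_prod G ws)"
    using len_mult[of w "list_prod G ws"] by simp
  also have "\<dots> \<le> B + length ws * B" using Cons by (intro add_mono) auto
  finally show ?case by (simp add: algebra_simps)
qed (simp add: len_one)

text \<open>The map q stands for a quotient homomorphism and v for a short lift of the a-th power of
  q z: the powers of z have sublinear length once the kernel of q is disregarded. Lifts take the
  place of a length on the quotient.\<close>

definition sublinear_powers :: "('c, 'd) monoid_scheme \<Rightarrow> ('a \<Rightarrow> 'c) \<Rightarrow> 'a \<Rightarrow> bool" where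
  "sublinear_powers Q q z \<longleftrightarrow>
     (\<forall>\<epsilon>>0::real. \<exists>A::real. \<forall>a::nat. \<exists>v\<in>carrier G. len v \<le> \<epsilon> * real a + A \<and> q v = q z [^]\<^bsub>Q\<^esub> a)"

text \<open>The reason is that \<open>[x, y]\<close> to the power \<open>p\<^sup>2\<close> is \<open>[x\<^sup>p, y\<^sup>p]\<close>, of length linear in \<open>p\<close>.\<close>

lemma sublinear_powers_commutator:
  assumes "group_hom G Q q" and x: "x \<in> carrier G" and y: "y \<in> carrier G"
    and z: "z = x \<otimes> y \<otimes> inv x \<otimes> inv y"
    and central: "\<And>g. g \<in> carrier G \<Longrightarrow> q z \<otimes>\<^bsub>Q\<^esub> q g = q g \<otimes>\<^bsub>Q\<^esub> q z"
  shows "sublinear_powers Q q z"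
  unfolding sublinear_powers_def
proof (intro allI impI)
  fix \<epsilon> :: real assume \<epsilon>: "\<epsilon> > 0"
  interpret q: group_hom G Q q by fact
  have zc: "z \<in> carrier G" using x y z by auto
  define K where "K = 2 * (len x + len y) + 2 * len z"
  have "\<exists>v\<in>carrier G. len v \<le> \<epsilon> * real a + K\<^sup>2 / (4 * \<epsilon>) \<and> q v = q z [^]\<^bsub>Q\<^esub> a" for a :: nat
  proof -
    \<comment> \<open>With p the integer square root, a = p^2 + r and r \<le> 2p. The square is one
      commutator of p-th powers, the remainder consists of r plain factors z, and the total length
      is at most K p.\<close>
    define p where "p = nat \<lfloor>sqrt (real a)\<rfloor>"
    have p1: "real p \<le> sqrt (real a)" "sqrt (real a) < real p + 1"
      by (auto simp: p_def of_nat_nat)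
    have pa: "real (p * p) \<le> real a"
      using power_mono[OF p1(1), of 2] by (simp add: power2_eq_square)
    have "real a < real ((p + 1) * (p + 1))"
      using power_strict_mono[OF p1(2), of 2] by (simp add: power2_eq_square algebra_simps)
    then have "a < (p + 1) * (p + 1)" by (simp only: of_nat_less_iff)
    then have "a \<le> p * p + 2 * p" by simp
    then have "real a \<le> real (p * p + 2 * p)" by (simp only: of_nat_le_iff)
    then have r: "real a - real (p * p) \<le> 2 * real p" by simp
    define r where "r = a - p * p"
    have a: "a = p * p + r" using pa by (simp add: r_def flip: of_nat_mult)
    have r2: "real r \<le> 2 * real p" using r a by simp
    define v where "v = (x [^] p \<otimes> y [^] p \<otimes> inv (x [^] p) \<otimes> inv (y [^] p)) \<otimes> z [^] r"
    have vc: "v \<in> carrier G" using x y zc by (auto simp: v_def)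
    have lx: "len (x [^] p) \<le> p * len x" and ly: "len (y [^] p) \<le> p * len y"
      and lz: "len (z [^] r) \<le> r * len z" using len_pow x y zc by auto
    have "len v \<le> len (x [^] p) + len (y [^] p) + len (inv (x [^] p)) + len (inv (y [^] p)) + len (z [^] r)"
      unfolding v_def using x y zc
      by (intro order_trans[OF len_mult] add_mono) auto
    also have "\<dots> \<le> 2 * (p * len x) + 2 * (p * len y) + r * len z"
      using lx ly lz x y by (simp add: len_inv)
    also have "\<dots> \<le> 2 * (p * len x) + 2 * (p * len y) + (2 * p) * len z"
      using r2 len_nonneg[OF zc] by (intro add_left_mono mult_right_mono) auto
    also have "\<dots> = K * p" by (simp add: K_def algebra_simps)
    also have "\<dots> \<le> \<epsilon> * (p * p) + K\<^sup>2 / (4 * \<epsilon>)"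
    proof -
      \<comment> \<open>Completing the square trades K p, of order sqrt a, for a small multiple of
        p^2 plus a constant; this is the origin of the additive constant K^2 / (4
        \<epsilon>).\<close>
      have "0 \<le> (2 * \<epsilon> * p - K)\<^sup>2 / (4 * \<epsilon>)" using \<epsilon> by simp
      also have "\<dots> = \<epsilon> * (p * p) + K\<^sup>2 / (4 * \<epsilon>) - K * p"
        using \<epsilon> by (simp add: field_simps power2_eq_square)
      finally show ?thesis by simp
    qed
    also have "\<dots> \<le> \<epsilon> * real a + K\<^sup>2 / (4 * \<epsilon>)"
      using pa \<epsilon> by (intro add_right_mono mult_left_mono) auto
    finally have len: "len v \<le> \<epsilon> * real a + K\<^sup>2 / (4 * \<epsilon>)" .
    have "x \<otimes> y = z \<otimes> (y \<otimes> x)"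
      using x y by (simp add: z m_assoc) (simp flip: m_assoc)
    then have "q x \<otimes>\<^bsub>Q\<^esub> q y = q z \<otimes>\<^bsub>Q\<^esub> (q y \<otimes>\<^bsub>Q\<^esub> q x)"
      using x y zc by (metis m_closed q.hom_mult)
    then have *: "q x [^]\<^bsub>Q\<^esub> p \<otimes>\<^bsub>Q\<^esub> q y [^]\<^bsub>Q\<^esub> p =
        q z [^]\<^bsub>Q\<^esub> (p * p) \<otimes>\<^bsub>Q\<^esub> (q y [^]\<^bsub>Q\<^esub> p \<otimes>\<^bsub>Q\<^esub> q x [^]\<^bsub>Q\<^esub> p)"
      using x y zc central by (intro q.H.pow_mult_central) auto
    have "q v = q x [^]\<^bsub>Q\<^esub> p \<otimes>\<^bsub>Q\<^esub> q y [^]\<^bsub>Q\<^esub> p \<otimes>\<^bsub>Q\<^esub> inv\<^bsub>Q\<^esub> (q x [^]\<^bsub>Q\<^esub> p)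
        \<otimes>\<^bsub>Q\<^esub> inv\<^bsub>Q\<^esub> (q y [^]\<^bsub>Q\<^esub> p) \<otimes>\<^bsub>Q\<^esub> q z [^]\<^bsub>Q\<^esub> r"
      using x y zc by (simp add: v_def q.hom_nat_pow)
    also have "\<dots> = q z [^]\<^bsub>Q\<^esub> (p * p) \<otimes>\<^bsub>Q\<^esub> q z [^]\<^bsub>Q\<^esub> r"
      unfolding * using x y zc by (simp add: q.H.m_assoc)
    also have "\<dots> = q z [^]\<^bsub>Q\<^esub> a" using zc by (simp add: a q.H.nat_pow_mult)
    finally show ?thesis using vc len by blast
  qed
  then show "\<exists>A. \<forall>a::nat. \<exists>v\<in>carrier G. len v \<le> \<epsilon> * real a + A \<and> q v = q z [^]\<^bsub>Q\<^esub> a" by blast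
qed

lemma sublinear_powers_one:
  assumes "group_hom G Q q"
  shows "sublinear_powers Q q \<one>"
proof -
  interpret q: group_hom G Q q by fact
  show ?thesis
    unfolding sublinear_powers_def
    by (intro allI impI exI[of _ 0] bexI[of _ \<one>]) (auto simp: len_one)
qed

lemma sublinear_powers_inv:
  assumes "group_hom G Q q" "z \<in> carrier G" "sublinear_powers Q q z"
  shows "sublinear_powers Q q (inv z)"
  unfolding sublinear_powers_def
proof (intro allI impI)
  fix \<epsilon> :: real assume "\<epsilon> > 0"
  interpret q: group_hom G Q q by fact
  obtain A where A: "\<forall>a::nat. \<exists>v\<in>carrier G. len v \<le> \<epsilon> * real a + A \<and> q v = q z [^]\<^bsub>Q\<^esub> a"
    using assms(3) \<open>\<epsilon> > 0\<close> unfolding sublinear_powers_def by blast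
  have "\<exists>v\<in>carrier G. len v \<le> \<epsilon> * real a + A \<and> q v = q (inv z) [^]\<^bsub>Q\<^esub> a" for a :: nat
  proof -
    obtain v where "v \<in> carrier G" "len v \<le> \<epsilon> * real a + A" "q v = q z [^]\<^bsub>Q\<^esub> a" using A by blast
    then show ?thesis
      using assms(2) by (intro bexI[of _ "inv v"]) (auto simp: len_inv q.H.nat_pow_inv)
  qed
  then show "\<exists>A. \<forall>a::nat. \<exists>v\<in>carrier G. len v \<le> \<epsilon> * real a + A \<and> q v = q (inv z) [^]\<^bsub>Q\<^esub> a" by blast
qed

text \<open>Since the images commute, the a-th power of the product is the product of the a-th
  powers, and the two lifts can be multiplied; each receives half of \<epsilon>.\<close>

lemma sublinear_powers_mult:
  assumes "group_hom G Q q" "x \<in> carrier G" "y \<in> carrier G"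
    and "sublinear_powers Q q x" "sublinear_powers Q q y"
    and comm: "q x \<otimes>\<^bsub>Q\<^esub> q y = q y \<otimes>\<^bsub>Q\<^esub> q x"
  shows "sublinear_powers Q q (x \<otimes> y)"
  unfolding sublinear_powers_def
proof (intro allI impI)
  fix \<epsilon> :: real assume "\<epsilon> > 0"
  then have e: "\<epsilon> / 2 > 0" by simp
  interpret q: group_hom G Q q by fact
  obtain A where A: "\<forall>a::nat. \<exists>v\<in>carrier G. len v \<le> \<epsilon> / 2 * real a + A \<and> q v = q x [^]\<^bsub>Q\<^esub> a"
    using assms(4) e unfolding sublinear_powers_def by blast
  obtain B where B: "\<forall>a::nat. \<exists>v\<in>carrier G. len v \<le> \<epsilon> / 2 * real a + B \<and> q v = q y [^]\<^bsub>Q\<^esub> a"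
    using assms(5) e unfolding sublinear_powers_def by blast
  have "\<exists>v\<in>carrier G. len v \<le> \<epsilon> * real a + (A + B) \<and> q v = q (x \<otimes> y) [^]\<^bsub>Q\<^esub> a" for a :: nat
  proof -
    obtain v where v: "v \<in> carrier G" "len v \<le> \<epsilon> / 2 * real a + A" "q v = q x [^]\<^bsub>Q\<^esub> a" using A by blast
    obtain w where w: "w \<in> carrier G" "len w \<le> \<epsilon> / 2 * real a + B" "q w = q y [^]\<^bsub>Q\<^esub> a" using B by blast
    have "len (v \<otimes> w) \<le> \<epsilon> * real a + (A + B)"
      using len_mult[OF v(1) w(1)] v(2) w(2) by (simp add: algebra_simps)
    moreover have "q (v \<otimes> w) = q (x \<otimes> y) [^]\<^bsub>Q\<^esub> a"
      using v w assms(2,3) q.H.pow_mult_distrib[OF comm] by simp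
    ultimately show ?thesis using v w by (intro bexI[of _ "v \<otimes> w"]) auto
  qed
  then show "\<exists>A. \<forall>a::nat. \<exists>v\<in>carrier G. len v \<le> \<epsilon> * real a + A \<and> q v = q (x \<otimes> y) [^]\<^bsub>Q\<^esub> a" by blast
qed

text \<open>The images of the letters are central, so all occurrences of one letter z can be
  gathered into a single power, which has a short lift; what remains is a word over a smaller
  alphabet. The constant A depends on the alphabet and on \<epsilon>, but not on the word.\<close>

lemma sublinear_list_prod_central:
  fixes \<epsilon> :: real
  assumes "group_hom G Q q" "finite Z" "Z \<subseteq> carrier G"
    and "\<And>z. z \<in> Z \<Longrightarrow> sublinear_powers Q q z"
    and "\<And>z g. z \<in> Z \<Longrightarrow> g \<in> carrier G \<Longrightarrow> q z \<otimes>\<^bsub>Q\<^esub> q g = q g \<otimes>\<^bsub>Q\<^esub> q z"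
    and "\<epsilon> > 0"
  shows "\<exists>A::real. \<forall>zs. set zs \<subseteq> Z \<longrightarrow>
    (\<exists>v\<in>carrier G. len v \<le> \<epsilon> * real (length zs) + A \<and> q v = q (list_prod G zs))"
  using assms(2-6)
proof (induction Z arbitrary: \<epsilon> rule: finite_induct)
  case empty
  show ?case by (rule exI[of _ 0]) (auto intro!: bexI[of _ \<one>] simp: len_one)
next
  case (insert z Z)
  interpret q: group_hom G Q q by fact
  have e: "\<epsilon> / 2 > 0" and z: "z \<in> carrier G" using insert.prems by auto
  obtain A where A: "\<And>zs. set zs \<subseteq> Z \<Longrightarrow>
      \<exists>v\<in>carrier G. len v \<le> \<epsilon> / 2 * real (length zs) + A \<and> q v = q (list_prod G zs)"
    using insert.IH[OF _ _ _ e] insert.prems by (metis insert_subset insertCI)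
  obtain B where B: "\<forall>a::nat. \<exists>v\<in>carrier G. len v \<le> \<epsilon> / 2 * real a + B \<and> q v = q z [^]\<^bsub>Q\<^esub> a"
    using insert.prems(2)[of z] e unfolding sublinear_powers_def by blast
  have comm: "q z [^]\<^bsub>Q\<^esub> (n::nat) \<otimes>\<^bsub>Q\<^esub> q g = q g \<otimes>\<^bsub>Q\<^esub> q z [^]\<^bsub>Q\<^esub> n" if "g \<in> carrier G" for n g
    by (rule q.H.group_commutes_pow) (use insert.prems(3) z that in auto)
  have split: "q (list_prod G zs) =
      q z [^]\<^bsub>Q\<^esub> (length (filter ((=) z) zs)) \<otimes>\<^bsub>Q\<^esub> q (list_prod G (filter ((\<noteq>) z) zs))"
    if "set zs \<subseteq> carrier G" for zs
    using that
  proof (induction zs)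
    case (Cons w zs)
    define n ys where "n = length (filter ((=) z) zs)" and "ys = list_prod G (filter ((\<noteq>) z) zs)"
    have ys: "ys \<in> carrier G" unfolding ys_def using Cons.prems by (intro list_prod_closed) auto
    have IH: "q (list_prod G zs) = q z [^]\<^bsub>Q\<^esub> n \<otimes>\<^bsub>Q\<^esub> q ys"
      using Cons by (auto simp: n_def ys_def)
    have w: "w \<in> carrier G" "set zs \<subseteq> carrier G" using Cons.prems by auto
    have **: "q (list_prod G (w # zs)) = (q w \<otimes>\<^bsub>Q\<^esub> q z [^]\<^bsub>Q\<^esub> n) \<otimes>\<^bsub>Q\<^esub> q ys"
      using w ys z by (simp add: IH q.H.m_assoc)
    show ?case
    proof (cases "w = z")
      case True
      then have "q w \<otimes>\<^bsub>Q\<^esub> q z [^]\<^bsub>Q\<^esub> n = q z [^]\<^bsub>Q\<^esub> Suc n"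
        using comm[OF z, of n] by simp
      then show ?thesis using True ** by (simp add: n_def ys_def)
    next
      case False
      then show ?thesis
        using ** w ys z comm[of w n, symmetric] by (simp add: q.H.m_assoc flip: n_def ys_def)
    qed
  qed auto
  show ?case
  proof (rule exI[of _ "A + B"], intro allI impI)
    fix zs assume zs: "set zs \<subseteq> insert z Z"
    define n where "n = length (filter ((=) z) zs)"
    define ys where "ys = filter ((\<noteq>) z) zs"
    have "set ys \<subseteq> Z" using zs by (auto simp: ys_def)
    then obtain v where v: "v \<in> carrier G" "len v \<le> \<epsilon> / 2 * real (length ys) + A" "q v = q (list_prod G ys)"
      using A by blast
    obtain w where w: "w \<in> carrier G" "len w \<le> \<epsilon> / 2 * n + B" "q w = q z [^]\<^bsub>Q\<^esub> n"
      using B by blast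
    have "n \<le> length zs" "length ys \<le> length zs" by (auto simp: n_def ys_def)
    then have "\<epsilon> / 2 * n \<le> \<epsilon> / 2 * real (length zs)" "\<epsilon> / 2 * real (length ys) \<le> \<epsilon> / 2 * real (length zs)"
      using e by (auto intro!: mult_left_mono)
    then have "len (w \<otimes> v) \<le> \<epsilon> * real (length zs) + (A + B)"
      using len_mult[OF w(1) v(1)] v(2) w(2) by (simp add: algebra_simps)
    moreover have "q (w \<otimes> v) = q (list_prod G zs)"
    proof -
      have "set zs \<subseteq> carrier G" using zs insert.prems(1) by blast
      then show ?thesis using v w split[of zs] by (simp add: n_def ys_def)
    qed
    ultimately show "\<exists>v\<in>carrier G. len v \<le> \<epsilon> * real (length zs) + (A + B) \<and> q v = q (list_prod G zs)"
      using v w by (intro bexI[of _ "w \<otimes> v"]) auto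
  qed
qed

text \<open>The relation R says in which sense the short element u approximates the product: up to
  an error in a term of the lower central series, or equality of images under a quotient
  map.\<close>

definition sublinear_products :: "('a \<Rightarrow> 'a \<Rightarrow> bool) \<Rightarrow> 'a set \<Rightarrow> bool" where
  "sublinear_products R F \<longleftrightarrow>
     (\<forall>\<epsilon>>0::real. \<exists>A::real. \<forall>ws. set ws \<subseteq> F \<longrightarrow>
        (\<exists>u\<in>carrier G. len u \<le> \<epsilon> * real (length ws) + A \<and> R u (list_prod G ws)))"

text \<open>
  A long word is cut into blocks of a fixed length \<open>m\<close>. Each block is \<open>u \<otimes> z\<close> with \<open>u\<close> short and
  \<open>z\<close> in a finite set depending on \<open>m\<close>; modulo the kernel of \<open>q\<close> the factors \<open>z\<close> are central, hence
  can be collected.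
\<close>

lemma sublinear_products_refine:
  assumes "group_hom G Q q" "finite F" "F \<subseteq> carrier G" "K \<subseteq> carrier G"
    and sub: "\<And>z. z \<in> K \<Longrightarrow> sublinear_powers Q q z"
    and central: "\<And>z g. z \<in> K \<Longrightarrow> g \<in> carrier G \<Longrightarrow> q z \<otimes>\<^bsub>Q\<^esub> q g = q g \<otimes>\<^bsub>Q\<^esub> q z"
    and prods: "sublinear_products (\<lambda>u p. inv u \<otimes> p \<in> K) F"
  shows "sublinear_products (\<lambda>u p. q u = q p) F"
  unfolding sublinear_products_def
proof (intro allI impI)
  fix \<epsilon> :: real assume \<epsilon>: "\<epsilon> > 0"
  interpret q: group_hom G Q q by fact
  obtain A where A: "\<And>ws. set ws \<subseteq> F \<Longrightarrow>
      \<exists>u\<in>carrier G. len u \<le> \<epsilon> / 4 * real (length ws) + A \<and> inv u \<otimes> list_prod G ws \<in> K"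
    using prods \<epsilon> unfolding sublinear_products_def by (metis divide_pos_pos zero_less_numeral)
  \<comment> \<open>Fixing one approximant for each word leaves one error per word, so the words of
    a given length have only finitely many errors.\<close>
  obtain U where U: "\<And>ws. set ws \<subseteq> F \<Longrightarrow> U ws \<in> carrier G \<and> len (U ws) \<le> \<epsilon> / 4 * real (length ws) + A
      \<and> inv (U ws) \<otimes> list_prod G ws \<in> K"
    using A by metis
  \<comment> \<open>The block length is chosen so large that the additive constant A, paid once per
    block, is at most \<epsilon> m / 4. The short part of a block then costs at most \<epsilon> / 2
    per letter.\<close>
  define m where "m = nat \<lceil>4 * A / \<epsilon>\<rceil> + 1"
  have m0: "m > 0" by (simp add: m_def)
  have "4 * A / \<epsilon> \<le> m" unfolding m_def by linarith
  then have mA: "A \<le> \<epsilon> / 4 * m" using \<epsilon> by (simp add: field_simps)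
  define W where "W = {ws. set ws \<subseteq> F \<and> length ws = m}"
  define Z where "Z = (\<lambda>ws. inv (U ws) \<otimes> list_prod G ws) ` W"
  have "finite Z" unfolding Z_def W_def using assms(2) by (intro finite_imageI finite_lists_length_eq)
  have ZK: "Z \<subseteq> K" using U by (auto simp: Z_def W_def)
  have e4: "\<epsilon> / 4 * m > 0" using \<epsilon> m0 by simp
  \<comment> \<open>The error set Z depends on m, so its constant is chosen after m. There is at
    most one error per m letters, so the generous rate \<epsilon> m / 4 per error is only \<epsilon>
    / 4 per letter.\<close>
  obtain B where B: "\<And>zs. set zs \<subseteq> Z \<Longrightarrow>
      \<exists>v\<in>carrier G. len v \<le> \<epsilon> / 4 * m * real (length zs) + B \<and> q v = q (list_prod G zs)"
    using sublinear_list_prod_central[OF assms(1) \<open>finite Z\<close> _ _ _ e4] ZK assms(4) sub central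
    by (smt (verit, del_insts) subset_iff)
  obtain b where b: "\<And>w. w \<in> F \<Longrightarrow> len w \<le> b" and b0: "b \<ge> 0"
  proof
    show "len w \<le> Max (insert 0 (len ` F))" if "w \<in> F" for w using that assms(2) by simp
    show "Max (insert 0 (len ` F)) \<ge> 0" using assms(2) by simp
  qed
  \<comment> \<open>Here u multiplies the short parts of all complete blocks and the incomplete last
    one, whose fewer than m letters account for m * b. The errors zs are moved to the right, past
    the later short parts, by centrality.\<close>
  have blocks: "\<exists>u\<in>carrier G. \<exists>zs. set zs \<subseteq> Z \<and> m * length zs \<le> length ws \<and>
      len u \<le> \<epsilon> / 2 * real (length ws) + m * b \<and> q (list_prod G ws) = q u \<otimes>\<^bsub>Q\<^esub> q (list_prod G zs)"
    if "set ws \<subseteq> F" for ws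
    using that
  proof (induction ws rule: length_induct)
    case (1 ws)
    have wsG: "set ws \<subseteq> carrier G" using 1(2) assms(3) by blast
    show ?case
    proof (cases "length ws < m")
      case True
      have "len (list_prod G ws) \<le> length ws * b" by (rule len_list_prod) (use wsG b 1(2) in auto)
      also have "\<dots> \<le> m * b" using True b0 by (intro mult_right_mono) auto
      also have "\<dots> \<le> \<epsilon> / 2 * real (length ws) + m * b" using \<epsilon> by simp
      finally show ?thesis using wsG
        by (intro bexI[of _ "list_prod G ws"] exI[of _ "[]"]) auto
    next
      case False
      define w1 w2 where "w1 = take m ws" and "w2 = drop m ws"
      have len: "length w1 = m" "length ws = m + length w2" using False by (auto simp: w1_def w2_def)
      have "set (w1 @ w2) \<subseteq> F" using 1(2) by (simp add: w1_def w2_def)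
      then have F: "set w1 \<subseteq> F" "set w2 \<subseteq> F" by auto
      have "length w2 < length ws" using len m0 by simp
      then obtain u zs where u: "u \<in> carrier G" "set zs \<subseteq> Z" "m * length zs \<le> length w2"
        "len u \<le> \<epsilon> / 2 * real (length w2) + m * b" "q (list_prod G w2) = q u \<otimes>\<^bsub>Q\<^esub> q (list_prod G zs)"
        using 1(1) F(2) by blast
      define z where "z = inv (U w1) \<otimes> list_prod G w1"
      have U1: "U w1 \<in> carrier G" "len (U w1) \<le> \<epsilon> / 4 * m + A" using U[OF F(1)] len by auto
      have z: "z \<in> Z" using F len by (auto simp: z_def Z_def W_def)
      then have zG: "z \<in> carrier G" using ZK assms(4) by blast
      have zsG: "set zs \<subseteq> carrier G" using u(2) ZK assms(4) by blast
      have w1G: "list_prod G w1 \<in> carrier G" using F(1) assms(3) by (intro list_prod_closed) auto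
      have "list_prod G w1 = U w1 \<otimes> z" using U1 w1G by (simp add: z_def flip: m_assoc)
      then have "q (list_prod G w1) = q (U w1) \<otimes>\<^bsub>Q\<^esub> q z" using U1 zG by simp
      moreover have "list_prod G ws = list_prod G w1 \<otimes> list_prod G w2"
        using list_prod_append[of w1 w2] F assms(3) by (simp add: w1_def w2_def del: foldr_append)
      moreover have "list_prod G w2 \<in> carrier G" using F(2) assms(3) by (intro list_prod_closed) auto
      ultimately have "q (list_prod G ws) = q (U w1) \<otimes>\<^bsub>Q\<^esub> (q z \<otimes>\<^bsub>Q\<^esub> q u) \<otimes>\<^bsub>Q\<^esub> q (list_prod G zs)"
        using u U1 zG w1G zsG by (simp add: q.H.m_assoc)
      also have "q z \<otimes>\<^bsub>Q\<^esub> q u = q u \<otimes>\<^bsub>Q\<^esub> q z" using central z ZK u(1) by blast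
      finally have "q (list_prod G ws) = q (U w1 \<otimes> u) \<otimes>\<^bsub>Q\<^esub> q (list_prod G (z # zs))"
        using u U1 zG zsG by (simp add: q.H.m_assoc)
      moreover have "len (U w1 \<otimes> u) \<le> \<epsilon> / 2 * real (length ws) + m * b"
        using len_mult[OF U1(1) u(1)] U1(2) u(4) mA len by (simp add: algebra_simps)
      moreover have "set (z # zs) \<subseteq> Z" "m * length (z # zs) \<le> length ws"
        using u z len by auto
      ultimately show ?thesis using u(1) U1(1) by blast
    qed
  qed
  show "\<exists>A. \<forall>ws. set ws \<subseteq> F \<longrightarrow>
      (\<exists>u\<in>carrier G. len u \<le> \<epsilon> * real (length ws) + A \<and> q u = q (list_prod G ws))"
  proof (rule exI[of _ "m * b + B"], intro allI impI)
    fix ws assume ws: "set ws \<subseteq> F"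
    obtain u zs where u: "u \<in> carrier G" "set zs \<subseteq> Z" "m * length zs \<le> length ws"
      "len u \<le> \<epsilon> / 2 * real (length ws) + m * b" "q (list_prod G ws) = q u \<otimes>\<^bsub>Q\<^esub> q (list_prod G zs)"
      using blocks[OF ws] by blast
    obtain v where v: "v \<in> carrier G" "len v \<le> \<epsilon> / 4 * m * real (length zs) + B" "q v = q (list_prod G zs)"
      using B[OF u(2)] by blast
    have "real m * real (length zs) \<le> length ws" using u(3) by (simp flip: of_nat_mult)
    then have "\<epsilon> / 4 * (m * real (length zs)) \<le> \<epsilon> / 4 * real (length ws)" using \<epsilon> by (intro mult_left_mono) auto
    moreover have "\<epsilon> / 4 * real (length ws) \<le> \<epsilon> / 2 * real (length ws)" using \<epsilon> by (intro mult_right_mono) auto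
    ultimately have "len (u \<otimes> v) \<le> \<epsilon> * real (length ws) + (m * b + B)"
      using len_mult[OF u(1) v(1)] u(4) v(2) by (simp add: algebra_simps)
    then show "\<exists>u\<in>carrier G. len u \<le> \<epsilon> * real (length ws) + (m * b + B) \<and> q u = q (list_prod G ws)"
      using u v by (intro bexI[of _ "u \<otimes> v"]) auto
  qed
qed

text \<open>At the start the product itself is the error and u is trivial. In the inductive step the
  current term becomes central modulo the next one, and it is generated by commutators, whose powers
  are short there; products and inverses inherit this, so \<open>sublinear_products_refine\<close>
  absorbs the errors of the current term.\<close>

lemma sublinear_products_lower_central:
  assumes "finite F" "F \<subseteq> lower_central G 1"
  shows "sublinear_products (\<lambda>u p. inv u \<otimes> p \<in> lower_central G (Suc k)) F"
proof (induction k)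
  case 0
  have "list_prod G ws \<in> carrier G \<and> list_prod G ws \<in> lower_central G 1" if "set ws \<subseteq> F" for ws
  proof -
    have "list_prod G ws \<in> lower_central G 1"
      using that assms(2) by (intro list_prod_subgroup normal_imp_subgroup normal_lower_central) auto
    then show ?thesis using lower_central_subset by blast
  qed
  then show ?case
    unfolding sublinear_products_def
    by (intro allI impI exI[of _ 0] bexI[of _ \<one>])
      (auto simp: len_one)
next
  case (Suc k)
  let ?K = "lower_central G (Suc k)" and ?K' = "lower_central G (Suc (Suc k))"
  define Q where "Q = G Mod ?K'"
  define q where "q = (\<lambda>x. ?K' #> x)"
  interpret K': normal ?K' G by (rule normal_lower_central)
  have hom: "group_hom G Q q"
    unfolding group_hom_def group_hom_axioms_def Q_def q_def
    using K'.r_coset_hom_Mod K'.factorgroup_is_group is_group by simp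
  interpret q: group_hom G Q q by (rule hom)
  have FG: "F \<subseteq> carrier G" using assms(2) lower_central_subset by blast
  have eq_iff: "q x = q y \<longleftrightarrow> inv x \<otimes> y \<in> ?K'" if "x \<in> carrier G" "y \<in> carrier G" for x y
  proof -
    have "q x = q y \<longleftrightarrow> \<one>\<^bsub>Q\<^esub> = inv\<^bsub>Q\<^esub> q x \<otimes>\<^bsub>Q\<^esub> q y"
      using q.H.inv_solve_left[of "\<one>\<^bsub>Q\<^esub>" "q x" "q y"] that by (metis q.H.one_closed q.H.r_one q.hom_closed)
    also have "\<dots> \<longleftrightarrow> ?K' #> (inv x \<otimes> y) = ?K'"
      using that by (metis Q_def inv_closed m_closed one_FactGroup q.hom_inv q.hom_mult q_def)
    also have "\<dots> \<longleftrightarrow> inv x \<otimes> y \<in> ?K'"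
      using coset_join1[OF _ _ K'.is_subgroup] coset_join2[OF _ K'.is_subgroup]
        m_closed[OF inv_closed[OF that(1)] that(2)] by blast
    finally show ?thesis .
  qed
  have central: "q z \<otimes>\<^bsub>Q\<^esub> q g = q g \<otimes>\<^bsub>Q\<^esub> q z" if "z \<in> ?K" "g \<in> carrier G" for z g
  proof -
    have z: "z \<in> carrier G" using that lower_central_subset by blast
    \<comment> \<open>The quotient of zg by gz is the commutator of the inverses of z and g, so it
      lies in the next term of the series.\<close>
    have "inv z \<otimes> inv g \<otimes> inv (inv z) \<otimes> inv (inv g) \<in> ?K'"
      using that by (intro commutator_in_lower_central)
        (auto intro: subgroup.m_inv_closed normal_imp_subgroup normal_lower_central)
    then have "inv (g \<otimes> z) \<otimes> (z \<otimes> g) \<in> ?K'"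
      using z that by (simp add: inv_mult_group m_assoc)
    then have "q (g \<otimes> z) = q (z \<otimes> g)"
      using eq_iff[of "g \<otimes> z" "z \<otimes> g"] z that by blast
    then show ?thesis using q.hom_mult[of g z] q.hom_mult[of z g] z that(2) by metis
  qed
  have sub: "sublinear_powers Q q z" if "z \<in> ?K" for z
  proof -
    have "z \<in> generate G {x \<otimes> y \<otimes> inv x \<otimes> inv y | x y. x \<in> lower_central G k \<and> y \<in> carrier G}"
      using that unfolding lower_central.simps .
    then show ?thesis
    proof (induction rule: generate.induct)
      case (incl h)
      then obtain x y where h: "h = x \<otimes> y \<otimes> inv x \<otimes> inv y" "x \<in> lower_central G k" "y \<in> carrier G"
        by auto
      show ?case
        using h lower_central_subset[of k] commutator_in_lower_central[OF h(2,3)] central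
        by (intro sublinear_powers_commutator[OF hom _ _ h(1)]) auto
    next
      case (inv h)
      then obtain x y where h: "h = x \<otimes> y \<otimes> inv x \<otimes> inv y" "x \<in> lower_central G k" "y \<in> carrier G"
        by auto
      have "sublinear_powers Q q h"
        using h lower_central_subset[of k] commutator_in_lower_central[OF h(2,3)] central
        by (intro sublinear_powers_commutator[OF hom _ _ h(1)]) auto
      then show ?case using h lower_central_subset[of k]
        by (intro sublinear_powers_inv[OF hom]) auto
    next
      case (eng x y)
      then have "x \<in> ?K" "y \<in> ?K" unfolding lower_central.simps by blast+
      then show ?case
        using eng lower_central_subset[of "Suc k"] central[of x y]
        by (intro sublinear_powers_mult[OF hom]) auto
    qed (rule sublinear_powers_one[OF hom])
  qed
  have "sublinear_products (\<lambda>u p. q u = q p) F"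
    using lower_central_subset[of "Suc k"]
    by (intro sublinear_products_refine[OF hom assms(1) FG _ sub central Suc]) auto
  then show ?case
    unfolding sublinear_products_def using eq_iff FG
    by (smt (verit, best) list_prod_closed subset_trans)
qed

text \<open>At the trivial end of the series the error vanishes, and the short approximant is the
  product itself.\<close>

lemma nilpotent_derived_sublinear:
  fixes \<epsilon> :: real
  assumes "nilpotent_group G" "finite F" "F \<subseteq> lower_central G 1" "\<epsilon> > 0"
  obtains A where "\<And>ws. set ws \<subseteq> F \<Longrightarrow> len (list_prod G ws) \<le> \<epsilon> * real (length ws) + A"
proof -
  obtain n where "lower_central G n = {\<one>}" using assms(1) by (auto simp: nilpotent_group_def)
  \<comment> \<open>The descent speaks of terms of successor index only, hence one more step down
    from n.\<close>
  then have 1: "lower_central G (Suc n) \<subseteq> {\<one>}" using lower_central_Suc_subset by metis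
  obtain A where A: "\<And>ws. set ws \<subseteq> F \<Longrightarrow>
      \<exists>u\<in>carrier G. len u \<le> \<epsilon> * real (length ws) + A \<and> inv u \<otimes> list_prod G ws \<in> lower_central G (Suc n)"
    using sublinear_products_lower_central[OF assms(2,3), of n] assms(4)
    unfolding sublinear_products_def by blast
  have FG: "F \<subseteq> carrier G" using assms(3) lower_central_subset by blast
  show thesis
  proof
    fix ws assume ws: "set ws \<subseteq> F"
    obtain u where u: "u \<in> carrier G" "len u \<le> \<epsilon> * real (length ws) + A" "inv u \<otimes> list_prod G ws = \<one>"
      using A[OF ws] 1 by blast
    have "list_prod G ws \<in> carrier G" using ws FG by (intro list_prod_closed) auto
    then have "list_prod G ws = u" using u by (metis inv_closed inv_equality inv_inv)
    then show "len (list_prod G ws) \<le> \<epsilon> * real (length ws) + A" using u by simp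
  qed
qed

end

section \<open>Normed real spaces with explicit carrier\<close>

locale real_space = abelian_group V for V :: "(real, 'v) module" (structure) +
  assumes smult_closed [simp]: "v \<in> carrier V \<Longrightarrow> a \<odot> v \<in> carrier V"
    and smult_l_distr: "v \<in> carrier V \<Longrightarrow> (a + b) \<odot> v = a \<odot> v \<oplus> b \<odot> v"
    and smult_r_distr: "u \<in> carrier V \<Longrightarrow> v \<in> carrier V \<Longrightarrow> a \<odot> (u \<oplus> v) = a \<odot> u \<oplus> a \<odot> v"
    and smult_assoc: "v \<in> carrier V \<Longrightarrow> (a * b) \<odot> v = a \<odot> (b \<odot> v)"
    and smult_one [simp]: "v \<in> carrier V \<Longrightarrow> 1 \<odot> v = v"
begin

lemma smult_zero_left [simp]: "v \<in> carrier V \<Longrightarrow> 0 \<odot> v = \<zero>"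
  using smult_l_distr[of v 0 0] by (metis add.l_cancel_one' add_0 smult_closed)

lemma smult_zero_right [simp]: "a \<odot> \<zero> = \<zero>"
  using smult_r_distr[of \<zero> \<zero> a] by (metis add.l_cancel_one' l_zero zero_closed smult_closed)

lemma smult_minus_left: "v \<in> carrier V \<Longrightarrow> (- a) \<odot> v = \<ominus> (a \<odot> v)"
  using smult_l_distr[of v "- a" a] by (simp add: minus_equality)

lemma minus_eq_smult: "v \<in> carrier V \<Longrightarrow> \<ominus> v = (- 1) \<odot> v"
  using smult_minus_left[of v 1] by simp

lemma smult_minus_right: "v \<in> carrier V \<Longrightarrow> a \<odot> (\<ominus> v) = \<ominus> (a \<odot> v)"
  by (simp add: minus_eq_smult flip: smult_assoc)

lemma smult_diff: "u \<in> carrier V \<Longrightarrow> v \<in> carrier V \<Longrightarrow> a \<odot> (u \<ominus> v) = a \<odot> u \<ominus> a \<odot> v"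
  by (simp add: minus_eq smult_r_distr smult_minus_right)

lemma smult_diff_left: "v \<in> carrier V \<Longrightarrow> (a - b) \<odot> v = a \<odot> v \<ominus> b \<odot> v"
  using smult_l_distr[of v a "- b"] by (simp add: minus_eq smult_minus_left)

lemma diff_closed [simp]: "u \<in> carrier V \<Longrightarrow> v \<in> carrier V \<Longrightarrow> u \<ominus> v \<in> carrier V"
  by (simp add: minus_eq)

lemma diff_eq_zero_iff: "u \<in> carrier V \<Longrightarrow> v \<in> carrier V \<Longrightarrow> u \<ominus> v = \<zero> \<longleftrightarrow> u = v"
  using add.inv_solve_right'[of \<zero> u v] by (simp add: minus_eq)

lemma diff_add_cancel: "u \<in> carrier V \<Longrightarrow> v \<in> carrier V \<Longrightarrow> (u \<ominus> v) \<oplus> v = u"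
  by (simp add: minus_eq a_assoc l_neg)

lemma add_diff_cancel: "u \<in> carrier V \<Longrightarrow> v \<in> carrier V \<Longrightarrow> (u \<oplus> v) \<ominus> v = u"
  by (simp add: minus_eq a_assoc r_neg)

lemma add_diff_swap:
  "\<lbrakk>u \<in> carrier V; v \<in> carrier V; w \<in> carrier V; x \<in> carrier V\<rbrakk> \<Longrightarrow>
     (u \<oplus> v) \<ominus> (w \<oplus> x) = (u \<ominus> w) \<oplus> (v \<ominus> x)"
  by (simp add: minus_eq minus_add a_ac)

section \<open>Subspaces and spans of finite lists\<close>

definition subspace_on :: "'v set \<Rightarrow> bool" where
  "subspace_on W \<longleftrightarrow> W \<subseteq> carrier V \<and> \<zero> \<in> W \<and> (\<forall>u\<in>W. \<forall>v\<in>W. u \<oplus> v \<in> W) \<and> (\<forall>a. \<forall>v\<in>W. a \<odot> v \<in> W)"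

lemma subspace_diff: "subspace_on W \<Longrightarrow> u \<in> W \<Longrightarrow> v \<in> W \<Longrightarrow> u \<ominus> v \<in> W"
  using minus_eq_smult[of v] by (simp add: subspace_on_def minus_eq subset_iff)

text \<open>Adding one vector at a time fits the inductions to come: elimination, closedness and the
  rounding of coefficients each treat a single summand t u. The list may be linearly
  dependent.\<close>

primrec list_span :: "'v list \<Rightarrow> 'v set" where
  "list_span [] = {\<zero>}"
| "list_span (u # us) = {w \<oplus> t \<odot> u | w t. w \<in> list_span us}"

lemma subspace_list_span: "set us \<subseteq> carrier V \<Longrightarrow> subspace_on (list_span us)"
proof (induction us)
  case (Cons u us)
  then have u: "u \<in> carrier V" and W: "subspace_on (list_span us)" by auto
  note W = W[unfolded subspace_on_def]
  have add: "(w \<oplus> t \<odot> u) \<oplus> (w' \<oplus> t' \<odot> u) = (w \<oplus> w') \<oplus> (t + t') \<odot> u"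
    if "w \<in> list_span us" "w' \<in> list_span us" for w w' t t'
  proof -
    have "w \<in> carrier V" "w' \<in> carrier V" using that W by auto
    then show ?thesis using u by (simp add: smult_l_distr a_ac)
  qed
  have smult: "a \<odot> (w \<oplus> t \<odot> u) = a \<odot> w \<oplus> (a * t) \<odot> u" if "w \<in> list_span us" for w a t
    using that W u by (simp add: smult_r_distr smult_assoc subset_iff)
  have "\<zero> = \<zero> \<oplus> 0 \<odot> u" using u by simp
  then have "\<zero> \<in> list_span (u # us)" using W unfolding list_span.simps by blast
  moreover have "x \<oplus> y \<in> list_span (u # us)" if "x \<in> list_span (u # us)" "y \<in> list_span (u # us)" for x y
    using that W add unfolding list_span.simps by (smt (verit, best) mem_Collect_eq)
  moreover have "a \<odot> x \<in> list_span (u # us)" if "x \<in> list_span (u # us)" for a x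
    using that W smult unfolding list_span.simps by (smt (verit, best) mem_Collect_eq)
  moreover have "list_span (u # us) \<subseteq> carrier V" using W u by auto
  ultimately show ?case unfolding subspace_on_def by blast
qed (auto simp: subspace_on_def)

lemma list_span_minimal: "subspace_on W \<Longrightarrow> set us \<subseteq> W \<Longrightarrow> list_span us \<subseteq> W"
  by (induction us) (auto simp: subspace_on_def)

lemma list_span_superset: "set us \<subseteq> carrier V \<Longrightarrow> set us \<subseteq> list_span us"
proof (induction us)
  case (Cons u us)
  have W: "subspace_on (list_span us)" using Cons by (intro subspace_list_span) auto
  have "u = \<zero> \<oplus> 1 \<odot> u" using Cons by simp
  then have "u \<in> list_span (u # us)" using W unfolding subspace_on_def list_span.simps by blast
  moreover have "w \<in> list_span (u # us)" if "w \<in> list_span us" for w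
  proof -
    have "w = w \<oplus> 0 \<odot> u" using that W Cons.prems by (auto simp: subspace_on_def)
    then show ?thesis using that unfolding list_span.simps by blast
  qed
  ultimately show ?case using Cons by auto
qed auto

text \<open>If X is not contained in the span of the tail, some x in X has a nonzero coefficient t
  at u. Subtracting s / t times x from a vector with coefficient s moves it into the tail, so X is
  spanned by x together with its part in the tail. The result makes kernels of functionals finitely
  spanned, hence closed.\<close>

lemma subspace_of_list_span:
  assumes "subspace_on X" "set us \<subseteq> carrier V" "X \<subseteq> list_span us"
  obtains vs where "set vs \<subseteq> carrier V" "X = list_span vs"
  using assms
proof (induction us arbitrary: X thesis)
  case Nil
  then have "X = list_span []" by (auto simp: subspace_on_def)
  then show ?case using Nil.prems(1)[of "[]"] by auto
next
  case (Cons u us)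
  have u: "u \<in> carrier V" and us: "set us \<subseteq> carrier V" using Cons.prems by auto
  have W: "subspace_on (list_span us)" using us by (rule subspace_list_span)
  have "subspace_on (X \<inter> list_span us)" using W Cons.prems by (auto simp: subspace_on_def)
  then obtain vs where vs: "set vs \<subseteq> carrier V" "X \<inter> list_span us = list_span vs"
    using Cons.IH us by (metis inf_le2)
  show ?case
  proof (cases "X \<subseteq> list_span us")
    case True
    then show ?thesis using vs Cons.prems(1) by (simp add: Int_absorb2)
  next
    case False
    then obtain x where x: "x \<in> X" "x \<notin> list_span us" by blast
    then obtain w t where wt: "x = w \<oplus> t \<odot> u" "w \<in> list_span us" using Cons.prems by auto
    have wV: "w \<in> carrier V" using wt W by (auto simp: subspace_on_def)
    have t: "t \<noteq> 0" using x wt u wV by auto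
    have xV: "x \<in> carrier V" using x Cons.prems by (auto simp: subspace_on_def)
    have "X = list_span (x # vs)"
    proof
      show "X \<subseteq> list_span (x # vs)"
      proof
        fix y assume y: "y \<in> X"
        then obtain w' s where ws: "y = w' \<oplus> s \<odot> u" "w' \<in> list_span us" using Cons.prems by auto
        have w'V: "w' \<in> carrier V" using ws W by (auto simp: subspace_on_def)
        define z where "z = y \<ominus> (s / t) \<odot> x"
        have "z \<in> X"
          unfolding z_def using y x Cons.prems(2) by (intro subspace_diff) (auto simp: subspace_on_def)
        moreover have "z = w' \<ominus> (s / t) \<odot> w"
        proof -
          have "(s / t) \<odot> x = (s / t) \<odot> w \<oplus> s \<odot> u"
            using u wV t by (simp add: wt smult_r_distr flip: smult_assoc)
          then show ?thesis
            unfolding z_def ws using u wV w'V by (simp add: add_diff_swap diff_eq_zero_iff[THEN iffD2])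
        qed
        then have "z \<in> list_span us"
          using W wt ws by (auto intro!: subspace_diff simp: subspace_on_def)
        ultimately have "z \<in> list_span vs" using vs by blast
        moreover have "y = z \<oplus> (s / t) \<odot> x"
          unfolding z_def using y xV Cons.prems(2) by (auto simp: diff_add_cancel subspace_on_def)
        ultimately show "y \<in> list_span (x # vs)" by auto
      qed
      show "list_span (x # vs) \<subseteq> X"
        using vs x Cons.prems(2) unfolding list_span.simps subspace_on_def by blast
    qed
    then show ?thesis using vs xV Cons.prems(1)[of "x # vs"] by auto
  qed
qed

lemma subspace_kernel:
  assumes "functional_on V f"
  shows "subspace_on {v \<in> carrier V. f v = 0}"
proof -
  have "f \<zero> = 0" using assms unfolding functional_on_def by (metis smult_zero_left zero_closed mult_zero_left)
  then show ?thesis using assms by (auto simp: subspace_on_def functional_on_def)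
qed

lemma linear_on_zero:
  assumes "linear_on V W L" "real_space W" shows "L \<zero> = \<zero>\<^bsub>W\<^esub>"
proof -
  interpret W: real_space W by fact
  have "L (0 \<odot> \<zero>) = 0 \<odot>\<^bsub>W\<^esub> L \<zero>" "L \<zero> \<in> carrier W"
    using assms(1) by (auto simp: linear_on_def simp del: smult_zero_left smult_zero_right)
  then show ?thesis by simp
qed

lemma linear_on_list_span_image:
  assumes L: "linear_on V W L" and W: "real_space W" and "set us \<subseteq> carrier V"
  shows "L ` list_span us = real_space.list_span W (map L us)"
  using assms(3)
proof (induction us)
  case Nil
  then show ?case by (simp add: real_space.list_span.simps[OF W] linear_on_zero[OF L W])
next
  case (Cons u us)
  have sub: "list_span us \<subseteq> carrier V"
    using subspace_list_span[of us] Cons.prems by (auto simp: subspace_on_def)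
  have "L (w \<oplus> t \<odot> u) = L w \<oplus>\<^bsub>W\<^esub> t \<odot>\<^bsub>W\<^esub> L u" if "w \<in> list_span us" for w t
    using L that sub Cons.prems by (auto simp: linear_on_def)
  then have "L ` list_span (u # us) = {x \<oplus>\<^bsub>W\<^esub> t \<odot>\<^bsub>W\<^esub> L u | x t. x \<in> L ` list_span us}"
    unfolding list_span.simps by (auto simp: image_iff) metis+
  then show ?case using Cons by (simp add: real_space.list_span.simps[OF W])
qed

end

text \<open>Besides norms, the argument measures vectors by \<bar>f v\<bar> for a functional f, and
  by such a term added to the norm of a linear image. These vanish on nonzero vectors in general, so
  definiteness is split off.\<close>

locale seminormed_space = real_space V for V :: "(real, 'v) module" (structure) +
  fixes nrm :: "'v \<Rightarrow> real"
  assumes nrm_smult: "v \<in> carrier V \<Longrightarrow> nrm (a \<odot> v) = \<bar>a\<bar> * nrm v"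
    and nrm_add: "u \<in> carrier V \<Longrightarrow> v \<in> carrier V \<Longrightarrow> nrm (u \<oplus> v) \<le> nrm u + nrm v"
begin

lemma nrm_zero [simp]: "nrm \<zero> = 0"
  using nrm_smult[of \<zero> 0] by simp

lemma nrm_minus: "v \<in> carrier V \<Longrightarrow> nrm (\<ominus> v) = nrm v"
  using nrm_smult[of v "- 1"] by (simp add: minus_eq_smult)

lemma nrm_nonneg: "v \<in> carrier V \<Longrightarrow> 0 \<le> nrm v"
  using nrm_add[of v "\<ominus> v"] by (simp add: nrm_minus r_neg)

lemma nrm_diff_commute: "u \<in> carrier V \<Longrightarrow> v \<in> carrier V \<Longrightarrow> nrm (u \<ominus> v) = nrm (v \<ominus> u)"
  using nrm_minus[of "u \<ominus> v"] by (simp add: minus_eq minus_add a_comm)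

lemma nrm_diff_triangle:
  assumes "u \<in> carrier V" "v \<in> carrier V" "w \<in> carrier V"
  shows "nrm (u \<ominus> w) \<le> nrm (u \<ominus> v) + nrm (v \<ominus> w)"
proof -
  have "u \<ominus> w = (u \<ominus> v) \<oplus> (v \<ominus> w)"
    using assms by (simp add: minus_eq a_assoc) (simp add: l_neg flip: a_assoc)
  then show ?thesis using nrm_add[of "u \<ominus> v" "v \<ominus> w"] assms by simp
qed

end

section \<open>Closed subspaces, bounded functionals and coarse density\<close>

locale normed_space = seminormed_space V nrm for V :: "(real, 'v) module" (structure) and nrm +
  assumes nrm_eq_zero: "v \<in> carrier V \<Longrightarrow> nrm v = 0 \<Longrightarrow> v = \<zero>"
begin

definition nrm_closed :: "'v set \<Rightarrow> bool" where
  "nrm_closed W \<longleftrightarrow> (\<forall>v\<in>carrier V. (\<forall>\<epsilon>>0. \<exists>w\<in>W. nrm (v \<ominus> w) < \<epsilon>) \<longrightarrow> v \<in> W)"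

lemma nrm_closed_zero: "nrm_closed {\<zero>}"
  unfolding nrm_closed_def
proof (intro ballI impI)
  fix v assume v: "v \<in> carrier V" "\<forall>\<epsilon>>0. \<exists>w\<in>{\<zero>}. nrm (v \<ominus> w) < \<epsilon>"
  then have "\<forall>\<epsilon>>0. nrm v < \<epsilon>" by (simp add: minus_eq minus_eq_smult)
  then have "nrm v = 0" using nrm_nonneg[OF v(1)] by (metis less_eq_real_def less_irrefl)
  then show "v \<in> {\<zero>}" using v nrm_eq_zero by auto
qed

text \<open>
  Only completeness of \<open>\<real>\<close> is used: if \<open>u\<close> is at distance \<open>\<delta> > 0\<close> from \<open>W\<close>, the coefficients of \<open>u\<close>
  in a convergent sequence of \<open>W + \<real> u\<close> form a Cauchy sequence.
\<close>

lemma nrm_closed_insert: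
  assumes W: "subspace_on W" "nrm_closed W" and u: "u \<in> carrier V"
  shows "nrm_closed {w \<oplus> t \<odot> u | w t. w \<in> W}"
proof (cases "u \<in> W")
  case True
  have "{w \<oplus> t \<odot> u | w t. w \<in> W} = W"
  proof
    show "{w \<oplus> t \<odot> u | w t. w \<in> W} \<subseteq> W" using W True by (auto simp: subspace_on_def)
    have "w = w \<oplus> 0 \<odot> u" if "w \<in> W" for w using that W u by (auto simp: subspace_on_def)
    then show "W \<subseteq> {w \<oplus> t \<odot> u | w t. w \<in> W}" by blast
  qed
  then show ?thesis using W by simp
next
  case False
  have WV: "w \<in> carrier V" if "w \<in> W" for w using that W by (auto simp: subspace_on_def)
  obtain \<delta> where \<delta>: "\<delta> > 0" "\<And>w. w \<in> W \<Longrightarrow> nrm (u \<ominus> w) \<ge> \<delta>"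
    using False W(2) u unfolding nrm_closed_def by (meson not_less)
  \<comment> \<open>Dividing by t reduces to the coefficient 1, where \<delta> is a lower bound: w +
    t u is t times the difference of u and an element of W. Thus the norm controls the coefficient
    of u.\<close>
  have lower: "\<delta> * \<bar>t\<bar> \<le> nrm (w \<oplus> t \<odot> u)" if "w \<in> W" for w t
  proof (cases "t = 0")
    case True
    then show ?thesis using that u WV nrm_nonneg by simp
  next
    case False
    define w' where "w' = (- (1 / t)) \<odot> w"
    have "w' \<in> W" using that W by (auto simp: w'_def subspace_on_def)
    have "t \<odot> (u \<ominus> w') = t \<odot> u \<ominus> (- 1) \<odot> w"
      using u WV[OF that] False by (simp add: w'_def smult_diff flip: smult_assoc)
    also have "\<dots> = w \<oplus> t \<odot> u"
      using u WV[OF that] by (simp add: minus_eq a_comm flip: minus_eq_smult)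
    finally have "nrm (w \<oplus> t \<odot> u) = \<bar>t\<bar> * nrm (u \<ominus> w')"
      using nrm_smult[of "u \<ominus> w'" t] u WV[OF \<open>w' \<in> W\<close>] by simp
    then show ?thesis using \<delta>(2)[OF \<open>w' \<in> W\<close>] by (simp add: mult.commute[of \<delta>] mult_left_mono)
  qed
  show ?thesis
    unfolding nrm_closed_def
  proof (intro ballI impI)
    fix v assume v: "v \<in> carrier V"
      and "\<forall>\<epsilon>>0. \<exists>w\<in>{w \<oplus> t \<odot> u | w t. w \<in> W}. nrm (v \<ominus> w) < \<epsilon>"
    then have "\<exists>w t. w \<in> W \<and> nrm (v \<ominus> (w \<oplus> t \<odot> u)) < \<epsilon>" if "\<epsilon> > 0" for \<epsilon> using that by blast
    then have "\<exists>w t. w \<in> W \<and> nrm (v \<ominus> (w \<oplus> t \<odot> u)) < inverse (Suc n)" for n :: nat by simp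
    then obtain w t where wt: "\<And>n. w n \<in> W" "\<And>n. nrm (v \<ominus> (w n \<oplus> t n \<odot> u)) < inverse (Suc n)" by metis
    have wV: "w n \<in> carrier V" for n using WV wt by blast
    have t_diff: "\<delta> * \<bar>t m - t n\<bar> \<le> inverse (Suc m) + inverse (Suc n)" for m n
    proof -
      have "\<delta> * \<bar>t m - t n\<bar> \<le> nrm ((w m \<ominus> w n) \<oplus> (t m - t n) \<odot> u)"
        using wt W by (intro lower subspace_diff) auto
      also have "(w m \<ominus> w n) \<oplus> (t m - t n) \<odot> u = (w m \<oplus> t m \<odot> u) \<ominus> (w n \<oplus> t n \<odot> u)"
        using wV u by (simp add: add_diff_swap smult_diff_left)
      also have "nrm \<dots> \<le> nrm ((w m \<oplus> t m \<odot> u) \<ominus> v) + nrm (v \<ominus> (w n \<oplus> t n \<odot> u))"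
        using wV u v by (intro nrm_diff_triangle) auto
      also have "\<dots> \<le> inverse (Suc m) + inverse (Suc n)"
        using wt(2)[of m] wt(2)[of n] nrm_diff_commute[of "w m \<oplus> t m \<odot> u" v] wV u v by simp
      finally show ?thesis .
    qed
    have "Cauchy t"
      unfolding Cauchy_altdef2
    proof (intro allI impI)
      fix e :: real assume "e > 0"
      then obtain N where N: "inverse (real (Suc N)) < \<delta> * e / 2"
        using reals_Archimedean[of "\<delta> * e / 2"] \<delta> by auto
      have "dist (t n) (t N) < e" if "n \<ge> N" for n
      proof -
        have "inverse (real (Suc n)) \<le> inverse (real (Suc N))" using that by simp
        then have "\<delta> * \<bar>t n - t N\<bar> < \<delta> * e" using t_diff[of n N] N by linarith
        then show ?thesis using \<delta> by (simp add: dist_real_def)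
      qed
      then show "\<exists>N. \<forall>n\<ge>N. dist (t n) (t N) < e" by blast
    qed
    then obtain T where T: "t \<longlonglongrightarrow> T" using Cauchy_convergent_iff convergent_def by blast
    \<comment> \<open>Replacing t n by its limit T changes the approximants by \<bar>t n - T\<bar>
      times the norm of u, so v - T u is a limit of elements of W.\<close>
    have "v \<ominus> T \<odot> u \<in> W"
    proof -
      have "\<exists>x\<in>W. nrm ((v \<ominus> T \<odot> u) \<ominus> x) < \<epsilon>" if "\<epsilon> > 0" for \<epsilon> :: real
      proof -
        have "(\<lambda>n. inverse (real (Suc n)) + \<bar>t n - T\<bar> * nrm u) \<longlonglongrightarrow> 0 + \<bar>T - T\<bar> * nrm u"
          by (intro tendsto_intros T LIMSEQ_inverse_real_of_nat)
        then have "eventually (\<lambda>n. inverse (real (Suc n)) + \<bar>t n - T\<bar> * nrm u < \<epsilon>) sequentially"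
          using that by (intro order_tendstoD(2)) auto
        then obtain n where n: "inverse (real (Suc n)) + \<bar>t n - T\<bar> * nrm u < \<epsilon>"
          by (auto simp: eventually_sequentially)
        have "(v \<ominus> T \<odot> u) \<ominus> w n = (v \<ominus> (w n \<oplus> t n \<odot> u)) \<oplus> (t n - T) \<odot> u"
        proof -
          have "(v \<ominus> (w n \<oplus> t n \<odot> u)) \<oplus> (t n \<odot> u \<ominus> T \<odot> u) =
            (v \<ominus> T \<odot> u \<ominus> w n) \<oplus> (t n \<odot> u \<ominus> t n \<odot> u)"
            using v u wV by (simp add: minus_eq minus_add a_ac)
          then show ?thesis using v u wV by (simp add: smult_diff_left diff_eq_zero_iff[THEN iffD2])
        qed
        then have "nrm ((v \<ominus> T \<odot> u) \<ominus> w n) \<le> nrm (v \<ominus> (w n \<oplus> t n \<odot> u)) + \<bar>t n - T\<bar> * nrm u"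
          using nrm_add[of "v \<ominus> (w n \<oplus> t n \<odot> u)" "(t n - T) \<odot> u"] v u wV by (simp add: nrm_smult)
        then show ?thesis using n wt(2)[of n] wt(1) by (intro bexI[of _ "w n"]) auto
      qed
      then show ?thesis using W(2) v u unfolding nrm_closed_def by simp
    qed
    moreover have "v = (v \<ominus> T \<odot> u) \<oplus> T \<odot> u" using v u by (simp add: diff_add_cancel)
    ultimately show "v \<in> {w \<oplus> t \<odot> u | w t. w \<in> W}" by blast
  qed
qed

lemma nrm_closed_list_span: "set us \<subseteq> carrier V \<Longrightarrow> nrm_closed (list_span us)"
proof (induction us)
  case (Cons u us)
  then show ?case
    unfolding list_span.simps by (intro nrm_closed_insert subspace_list_span) auto
qed (simp add: nrm_closed_zero)

text \<open>The kernel is finitely spanned, hence closed, so a vector v with f v = 1 has positive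
  distance \<delta> from it. For f u \<noteq> 0 the vector v - u / f u lies in the kernel, so u / f
  u has norm at least \<delta>; this gives the bound 1 / \<delta>.\<close>

lemma functional_bounded:
  assumes V: "carrier V = list_span us" "set us \<subseteq> carrier V" and f: "functional_on V f"
  obtains B where "B \<ge> 0" "\<And>v. v \<in> carrier V \<Longrightarrow> \<bar>f v\<bar> \<le> B * nrm v"
proof (cases "\<forall>v\<in>carrier V. f v = 0")
  case True
  then show ?thesis using that[of 0] by auto
next
  case False
  then obtain v0 where v0: "v0 \<in> carrier V" "f v0 \<noteq> 0" by blast
  define v where "v = (1 / f v0) \<odot> v0"
  have v: "v \<in> carrier V" "f v = 1" using v0 f by (auto simp: v_def functional_on_def)
  let ?K = "{v \<in> carrier V. f v = 0}"
  have K: "subspace_on ?K" by (rule subspace_kernel[OF f])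
  obtain vs where "set vs \<subseteq> carrier V" "?K = list_span vs"
    using subspace_of_list_span[OF K V(2)] V(1) by blast
  then have "nrm_closed ?K" using nrm_closed_list_span by simp
  then obtain \<delta> where \<delta>: "\<delta> > 0" "\<And>w. w \<in> ?K \<Longrightarrow> nrm (v \<ominus> w) \<ge> \<delta>"
    using v unfolding nrm_closed_def by (smt (verit) mem_Collect_eq)
  show ?thesis
  proof
    show "1 / \<delta> \<ge> 0" using \<delta> by simp
    fix u assume u: "u \<in> carrier V"
    show "\<bar>f u\<bar> \<le> 1 / \<delta> * nrm u"
    proof (cases "f u = 0")
      case True
      then show ?thesis using \<delta> nrm_nonneg[OF u] by simp
    next
      case False
      define w where "w = v \<ominus> (1 / f u) \<odot> u"
      have w: "w \<in> carrier V" using u v by (simp add: w_def)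
      have "w = v \<oplus> (- (1 / f u)) \<odot> u" using u v by (simp add: w_def minus_eq smult_minus_left)
      then have "f w = f v + (- (1 / f u)) * f u"
        using f u v by (metis functional_on_def smult_closed)
      then have "w \<in> ?K" using w v False by simp
      have "v \<ominus> w = (1 / f u) \<odot> u"
        unfolding w_def using u v by (simp add: minus_eq minus_add flip: a_assoc) (simp add: r_neg)
      then have "\<delta> \<le> \<bar>1 / f u\<bar> * nrm u" using \<delta>(2)[OF \<open>w \<in> ?K\<close>] nrm_smult[OF u, of "1 / f u"] by simp
      then show ?thesis using \<delta>(1) False by (simp add: field_simps)
    qed
  qed
qed

text \<open>A subspace is invariant under scaling: approximating n v within B and dividing by n
  approximates v within B / n.\<close>

lemma coarsely_dense_subspace:
  assumes W: "subspace_on W" "nrm_closed W"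
    and dense: "\<And>v. v \<in> carrier V \<Longrightarrow> \<exists>w\<in>W. nrm (v \<ominus> w) \<le> B"
  shows "W = carrier V"
proof
  show "W \<subseteq> carrier V" using W unfolding subspace_on_def by blast
  show "carrier V \<subseteq> W"
  proof
    fix v assume v: "v \<in> carrier V"
    have "\<exists>w\<in>W. nrm (v \<ominus> w) < \<epsilon>" if e: "\<epsilon> > 0" for \<epsilon> :: real
    proof -
      obtain n where "B < real n * \<epsilon>" using reals_Archimedean3[OF e] by blast
      also have "\<dots> \<le> real (Suc n) * \<epsilon>" using e by (intro mult_right_mono) auto
      finally have n: "B < real (Suc n) * \<epsilon>" .
      obtain w where w: "w \<in> W" "nrm (real (Suc n) \<odot> v \<ominus> w) \<le> B" using dense v smult_closed by blast
      define w' where "w' = (1 / real (Suc n)) \<odot> w"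
      have wV: "w \<in> carrier V" using w W by (auto simp: subspace_on_def)
      have "v \<ominus> w' = (1 / real (Suc n)) \<odot> (real (Suc n) \<odot> v \<ominus> w)"
        using v wV by (simp add: smult_diff w'_def flip: smult_assoc)
      then have "nrm (v \<ominus> w') = (1 / real (Suc n)) * nrm (real (Suc n) \<odot> v \<ominus> w)"
        using v wV by (simp add: nrm_smult)
      also have "\<dots> \<le> (1 / real (Suc n)) * B" using w by (intro mult_left_mono) auto
      also have "\<dots> < \<epsilon>" using n by (simp add: field_simps)
      finally have "nrm (v \<ominus> w') < \<epsilon>" .
      moreover have "w' \<in> W" using w(1) W(1) by (simp add: w'_def subspace_on_def)
      ultimately show ?thesis by blast
    qed
    then show "v \<in> W" using W(2) v unfolding nrm_closed_def by blast
  qed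
qed

end

section \<open>Coordinates on finitely generated abelian groups\<close>

definition additive_on :: "('a, 'x) monoid_scheme \<Rightarrow> ('a \<Rightarrow> real) \<Rightarrow> bool" where
  "additive_on G f \<longleftrightarrow> (\<forall>x\<in>carrier G. \<forall>y\<in>carrier G. f (x \<otimes>\<^bsub>G\<^esub> y) = f x + f y)"

context comm_group
begin

definition pow_prod :: "'a set \<Rightarrow> ('a \<Rightarrow> int) \<Rightarrow> 'a" where
  "pow_prod B n = (\<Otimes>b\<in>B. b [^] n b)"

lemma pow_prod_closed [simp]: "B \<subseteq> carrier G \<Longrightarrow> pow_prod B n \<in> carrier G"
  unfolding pow_prod_def by (intro finprod_closed) auto

lemma pow_prod_cong: "B \<subseteq> carrier G \<Longrightarrow> (\<And>b. b \<in> B \<Longrightarrow> n b = m b) \<Longrightarrow> pow_prod B n = pow_prod B m"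
  unfolding pow_prod_def by (intro finprod_cong') auto

lemma pow_prod_zero [simp]: "B \<subseteq> carrier G \<Longrightarrow> pow_prod B (\<lambda>b. 0) = \<one>"
  unfolding pow_prod_def by (simp add: finprod_one_eqI)

lemma pow_prod_add:
  assumes "B \<subseteq> carrier G"
  shows "pow_prod B (\<lambda>b. n b + m b) = pow_prod B n \<otimes> pow_prod B m"
proof -
  have "pow_prod B (\<lambda>b. n b + m b) = (\<Otimes>b\<in>B. b [^] n b \<otimes> b [^] m b)"
    unfolding pow_prod_def using assms by (intro finprod_cong') (auto simp: int_pow_mult)
  then show ?thesis unfolding pow_prod_def using assms by (simp add: finprod_multf Pi_iff subset_iff)
qed

lemma pow_prod_mult:
  assumes "finite B" "B \<subseteq> carrier G"
  shows "pow_prod B (\<lambda>b. n b * k) = pow_prod B n [^] k"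
  using assms
proof (induction B rule: finite_induct)
  case (insert b B)
  then show ?case
    by (simp add: pow_prod_def Pi_iff subset_iff int_pow_distrib int_pow_pow)
qed (simp add: pow_prod_def)

lemma pow_prod_insert:
  "finite B \<Longrightarrow> b \<notin> B \<Longrightarrow> insert b B \<subseteq> carrier G \<Longrightarrow> pow_prod (insert b B) n = b [^] n b \<otimes> pow_prod B n"
  by (simp add: pow_prod_def Pi_iff subset_iff)

lemma pow_prod_single:
  assumes "finite B" "B \<subseteq> carrier G" "b \<in> B"
  shows "pow_prod B (\<lambda>c. if c = b then k else 0) = b [^] k"
proof -
  have "pow_prod (insert b (B - {b})) (\<lambda>c. if c = b then k else 0) =
      b [^] k \<otimes> pow_prod (B - {b}) (\<lambda>c. if c = b then k else 0)"
    using assms by (subst pow_prod_insert) auto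
  also have "pow_prod (B - {b}) (\<lambda>c. if c = b then k else 0) = pow_prod (B - {b}) (\<lambda>c. 0)"
    using assms by (intro pow_prod_cong) auto
  also have "\<dots> = \<one>" using assms by (intro pow_prod_zero) auto
  finally show ?thesis using assms by (auto simp: insert_absorb)
qed

lemma pow_prod_in_generate: "finite B \<Longrightarrow> B \<subseteq> carrier G \<Longrightarrow> pow_prod B n \<in> generate G B"
proof (induction B rule: finite_induct)
  case (insert b B)
  have "b [^] n b \<in> generate G (insert b B)"
    using insert by (intro subgroup_int_pow_closed generate_is_subgroup generate.incl) auto
  moreover have "pow_prod B n \<in> generate G (insert b B)"
    using insert mono_generate[of B "insert b B"] by auto
  ultimately show ?case using insert by (simp add: pow_prod_insert generate.eng)
qed (simp add: pow_prod_def generate.one)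

lemma generate_eq_pow_prod:
  assumes "finite B" "B \<subseteq> carrier G" "x \<in> generate G B"
  obtains n where "x = pow_prod B n"
proof -
  have "\<exists>n. x = pow_prod B n"
    using assms(3)
  proof (induction rule: generate.induct)
    case one
    then show ?case using assms by (metis pow_prod_zero)
  next
    case (incl h)
    then show ?case using pow_prod_single[OF assms(1,2), of h 1] assms
      by (metis int_pow_1 subset_iff)
  next
    case (inv h)
    then have "inv h = pow_prod B (\<lambda>c. if c = h then - 1 else 0)"
      using pow_prod_single[OF assms(1,2), of h "- 1"] assms by (auto simp: int_pow_neg)
    then show ?case by blast
  next
    case (eng x y)
    then show ?case using assms by (metis pow_prod_add)
  qed
  then show thesis using that by blast
qed

section \<open>Independence over the integers and real coordinates\<close>

definition int_independent :: "'a set \<Rightarrow> bool" where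
  "int_independent B \<longleftrightarrow> (\<forall>n. pow_prod B n = \<one> \<longrightarrow> (\<forall>b\<in>B. n b = 0))"

lemma int_independent_unique:
  assumes "int_independent B" "finite B" "B \<subseteq> carrier G" "pow_prod B n = pow_prod B m" "b \<in> B"
  shows "n b = m b"
proof -
  have "pow_prod B (\<lambda>b. n b + m b * - 1) = pow_prod B n \<otimes> inv (pow_prod B m)"
    using assms by (simp only: pow_prod_add pow_prod_mult int_pow_neg pow_prod_closed int_pow_1)
  also have "\<dots> = \<one>" using assms by simp
  finally have "n b + m b * - 1 = 0" using assms(1,5) unfolding int_independent_def by blast
  then show ?thesis by simp
qed

text \<open>By maximality every further generator s satisfies a relation with B in which s really
  occurs, so a nonzero power of s lies in the subgroup generated by B. The product of these
  exponents over all generators serves as a common exponent T.\<close>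

lemma maximal_int_independent:
  assumes "finite S" "S \<subseteq> carrier G" "generate G S = carrier G"
  obtains B T where "B \<subseteq> S" "int_independent B" "(T::nat) > 0"
    "\<And>x. x \<in> carrier G \<Longrightarrow> x [^] T \<in> generate G B"
proof -
  let ?\<B> = "{B. B \<subseteq> S \<and> int_independent B}"
  have "{} \<in> ?\<B>" and fin: "finite ?\<B>" using assms(1) by (simp_all add: int_independent_def)
  then have "?\<B> \<noteq> {}" by blast
  then obtain B where B_in: "B \<in> ?\<B>" and B_max: "\<forall>B'\<in>?\<B>. B \<subseteq> B' \<longrightarrow> B = B'"
    using finite_has_maximal[OF fin] by meson
  have B: "B \<subseteq> S" "int_independent B" using B_in by simp_all
  have max: "B = B'" if "B' \<subseteq> S" "int_independent B'" "B \<subseteq> B'" for B'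
    using B_max that by simp
  have Bc: "finite B" "B \<subseteq> carrier G" using B assms finite_subset by auto
  have sub: "subgroup (generate G B) G" using Bc by (intro generate_is_subgroup)
  have "\<exists>t::nat. t > 0 \<and> s [^] t \<in> generate G B" if "s \<in> S" for s
  proof (cases "s \<in> B")
    case True
    then have "s [^] (1::nat) = s" using Bc by auto
    then show ?thesis using True by (metis generate.incl zero_less_one)
  next
    case False
    have s: "s \<in> carrier G" using that assms by auto
    have "\<not> int_independent (insert s B)" using max[of "insert s B"] False that B by auto
    then obtain n b where n: "pow_prod (insert s B) n = \<one>" "b \<in> insert s B" "n b \<noteq> 0"
      unfolding int_independent_def by blast
    have eq: "s [^] n s \<otimes> pow_prod B n = \<one>" using n(1) s Bc False by (simp add: pow_prod_insert)
    \<comment> \<open>Otherwise the relation would be one among the elements of B alone, against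
      their independence.\<close>
    have ns: "n s \<noteq> 0"
    proof
      assume "n s = 0"
      then have "pow_prod B n = \<one>" using eq Bc by simp
      then have "n b = 0" using B(2) n(2) \<open>n s = 0\<close> unfolding int_independent_def by blast
      then show False using n by simp
    qed
    have "s [^] n s = inv (pow_prod B n)" using eq s Bc by (metis inv_equality inv_inv int_pow_closed pow_prod_closed)
    then have in_B: "s [^] n s \<in> generate G B"
      using pow_prod_in_generate[OF Bc] sub by (simp add: subgroup.m_inv_closed)
    \<comment> \<open>Multiplying by its sign makes the exponent a positive natural number.\<close>
    then have "s [^] (n s * sgn (n s)) \<in> generate G B"
      using subgroup_int_pow_closed[OF sub in_B] s by (simp add: int_pow_pow)
    moreover have "n s * sgn (n s) = int (nat \<bar>n s\<bar>)" by (simp flip: abs_sgn)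
    ultimately have "s [^] nat \<bar>n s\<bar> \<in> generate G B" by (simp only: int_pow_int)
    then show ?thesis using ns by (intro exI[of _ "nat \<bar>n s\<bar>"]) auto
  qed
  then obtain t where t: "\<And>s. s \<in> S \<Longrightarrow> t s > (0::nat) \<and> s [^] t s \<in> generate G B" by metis
  define T where "T = prod t S"
  have gen: "s [^] T \<in> generate G B" if "s \<in> S" for s
  proof -
    have "T = t s * prod t (S - {s})" unfolding T_def by (rule prod.remove) (use assms that in auto)
    then have "s [^] T = (s [^] t s) [^] prod t (S - {s})"
      using that assms(2) by (simp add: nat_pow_pow subset_iff)
    then show ?thesis
      using subgroup_int_pow_closed[OF sub, of "s [^] t s" "int (prod t (S - {s}))"] t[OF that]
      by (simp add: int_pow_int del: of_nat_prod)
  qed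
  have "x [^] T \<in> generate G B" if "x \<in> generate G S" for x
    using that
  proof (induction rule: generate.induct)
    case (inv h)
    then have "inv h [^] T = inv (h [^] T)" using assms by (simp add: nat_pow_inv subset_iff)
    then show ?case using gen[OF inv] sub by (simp add: subgroup.m_inv_closed)
  next
    case (eng x y)
    then have "x \<in> carrier G" "y \<in> carrier G" using generate_in_carrier[OF assms(2)] by auto
    then show ?case using eng.IH by (simp add: nat_pow_distrib generate.eng)
  qed (auto simp: generate.one gen)
  moreover have "T > 0" unfolding T_def using t assms(1) by (simp add: prod_pos)
  ultimately show thesis using that[OF B, of T] assms(3) by simp
qed

text \<open>
  The functions \<open>\<phi> b\<close> are rational coordinates on the free part: \<open>\<phi> b x\<close> is the exponent of \<open>b\<close> in
  \<open>x [^] T\<close>, divided by \<open>T\<close>.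
\<close>

lemma additive_coordinates:
  assumes S: "finite S" "S \<subseteq> carrier G" "generate G S = carrier G"
  obtains B T \<phi> where "B \<subseteq> S" "(T::nat) > 0" "\<And>x. x \<in> carrier G \<Longrightarrow> x [^] T \<in> generate G B"
    "\<And>b. b \<in> B \<Longrightarrow> additive_on G (\<phi> b)"
    "\<And>b c. b \<in> B \<Longrightarrow> c \<in> B \<Longrightarrow> \<phi> b c = (if c = b then 1 else 0)"
    "\<And>K. finite {x \<in> carrier G. \<forall>b\<in>B. \<bar>\<phi> b x\<bar> \<le> K}"
proof -
  obtain B T where B: "B \<subseteq> S" "int_independent B" and T: "(T::nat) > 0"
    and gen: "\<And>x. x \<in> carrier G \<Longrightarrow> x [^] T \<in> generate G B"
    using maximal_int_independent[OF S] by blast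
  have Bc: "finite B" "B \<subseteq> carrier G" using B S finite_subset by auto
  have "\<exists>n. x [^] T = pow_prod B n" if "x \<in> carrier G" for x
    using generate_eq_pow_prod[OF Bc gen[OF that]] by metis
  then obtain \<nu> where \<nu>: "\<And>x. x \<in> carrier G \<Longrightarrow> x [^] T = pow_prod B (\<nu> x)" by metis
  define \<phi> where "\<phi> b x = real_of_int (\<nu> x b) / T" for b x
  \<comment> \<open>Exponents over an independent set are unique, so \<phi> may be read off any
    expression of the T-th power of x in B. Additivity and the values on B come from suitable
    expressions.\<close>
  have \<phi>_eq: "\<phi> b x = real_of_int (n b) / T" if "x \<in> carrier G" "x [^] T = pow_prod B n" "b \<in> B" for b x n
    using int_independent_unique[OF B(2) Bc, of "\<nu> x" n b] that \<nu> by (simp add: \<phi>_def)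
  have additive: "additive_on G (\<phi> b)" if "b \<in> B" for b
    unfolding additive_on_def
  proof (intro ballI)
    fix x y assume xy: "x \<in> carrier G" "y \<in> carrier G"
    have "(x \<otimes> y) [^] T = pow_prod B (\<lambda>b. \<nu> x b + \<nu> y b)"
      using nat_pow_distrib[OF xy, of T] Bc(2) by (simp only: \<nu>[OF xy(1)] \<nu>[OF xy(2)] pow_prod_add)
    then have "\<phi> b (x \<otimes> y) = real_of_int (\<nu> x b + \<nu> y b) / T"
      using xy that by (intro \<phi>_eq) auto
    then show "\<phi> b (x \<otimes> y) = \<phi> b x + \<phi> b y" by (simp add: \<phi>_def add_divide_distrib)
  qed
  have \<phi>_pow_prod: "\<phi> b (pow_prod B n) = n b" if "b \<in> B" for b n
  proof -
    have "pow_prod B n [^] T = pow_prod B (\<lambda>b. n b * int T)"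
      using Bc by (simp add: pow_prod_mult int_pow_int)
    then have "\<phi> b (pow_prod B n) = real_of_int (n b * int T) / T"
      using that Bc by (intro \<phi>_eq) auto
    then show ?thesis using T by simp
  qed
  have coord: "\<phi> b c = (if c = b then 1 else 0)" if "b \<in> B" "c \<in> B" for b c
  proof -
    have "pow_prod B (\<lambda>d. if d = c then 1 else 0) = c"
      using that Bc pow_prod_single[OF Bc that(2), of 1] by auto
    then show ?thesis using \<phi>_pow_prod[OF that(1), of "\<lambda>d. if d = c then 1 else 0"] by auto
  qed
  \<comment> \<open>Exponents over S are divided by T with remainder. The quotients form a T-th
    power, which is a product of powers of B, and the remainders give finitely many elements. This
    finite set also accounts for torsion.\<close>
  define P where "P = pow_prod S ` (S \<rightarrow>\<^sub>E {0..<int T})"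
  have finP: "finite P" unfolding P_def using S by (intro finite_imageI finite_PiE) auto
  have PG: "P \<subseteq> carrier G" unfolding P_def using S by auto
  have decomp: "\<exists>n. \<exists>\<rho>\<in>P. x = pow_prod B n \<otimes> \<rho>" if x: "x \<in> carrier G" for x
  proof -
    obtain m where m: "x = pow_prod S m"
      using generate_eq_pow_prod[OF S(1,2)] x S(3) by metis
    define \<rho> where "\<rho> = restrict (\<lambda>s. m s mod int T) S"
    have "x = pow_prod S (\<lambda>s. (m s div int T) * int T + \<rho> s)"
      unfolding m using S by (intro pow_prod_cong) (auto simp: \<rho>_def)
    also have "\<dots> = pow_prod S (\<lambda>s. m s div int T) [^] T \<otimes> pow_prod S \<rho>"
      using S by (simp add: pow_prod_add pow_prod_mult int_pow_int)
    finally have "x = pow_prod B (\<nu> (pow_prod S (\<lambda>s. m s div int T))) \<otimes> pow_prod S \<rho>"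
      using S \<nu> by simp
    moreover have "pow_prod S \<rho> \<in> P" unfolding P_def \<rho>_def using T by (intro imageI) auto
    ultimately show ?thesis by blast
  qed
  have "finite {x \<in> carrier G. \<forall>b\<in>B. \<bar>\<phi> b x\<bar> \<le> K}" for K :: real
  proof -
    have "finite ((\<lambda>(b, \<rho>). \<bar>\<phi> b \<rho>\<bar>) ` (B \<times> P))" using Bc finP by auto
    then obtain C where C: "\<And>b \<rho>. b \<in> B \<Longrightarrow> \<rho> \<in> P \<Longrightarrow> \<bar>\<phi> b \<rho>\<bar> \<le> C"
      by (metis (mono_tags, lifting) Max_ge SigmaI case_prod_conv image_eqI)
    define J where "J = \<lceil>K + C\<rceil>"
    \<comment> \<open>The coordinates of x differ from the exponents n only by values of \<phi> on
      P, so bounded coordinates leave finitely many choices of n.\<close>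
    have sub: "{x \<in> carrier G. \<forall>b\<in>B. \<bar>\<phi> b x\<bar> \<le> K} \<subseteq>
        (\<lambda>(n, \<rho>). pow_prod B n \<otimes> \<rho>) ` ((B \<rightarrow>\<^sub>E {-J..J}) \<times> P)"
    proof
      fix x assume "x \<in> {x \<in> carrier G. \<forall>b\<in>B. \<bar>\<phi> b x\<bar> \<le> K}"
      then have x: "x \<in> carrier G" "\<And>b. b \<in> B \<Longrightarrow> \<bar>\<phi> b x\<bar> \<le> K" by auto
      obtain n \<rho> where n: "\<rho> \<in> P" "x = pow_prod B n \<otimes> \<rho>" using decomp x by blast
      have "n b \<in> {-J..J}" if "b \<in> B" for b
      proof -
        have "\<phi> b x = n b + \<phi> b \<rho>"
          using additive[OF that] n PG Bc \<phi>_pow_prod[OF that, of n]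
          by (simp add: additive_on_def subset_iff)
        then have "\<bar>real_of_int (n b)\<bar> \<le> K + C" using x(2)[OF that] C[OF that n(1)] by linarith
        then show ?thesis unfolding J_def atLeastAtMost_iff by linarith
      qed
      then have "restrict n B \<in> B \<rightarrow>\<^sub>E {-J..J}" by auto
      moreover have "pow_prod B (restrict n B) = pow_prod B n" using Bc by (intro pow_prod_cong) auto
      ultimately show "x \<in> (\<lambda>(n, \<rho>). pow_prod B n \<otimes> \<rho>) ` ((B \<rightarrow>\<^sub>E {-J..J}) \<times> P)"
        using n by (intro image_eqI[of _ _ "(restrict n B, \<rho>)"]) auto
    qed
    have "finite ((B \<rightarrow>\<^sub>E {-J..J}) \<times> P)" using Bc finP by (intro finite_cartesian_product finite_PiE) auto
    then show ?thesis by (rule finite_subset[OF sub finite_imageI])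
  qed
  from that[OF B(1) T gen additive coord this] show thesis .
qed

end

section \<open>The real tensor product\<close>

text \<open>The additive reals in the multiplicative notation of \<open>hom\<close>, as a target for
  the universal properties of free abelian groups and of quotients.\<close>

definition real_add_group :: "real monoid" where
  "real_add_group = \<lparr>carrier = UNIV, monoid.mult = (+), one = 0\<rparr>"

lemma real_add_group_simps [simp]:
  "carrier real_add_group = UNIV" "x \<otimes>\<^bsub>real_add_group\<^esub> y = x + y" "\<one>\<^bsub>real_add_group\<^esub> = 0"
  by (simp_all add: real_add_group_def)

lemma comm_group_real_add: "comm_group real_add_group"
  by (rule comm_groupI) (auto intro: exI[of _ "- x" for x])

text \<open>Scalar multiplication on representatives, before passing to cosets: the map inside the
  \<open>smult\<close> field of \<open>real_tensor\<close>.\<close>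

definition tensor_scale :: "real \<Rightarrow> ('a \<times> real \<Rightarrow>\<^sub>0 int) \<Rightarrow> ('a \<times> real \<Rightarrow>\<^sub>0 int)" where
  "tensor_scale t = frag_extend (\<lambda>(a, s). frag_of (a, t * s))"

lemma tensor_scale_simps [simp]:
  "tensor_scale t 0 = 0"
  "tensor_scale t (frag_of (a, s)) = frag_of (a, t * s)"
  "tensor_scale t (c + d) = tensor_scale t c + tensor_scale t d"
  "tensor_scale t (c - d) = tensor_scale t c - tensor_scale t d"
  "tensor_scale t (- c) = - tensor_scale t c"
  by (simp_all add: tensor_scale_def frag_extend_add frag_extend_diff frag_extend_minus)

lemma tensor_scale_mult: "tensor_scale (s * t) c = tensor_scale s (tensor_scale t c)"
  using subset_UNIV[of "Poly_Mapping.keys c"]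
proof (induction c rule: frag_induction)
  case (one x)
  then show ?case by (cases x) (simp add: mult.assoc)
qed auto

lemma tensor_scale_one: "tensor_scale 1 c = c"
  using subset_UNIV[of "Poly_Mapping.keys c"]
proof (induction c rule: frag_induction)
  case (one x)
  then show ?case by (cases x) simp
qed auto

context comm_group
begin

abbreviation "F \<equiv> tensor_free G"
abbreviation "K \<equiv> tensor_kernel G"
abbreviation "V \<equiv> real_tensor G"

lemma carrier_tensor_free: "c \<in> carrier F \<longleftrightarrow> Poly_Mapping.keys c \<subseteq> carrier G \<times> UNIV"
  by (simp add: tensor_free_def)

lemma mult_tensor_free [simp]: "c \<otimes>\<^bsub>F\<^esub> d = c + d"
  by (simp add: tensor_free_def)

lemma one_tensor_free [simp]: "\<one>\<^bsub>F\<^esub> = 0"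
  by (simp add: tensor_free_def)

lemma comm_group_tensor_free: "comm_group F"
  by (simp add: tensor_free_def abelian_free_Abelian_group)

lemma inv_tensor_free: "c \<in> carrier F \<Longrightarrow> inv\<^bsub>F\<^esub> c = - c"
  by (simp add: tensor_free_def)

lemma frag_of_tensor_free [simp]: "frag_of (a, s) \<in> carrier F \<longleftrightarrow> a \<in> carrier G"
  by (simp add: tensor_free_def)

lemma tensor_free_add [simp]: "c \<in> carrier F \<Longrightarrow> d \<in> carrier F \<Longrightarrow> c + d \<in> carrier F"
  using group.is_monoid[OF comm_group.axioms(2)[OF comm_group_tensor_free]] monoid.m_closed
  by fastforce

lemma tensor_free_minus [simp]: "c \<in> carrier F \<Longrightarrow> - c \<in> carrier F"
  by (simp add: carrier_tensor_free)

lemma tensor_free_diff [simp]: "c \<in> carrier F \<Longrightarrow> d \<in> carrier F \<Longrightarrow> c - d \<in> carrier F"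
  using tensor_free_add[of c "- d"] by simp

lemma tensor_free_zero [simp]: "0 \<in> carrier F"
  by (simp add: carrier_tensor_free)

lemma tensor_free_induct [consumes 1, case_names zero pure diff]:
  assumes "c \<in> carrier F" "P 0" "\<And>a s. a \<in> carrier G \<Longrightarrow> P (frag_of (a, s))"
    and "\<And>c d. P c \<Longrightarrow> P d \<Longrightarrow> P (c - d)"
  shows "P c"
  using assms(1)[unfolded carrier_tensor_free]
  by (induction c rule: frag_induction) (use assms in auto)

lemma tensor_scale_closed [simp]: "c \<in> carrier F \<Longrightarrow> tensor_scale t c \<in> carrier F"
proof -
  assume "c \<in> carrier F"
  then have "c \<in> carrier F \<and> tensor_scale t c \<in> carrier F"
    by (induction rule: tensor_free_induct) auto
  then show ?thesis by simp
qed

lemma tensor_relations_closed: "tensor_relations G \<subseteq> carrier F"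
  by (auto simp: tensor_relations_def)

lemma subgroup_tensor_kernel: "subgroup K F"
  unfolding tensor_kernel_def
  using group.generate_is_subgroup[OF comm_group.axioms(2)[OF comm_group_tensor_free] tensor_relations_closed] .

lemma normal_tensor_kernel: "K \<lhd> F"
  using comm_group_tensor_free subgroup_tensor_kernel by (rule comm_group.subgroup_imp_normal)

lemma tensor_kernel_subset: "K \<subseteq> carrier F"
  using subgroup_tensor_kernel by (rule subgroup.subset)

lemma tensor_kernel_induct [consumes 1, case_names zero left right add minus]:
  assumes "k \<in> K" "P 0"
    and "\<And>a b s. a \<in> carrier G \<Longrightarrow> b \<in> carrier G \<Longrightarrow>
          P (frag_of (a \<otimes> b, s) - frag_of (a, s) - frag_of (b, s))"
    and "\<And>a s t. a \<in> carrier G \<Longrightarrow> P (frag_of (a, s + t) - frag_of (a, s) - frag_of (a, t))"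
    and "\<And>c d. c \<in> K \<Longrightarrow> d \<in> K \<Longrightarrow> P c \<Longrightarrow> P d \<Longrightarrow> P (c + d)"
    and "\<And>c. c \<in> K \<Longrightarrow> P c \<Longrightarrow> P (- c)"
  shows "P k"
proof -
  have rel: "c \<in> K \<and> P c" if "c \<in> tensor_relations G" for c
    using that assms(3,4) unfolding tensor_kernel_def
    by (auto intro!: generate.incl) (auto simp: tensor_relations_def)
  have "k \<in> generate F (tensor_relations G)" using assms(1) by (simp add: tensor_kernel_def)
  then show ?thesis
  proof (induction rule: generate.induct)
    case (inv h)
    then show ?case using rel[OF inv] assms(6) tensor_kernel_subset inv_tensor_free by auto
  next
    case (eng x y)
    then show ?case using assms(5) by (simp add: tensor_kernel_def)
  qed (use rel assms(2) in auto)
qed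

lemma tensor_kernel_zero [simp]: "0 \<in> K"
  using subgroup.one_closed[OF subgroup_tensor_kernel] by simp

lemma tensor_kernel_add: "c \<in> K \<Longrightarrow> d \<in> K \<Longrightarrow> c + d \<in> K"
  using subgroup.m_closed[OF subgroup_tensor_kernel] by simp

lemma tensor_kernel_minus: "c \<in> K \<Longrightarrow> - c \<in> K"
  using subgroup.m_inv_closed[OF subgroup_tensor_kernel, of c] tensor_kernel_subset inv_tensor_free by auto

lemma tensor_kernel_diff: "c \<in> K \<Longrightarrow> d \<in> K \<Longrightarrow> c - d \<in> K"
  using tensor_kernel_add[of c "- d"] tensor_kernel_minus by simp

lemma tensor_kernel_left:
  "a \<in> carrier G \<Longrightarrow> b \<in> carrier G \<Longrightarrow> frag_of (a \<otimes> b, s) - frag_of (a, s) - frag_of (b, s) \<in> K"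
  unfolding tensor_kernel_def by (rule generate.incl) (auto simp: tensor_relations_def)

lemma tensor_kernel_right:
  "a \<in> carrier G \<Longrightarrow> frag_of (a, s + t) - frag_of (a, s) - frag_of (a, t) \<in> K"
  unfolding tensor_kernel_def tensor_relations_def by (rule generate.incl, rule UnI2) blast

lemma tensor_scale_kernel: "k \<in> K \<Longrightarrow> tensor_scale t k \<in> K"
  by (induction rule: tensor_kernel_induct)
    (auto simp: distrib_left tensor_kernel_left tensor_kernel_right tensor_kernel_add tensor_kernel_minus)

section \<open>Cosets of the bilinearity relations and the induced vector space\<close>

definition tcoset :: "('a \<times> real \<Rightarrow>\<^sub>0 int) \<Rightarrow> ('a \<times> real \<Rightarrow>\<^sub>0 int) set" where
  "tcoset c = K #>\<^bsub>F\<^esub> c"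

lemma mem_tcoset: "x \<in> tcoset c \<longleftrightarrow> x - c \<in> K"
proof -
  have "x \<in> tcoset c \<longleftrightarrow> (\<exists>k\<in>K. x = k + c)" by (auto simp: tcoset_def r_coset_def)
  also have "\<dots> \<longleftrightarrow> x - c \<in> K" by (auto simp: algebra_simps) (metis add_diff_cancel_left' diff_add_cancel add.commute)
  finally show ?thesis .
qed

lemma tcoset_eq_iff: "tcoset c = tcoset d \<longleftrightarrow> c - d \<in> K"
proof
  assume "tcoset c = tcoset d"
  moreover have "c \<in> tcoset c" by (simp add: mem_tcoset)
  ultimately show "c - d \<in> K" by (simp add: mem_tcoset)
next
  assume cd: "c - d \<in> K"
  have "x - c \<in> K \<longleftrightarrow> x - d \<in> K" for x
    using tensor_kernel_add[OF _ cd, of "x - c"] tensor_kernel_diff[OF _ cd, of "x - d"] by auto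
  then show "tcoset c = tcoset d" by (auto simp: mem_tcoset)
qed

lemma carrier_real_tensor: "carrier V = tcoset ` carrier F"
  by (simp add: real_tensor_def Let_def carrier_FactGroup tcoset_def[abs_def])

lemma tcoset_closed [simp]: "c \<in> carrier F \<Longrightarrow> tcoset c \<in> carrier V"
  by (simp add: carrier_real_tensor)

lemma zero_real_tensor: "\<zero>\<^bsub>V\<^esub> = tcoset 0"
proof -
  have "x \<in> tcoset 0 \<longleftrightarrow> x \<in> K" for x by (simp add: mem_tcoset)
  then have "tcoset 0 = K" by auto
  then show ?thesis by (simp add: real_tensor_def Let_def)
qed

lemma add_real_tensor [simp]:
  "c \<in> carrier F \<Longrightarrow> d \<in> carrier F \<Longrightarrow> tcoset c \<oplus>\<^bsub>V\<^esub> tcoset d = tcoset (c + d)"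
  using normal.rcos_sum[OF normal_tensor_kernel, of c d]
  by (simp add: real_tensor_def Let_def tcoset_def)

lemma smult_real_tensor [simp]: "t \<odot>\<^bsub>V\<^esub> tcoset c = tcoset (tensor_scale t c)"
proof -
  have "tcoset (tensor_scale t d) = tcoset (tensor_scale t c)" if "d \<in> tcoset c" for d
    using tensor_scale_kernel[of "d - c" t] that by (simp add: mem_tcoset tcoset_eq_iff)
  moreover have "c \<in> tcoset c" by (simp add: mem_tcoset)
  ultimately have "(\<Union>d\<in>tcoset c. tcoset (tensor_scale t d)) = tcoset (tensor_scale t c)" by blast
  then show ?thesis by (simp add: real_tensor_def Let_def tcoset_def tensor_scale_def)
qed

lemma abelian_group_real_tensor: "abelian_group V"
proof (rule abelian_groupI)
  fix x assume "x \<in> carrier V"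
  then obtain c where c: "c \<in> carrier F" "x = tcoset c" by (auto simp: carrier_real_tensor)
  then have "tcoset (- c) \<oplus>\<^bsub>V\<^esub> x = \<zero>\<^bsub>V\<^esub>" by (simp add: zero_real_tensor)
  then show "\<exists>y\<in>carrier V. y \<oplus>\<^bsub>V\<^esub> x = \<zero>\<^bsub>V\<^esub>" using c by (intro bexI[of _ "tcoset (- c)"]) auto
qed (auto simp: carrier_real_tensor zero_real_tensor ac_simps)

lemma real_space_real_tensor: "real_space V"
  unfolding real_space_def real_space_axioms_def
proof (intro conjI allI impI)
  show "abelian_group V" by (rule abelian_group_real_tensor)
  fix v a b assume "v \<in> carrier V"
  then obtain c where c: "c \<in> carrier F" "v = tcoset c" by (auto simp: carrier_real_tensor)
  show "a \<odot>\<^bsub>V\<^esub> v \<in> carrier V" using c by simp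
  \<comment> \<open>Of the scalar laws, only distributivity over sums of scalars fails for
    representatives. On a pure tensor the defect is a relation of the second kind.\<close>
  have "tensor_scale (a + b) c - (tensor_scale a c + tensor_scale b c) \<in> K"
    using c(1)
  proof (induction rule: tensor_free_induct)
    case (pure x s)
    then show ?case using tensor_kernel_right[of x "a * s" "b * s"] by (simp add: distrib_right algebra_simps)
  next
    case (diff c d)
    then show ?case using tensor_kernel_diff[OF diff] by (simp add: algebra_simps)
  qed auto
  then show "(a + b) \<odot>\<^bsub>V\<^esub> v = a \<odot>\<^bsub>V\<^esub> v \<oplus>\<^bsub>V\<^esub> b \<odot>\<^bsub>V\<^esub> v"
    using c by (simp add: tcoset_eq_iff)
  show "(a * b) \<odot>\<^bsub>V\<^esub> v = a \<odot>\<^bsub>V\<^esub> (b \<odot>\<^bsub>V\<^esub> v)" using c by (simp add: tensor_scale_mult)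
  show "1 \<odot>\<^bsub>V\<^esub> v = v" using c by (simp add: tensor_scale_one)
next
  fix u v a assume "u \<in> carrier V" "v \<in> carrier V"
  then show "a \<odot>\<^bsub>V\<^esub> (u \<oplus>\<^bsub>V\<^esub> v) = a \<odot>\<^bsub>V\<^esub> u \<oplus>\<^bsub>V\<^esub> a \<odot>\<^bsub>V\<^esub> v"
    by (auto simp: carrier_real_tensor)
qed

lemma pure_tensor_eq: "pure_tensor G a s = tcoset (frag_of (a, s))"
  by (simp add: pure_tensor_def tcoset_def)

lemma pure_tensor_closed [simp]: "a \<in> carrier G \<Longrightarrow> pure_tensor G a s \<in> carrier V"
  by (simp add: pure_tensor_eq)

lemma pure_tensor_mult:
  "a \<in> carrier G \<Longrightarrow> b \<in> carrier G \<Longrightarrow>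
     pure_tensor G (a \<otimes> b) s = pure_tensor G a s \<oplus>\<^bsub>V\<^esub> pure_tensor G b s"
  using tensor_kernel_left[of a b s] by (simp add: pure_tensor_eq tcoset_eq_iff algebra_simps)

text \<open>Since a \<otimes> s is s times a \<otimes> 1, the elements a \<otimes> 1 span over the
  reals. Linear maps are therefore determined by their values on the image of the group.\<close>

lemma real_tensor_minimal:
  assumes W: "real_space.subspace_on V W" "\<And>a. a \<in> carrier G \<Longrightarrow> pure_tensor G a 1 \<in> W"
  shows "W = carrier V"
proof -
  interpret V: real_space V by (rule real_space_real_tensor)
  have "c \<in> carrier F \<and> tcoset c \<in> W" if "c \<in> carrier F" for c
    using that
  proof (induction rule: tensor_free_induct)
    case zero
    then show ?case using W by (auto simp: V.subspace_on_def zero_real_tensor)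
  next
    case (pure a s)
    then have "s \<odot>\<^bsub>V\<^esub> pure_tensor G a 1 \<in> W" using W unfolding V.subspace_on_def by blast
    then show ?case using pure by (simp add: pure_tensor_eq)
  next
    case (diff c d)
    have "tcoset (c - d) \<oplus>\<^bsub>V\<^esub> tcoset d = tcoset c" using diff by simp
    then have "tcoset (c - d) = tcoset c \<ominus>\<^bsub>V\<^esub> tcoset d"
      using diff by (metis V.add_diff_cancel tcoset_closed tensor_free_diff)
    then show ?case using diff V.subspace_diff[OF W(1)] by simp
  qed
  then show ?thesis using W by (auto simp: carrier_real_tensor V.subspace_on_def)
qed

text \<open>The homomorphism on the free group sending (a, s) to s * f a kills both kinds of
  relations, because f is additive, and so descends to the quotient. This realizes the
  identification of Hom(A, \<real>) with linear functionals on A \<otimes> \<real>.\<close>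

lemma additive_extends:
  assumes f: "additive_on G f"
  obtains g where "functional_on V g" "\<And>a s. a \<in> carrier G \<Longrightarrow> g (pure_tensor G a s) = s * f a"
proof -
  interpret R: comm_group real_add_group by (rule comm_group_real_add)
  obtain h where h: "h \<in> hom F real_add_group"
    "\<And>x. x \<in> carrier G \<times> UNIV \<Longrightarrow> h (frag_of x) = (case x of (a, s) \<Rightarrow> s * f a)"
    using R.free_Abelian_group_universal[of "\<lambda>(a, s). s * f a" "carrier G \<times> UNIV"]
    by (auto simp: tensor_free_def)
  have h_add: "h (c + d) = h c + h d" if "c \<in> carrier F" "d \<in> carrier F" for c d
    using hom_mult[OF h(1) that] by simp
  have h_zero: "h 0 = 0" using h_add[of 0 0] by simp
  have h_minus: "h (- c) = - h c" if "c \<in> carrier F" for c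
    using h_add[of c "- c"] that h_zero by simp
  have h_diff: "h (c - d) = h c - h d" if "c \<in> carrier F" "d \<in> carrier F" for c d
    using h_add[of c "- d"] h_minus that by simp
  have h_pure: "h (frag_of (a, s)) = s * f a" if "a \<in> carrier G" for a s
    using h(2)[of "(a, s)"] that by simp
  have h_kernel: "h k = 0" if "k \<in> K" for k
    using that
  proof (induction rule: tensor_kernel_induct)
    case (left a b s)
    then show ?case using f by (simp add: h_diff h_pure additive_on_def distrib_left)
  next
    case (add c d)
    then show ?case using h_add[of c d] tensor_kernel_subset by auto
  next
    case (minus c)
    then show ?case using h_minus[of c] tensor_kernel_subset by auto
  qed (auto simp: h_zero h_diff h_pure distrib_right)
  have h_scale: "h (tensor_scale t c) = t * h c" if "c \<in> carrier F" for t c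
  proof -
    have "c \<in> carrier F \<and> h (tensor_scale t c) = t * h c"
      using that
      by (induction rule: tensor_free_induct) (auto simp: h_zero h_pure h_diff right_diff_distrib)
    then show ?thesis by simp
  qed
  have "h c = h d" if "c \<in> carrier F" "d \<in> carrier F" "tcoset c = tcoset d" for c d
    using that h_kernel[of "c - d"] h_diff by (simp add: tcoset_eq_iff)
  then obtain g where g: "g \<in> hom (F Mod K) real_add_group" "\<And>c. c \<in> carrier F \<Longrightarrow> g (tcoset c) = h c"
    using FactGroup_universal[OF h(1) normal_tensor_kernel] unfolding tcoset_def by metis
  show thesis
  proof
    show "functional_on V g"
      unfolding functional_on_def
      by (auto simp: carrier_real_tensor g h_add h_scale)
    show "g (pure_tensor G a s) = s * f a" if "a \<in> carrier G" for a s
      using that by (simp add: pure_tensor_eq g h_pure)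
  qed
qed

end

section \<open>The real abelianization\<close>

context group
begin

section \<open>Words, word length and finiteness of balls\<close>

lemma list_prod_upt_closed: "(\<And>n. d n \<in> carrier G) \<Longrightarrow> list_prod G (map d [0..<n]) \<in> carrier G"
  by (rule list_prod_closed) auto

lemma list_prod_upt_Suc:
  assumes "\<And>n. d n \<in> carrier G"
  shows "list_prod G (map d [0..<Suc n]) = list_prod G (map d [0..<n]) \<otimes> d n"
proof -
  have "set (map d [0..<n]) \<subseteq> carrier G" using assms by auto
  from list_prod_append[OF this, of "[d n]"] show ?thesis using assms by (simp del: foldr_append)
qed

lemma word_exists:
  assumes "finite_generating_set G S" "g \<in> carrier G"
  shows "\<exists>ws. set ws \<subseteq> S \<union> m_inv G ` S \<and> g = list_prod G ws"
proof -
  have S: "S \<subseteq> carrier G" and g: "g \<in> generate G S"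
    using assms by (auto simp: finite_generating_set_def)
  from g show ?thesis
  proof (induction rule: generate.induct)
    case one
    show ?case by (rule exI[of _ "[]"]) simp
  next
    case (incl h)
    then show ?case using S by (intro exI[of _ "[h]"]) auto
  next
    case (inv h)
    then show ?case using S by (intro exI[of _ "[inv h]"]) auto
  next
    case (eng x y)
    then obtain us ws where words: "set us \<subseteq> S \<union> m_inv G ` S" "x = list_prod G us"
      "set ws \<subseteq> S \<union> m_inv G ` S" "y = list_prod G ws" by blast
    have "S \<union> m_inv G ` S \<subseteq> carrier G" using S by auto
    then have "set us \<subseteq> carrier G" "set ws \<subseteq> carrier G" using words by blast+
    then have "x \<otimes> y = list_prod G (us @ ws)" using words list_prod_append by simp
    then show ?case using words by (intro exI[of _ "us @ ws"]) simp
  qed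
qed

lemma word_length_le:
  "set ws \<subseteq> S \<union> m_inv G ` S \<Longrightarrow> word_length G S (list_prod G ws) \<le> length ws"
  unfolding word_length_def by (rule Least_le) blast

lemma word_length_attained:
  assumes "finite_generating_set G S" "g \<in> carrier G"
  obtains ws where "set ws \<subseteq> S \<union> m_inv G ` S" "g = list_prod G ws" "length ws = word_length G S g"
proof -
  have "\<exists>n ws. length ws = n \<and> set ws \<subseteq> S \<union> m_inv G ` S \<and> g = list_prod G ws"
    using word_exists[OF assms] by blast
  from LeastI_ex[OF this] show thesis using that unfolding word_length_def by blast
qed

lemma group_length_word_length:
  assumes S: "finite_generating_set G S"
  shows "group_length G (\<lambda>x. real (word_length G S x))"
proof -
  have SG: "S \<union> m_inv G ` S \<subseteq> carrier G" using S by (auto simp: finite_generating_set_def)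
  have inv_le: "word_length G S (inv x) \<le> word_length G S x" if x: "x \<in> carrier G" for x
  proof -
    obtain ws where ws: "set ws \<subseteq> S \<union> m_inv G ` S" "x = list_prod G ws"
      "length ws = word_length G S x" using word_length_attained[OF S x] by blast
    have inv_S: "inv w \<in> S \<union> m_inv G ` S" if "w \<in> S \<union> m_inv G ` S" for w
      using that SG by auto
    have "set (rev (map (m_inv G) ws)) \<subseteq> S \<union> m_inv G ` S"
      unfolding set_rev set_map by (rule image_subsetI) (use inv_S ws(1) in blast)
    moreover have "inv x = list_prod G (rev (map (m_inv G) ws))"
      using list_prod_rev_inv[OF subset_trans[OF ws(1) SG]] ws(2) by simp
    ultimately show ?thesis using word_length_le[of "rev (map (m_inv G) ws)" S] ws(3) by simp
  qed
  show ?thesis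
  proof unfold_locales
    show "real (word_length G S \<one>) = 0" using word_length_le[of "[]" S] by simp
    fix x assume x: "x \<in> carrier G"
    show "real (word_length G S (inv x)) = real (word_length G S x)"
      using inv_le[OF x] inv_le[of "inv x"] x by simp
    fix y assume y: "y \<in> carrier G"
    obtain us where us: "set us \<subseteq> S \<union> m_inv G ` S" "x = list_prod G us"
      "length us = word_length G S x" using word_length_attained[OF S x] by blast
    obtain ws where ws: "set ws \<subseteq> S \<union> m_inv G ` S" "y = list_prod G ws"
      "length ws = word_length G S y" using word_length_attained[OF S y] by blast
    have "x \<otimes> y = list_prod G (us @ ws)"
      using list_prod_append[OF subset_trans[OF us(1) SG] subset_trans[OF ws(1) SG]] us ws by simp
    then have "word_length G S (x \<otimes> y) \<le> length (us @ ws)"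
      using word_length_le[of "us @ ws" S] us(1) ws(1) by simp
    then show "real (word_length G S (x \<otimes> y)) \<le> real (word_length G S x) + real (word_length G S y)"
      using us ws by simp
  qed simp
qed

lemma finite_word_ball:
  assumes S: "finite_generating_set G S"
  shows "finite {x \<in> carrier G. real (word_length G S x) \<le> D}"
proof -
  let ?W = "{ws. set ws \<subseteq> S \<union> m_inv G ` S \<and> length ws \<le> nat \<lfloor>D\<rfloor>}"
  have "finite ?W" using S by (intro finite_lists_length_le) (auto simp: finite_generating_set_def)
  moreover have "{x \<in> carrier G. real (word_length G S x) \<le> D} \<subseteq> list_prod G ` ?W"
  proof
    fix x assume x: "x \<in> {x \<in> carrier G. real (word_length G S x) \<le> D}"
    then obtain ws where ws: "set ws \<subseteq> S \<union> m_inv G ` S" "x = list_prod G ws"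
      "length ws = word_length G S x" using word_length_attained[OF S, of x] by blast
    have "length ws \<le> nat \<lfloor>D\<rfloor>" using x ws(3) by (simp add: le_nat_floor)
    then show "x \<in> list_prod G ` ?W" using ws by blast
  qed
  ultimately show ?thesis using finite_surj by blast
qed

section \<open>The abelianization and its projection to a real vector space\<close>

lemma comm_group_abelianization: "comm_group (abelianization G)"
  unfolding abelianization_def by (rule derived_quot_is_comm_group)

lemma normal_derived: "derived G (carrier G) \<lhd> G"
  using normal_lower_central[of 1] by (simp only: lower_central_one_eq_derived)

lemma group_hom_abelian_class: "group_hom G (abelianization G) (abelian_class G)"
proof -
  have "(\<lambda>x. derived G (carrier G) #> x) \<in> hom G (G Mod derived G (carrier G))"
    by (rule normal.r_coset_hom_Mod[OF normal_derived])
  then show ?thesis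
    using comm_group_abelianization is_group
    by (auto simp: group_hom_def group_hom_axioms_def abelianization_def abelian_class_def[abs_def]
        comm_group_def)
qed

lemma carrier_abelianization: "carrier (abelianization G) = abelian_class G ` carrier G"
  by (simp add: abelianization_def carrier_FactGroup abelian_class_def[abs_def])

lemma abelian_class_closed [simp]: "x \<in> carrier G \<Longrightarrow> abelian_class G x \<in> carrier (abelianization G)"
  by (simp add: carrier_abelianization)

lemma abelian_class_mult:
  "x \<in> carrier G \<Longrightarrow> y \<in> carrier G \<Longrightarrow>
     abelian_class G (x \<otimes> y) = abelian_class G x \<otimes>\<^bsub>abelianization G\<^esub> abelian_class G y"
  using group_hom.hom_mult[OF group_hom_abelian_class] .

lemma abelian_class_eq_imp:
  assumes "x \<in> carrier G" "y \<in> carrier G" "abelian_class G x = abelian_class G y"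
  shows "x \<otimes> inv y \<in> lower_central G 1"
proof -
  have sub: "subgroup (derived G (carrier G)) G" by (rule normal_imp_subgroup[OF normal_derived])
  have "x \<in> derived G (carrier G) #> y"
    using rcos_self[OF assms(1) sub] assms(3) by (simp add: abelian_class_def)
  then show ?thesis
    using subgroup.rcos_module[OF sub is_group assms(2,1)] by (simp only: lower_central_one_eq_derived)
qed

lemma real_space_real_ab: "real_space (real_ab G)"
  by (rule comm_group.real_space_real_tensor[OF comm_group_abelianization])

lemma ab_proj_closed [simp]: "x \<in> carrier G \<Longrightarrow> ab_proj G x \<in> carrier (real_ab G)"
  by (simp add: ab_proj_def comm_group.pure_tensor_closed[OF comm_group_abelianization])

lemma ab_proj_mult:
  "x \<in> carrier G \<Longrightarrow> y \<in> carrier G \<Longrightarrow>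
     ab_proj G (x \<otimes> y) = ab_proj G x \<oplus>\<^bsub>real_ab G\<^esub> ab_proj G y"
  by (simp add: ab_proj_def abelian_class_mult comm_group.pure_tensor_mult[OF comm_group_abelianization])

lemma ab_proj_hom: "ab_proj G \<in> hom G (add_monoid (real_ab G))"
  by (intro homI) (simp_all add: ab_proj_mult)

lemma group_hom_ab_proj: "group_hom G (add_monoid (real_ab G)) (ab_proj G)"
proof -
  interpret V: real_space "real_ab G" by (rule real_space_real_ab)
  show ?thesis
    using ab_proj_hom is_group V.add.is_group by (simp add: group_hom_def group_hom_axioms_def)
qed

lemma ab_proj_one: "ab_proj G \<one> = \<zero>\<^bsub>real_ab G\<^esub>"
  using group_hom.hom_one[OF group_hom_ab_proj] by simp

lemma ab_proj_inv: "x \<in> carrier G \<Longrightarrow> ab_proj G (inv x) = \<ominus>\<^bsub>real_ab G\<^esub> ab_proj G x"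
  using group_hom.hom_inv[OF group_hom_ab_proj] by (simp add: a_inv_def)

lemma ab_proj_nat_pow:
  "x \<in> carrier G \<Longrightarrow> ab_proj G (x [^] (n::nat)) = real n \<odot>\<^bsub>real_ab G\<^esub> ab_proj G x"
proof (induction n)
  case 0
  interpret V: real_space "real_ab G" by (rule real_space_real_ab)
  show ?case using 0 by (simp add: ab_proj_one)
next
  case (Suc n)
  interpret V: real_space "real_ab G" by (rule real_space_real_ab)
  have "ab_proj G (x [^] Suc n) = (real n + 1) \<odot>\<^bsub>real_ab G\<^esub> ab_proj G x"
    using Suc by (simp add: ab_proj_mult V.smult_l_distr)
  then show ?case by (simp add: add.commute)
qed

lemma ab_proj_int_pow:
  assumes "x \<in> carrier G"
  shows "ab_proj G (x [^] (k::int)) = real_of_int k \<odot>\<^bsub>real_ab G\<^esub> ab_proj G x"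
proof -
  interpret V: real_space "real_ab G" by (rule real_space_real_ab)
  show ?thesis
  proof (cases "0 \<le> k")
    case True
    then show ?thesis
      using ab_proj_nat_pow[OF assms, of "nat k"] int_pow_int[of G x "nat k"] by simp
  next
    case False
    define n where "n = nat (- k)"
    have k: "k = - int n" using False by (simp add: n_def)
    show ?thesis
      using assms unfolding k
      by (simp add: int_pow_neg int_pow_int ab_proj_inv ab_proj_nat_pow V.smult_minus_left)
  qed
qed

lemma real_ab_minimal:
  assumes "real_space.subspace_on (real_ab G) W" "\<And>x. x \<in> carrier G \<Longrightarrow> ab_proj G x \<in> W"
  shows "W = carrier (real_ab G)"
  using comm_group.real_tensor_minimal[OF comm_group_abelianization assms(1)] assms(2)
  by (auto simp: carrier_abelianization ab_proj_def)

text \<open>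
  The list \<open>gs\<close> lifts a maximal independent set of generators of the abelianization. Its images form a
  basis, dual to the extensions of the coordinates \<open>\<phi>\<close>.
\<close>

lemma real_ab_coordinates:
  assumes S: "finite_generating_set G S"
  obtains gs where "set gs \<subseteq> carrier G"
    "carrier (real_ab G) = real_space.list_span (real_ab G) (map (ab_proj G) gs)"
    "\<And>v. v \<in> carrier (real_ab G) \<Longrightarrow> v \<noteq> \<zero>\<^bsub>real_ab G\<^esub> \<Longrightarrow> \<exists>f. functional_on (real_ab G) f \<and> f v \<noteq> 0"
    "\<And>nrm K. normed_space (real_ab G) nrm \<Longrightarrow>
       finite {a \<in> carrier (abelianization G). nrm (pure_tensor (abelianization G) a 1) \<le> K}"
proof -
  let ?A = "abelianization G" and ?V = "real_ab G"
  let ?p = "\<lambda>a. pure_tensor ?A a 1"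
  interpret A: comm_group ?A by (rule comm_group_abelianization)
  interpret V: real_space ?V by (rule real_space_real_ab)
  interpret ac: group_hom G ?A "abelian_class G" by (rule group_hom_abelian_class)
  have SG: "finite S" "S \<subseteq> carrier G" "generate G S = carrier G"
    using S by (auto simp: finite_generating_set_def)
  have fin_gen: "finite (abelian_class G ` S)" "abelian_class G ` S \<subseteq> carrier ?A"
    "generate ?A (abelian_class G ` S) = carrier ?A"
    using ac.generate_img[OF SG(2)] SG by (auto simp: carrier_abelianization)
  show thesis
  proof (rule A.additive_coordinates[OF fin_gen])
    fix B \<phi> and T :: nat
    assume B: "B \<subseteq> abelian_class G ` S" and T: "(T::nat) > 0"
      and gen: "\<And>x. x \<in> carrier ?A \<Longrightarrow> x [^]\<^bsub>?A\<^esub> T \<in> generate ?A B"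
      and additive: "\<And>b. b \<in> B \<Longrightarrow> additive_on ?A (\<phi> b)"
      and coord: "\<And>b c. b \<in> B \<Longrightarrow> c \<in> B \<Longrightarrow> \<phi> b c = (if c = b then 1 else 0)"
      and fin: "\<And>K. finite {x \<in> carrier ?A. \<forall>b\<in>B. \<bar>\<phi> b x\<bar> \<le> K}"
    have BA: "B \<subseteq> carrier ?A" and finB: "finite B"
      using subset_trans[OF B fin_gen(2)] finite_subset[OF B fin_gen(1)] .
    obtain bs where bs: "set bs = B" "distinct bs" using finite_distinct_list[OF finB] by blast
    have "\<exists>\<Phi>. functional_on ?V \<Phi> \<and> (\<forall>a\<in>carrier ?A. \<Phi> (?p a) = \<phi> b a)" if "b \<in> B" for b
      using A.additive_extends[OF additive[OF that]] by (metis mult_1)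
    then obtain \<Phi> where \<Phi>: "\<And>b. b \<in> B \<Longrightarrow> functional_on ?V (\<Phi> b)"
      "\<And>b a. b \<in> B \<Longrightarrow> a \<in> carrier ?A \<Longrightarrow> \<Phi> b (?p a) = \<phi> b a" by metis
    have psub: "set (map ?p bs) \<subseteq> carrier ?V" using bs BA by auto
    let ?W = "V.list_span (map ?p bs)"
    have W: "V.subspace_on ?W" by (rule V.subspace_list_span[OF psub])
    have p_mult: "?p (a \<otimes>\<^bsub>?A\<^esub> b) = ?p a \<oplus>\<^bsub>?V\<^esub> ?p b" if "a \<in> carrier ?A" "b \<in> carrier ?A" for a b
      using that by (rule A.pure_tensor_mult)
    have p_one: "?p \<one>\<^bsub>?A\<^esub> = \<zero>\<^bsub>?V\<^esub>"
      using p_mult[of "\<one>\<^bsub>?A\<^esub>" "\<one>\<^bsub>?A\<^esub>"] by (metis A.one_closed A.l_one A.pure_tensor_closed V.add.l_cancel_one')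
    have p_inv: "?p (inv\<^bsub>?A\<^esub> a) = (- 1) \<odot>\<^bsub>?V\<^esub> ?p a" if "a \<in> carrier ?A" for a
      using p_mult[of "inv\<^bsub>?A\<^esub> a" a] that p_one V.minus_eq_smult[of "?p a"]
      by (metis A.inv_closed A.l_inv A.pure_tensor_closed V.minus_equality)
    have p_pow: "?p (a [^]\<^bsub>?A\<^esub> (n::nat)) = real n \<odot>\<^bsub>?V\<^esub> ?p a" if a: "a \<in> carrier ?A" for a n
    proof -
      obtain x where "x \<in> carrier G" "a = abelian_class G x" using a by (auto simp: carrier_abelianization)
      then show ?thesis using ab_proj_nat_pow[of x n] by (simp add: ab_proj_def ac.hom_nat_pow)
    qed
    have genW: "?p a \<in> ?W" if "a \<in> generate ?A B" for a
      using that
    proof (induction rule: generate.induct)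
      case one
      then show ?case using W p_one by (simp add: V.subspace_on_def)
    next
      case (incl h)
      then show ?case using V.list_span_superset[OF psub] bs by auto
    next
      case (inv h)
      then have "?p h \<in> ?W" using V.list_span_superset[OF psub] bs by auto
      then show ?case using W inv BA p_inv[of h] by (auto simp: V.subspace_on_def)
    next
      case (eng x y)
      then show ?case
        using W p_mult[of x y] A.generate_in_carrier[OF BA] by (simp add: V.subspace_on_def)
    qed
    \<comment> \<open>Division by T is possible after tensoring: the image of a is 1 / T times that
      of its T-th power, which lies in the group generated by B.\<close>
    have "?p a \<in> ?W" if a: "a \<in> carrier ?A" for a
    proof -
      have "?p a = (1 / real T) \<odot>\<^bsub>?V\<^esub> ?p (a [^]\<^bsub>?A\<^esub> T)"
        using a T by (simp add: p_pow flip: V.smult_assoc)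
      then show ?thesis using genW[OF gen[OF a]] W by (simp add: V.subspace_on_def)
    qed
    then have span: "carrier ?V = ?W" using A.real_tensor_minimal[OF W] by simp
    \<comment> \<open>Duality of B and \<Phi> peels off one coefficient at a time: \<Phi> c kills
      the images of the remaining basis elements, so the coefficient at c is \<Phi> c v. Hence the
      functionals \<Phi> b separate points.\<close>
    have zero: "v = \<zero>\<^bsub>?V\<^esub>"
      if "v \<in> V.list_span (map ?p cs)" "set cs \<subseteq> B" "distinct cs" "\<forall>b\<in>set cs. \<Phi> b v = 0" for v cs
      using that
    proof (induction cs arbitrary: v)
      case (Cons c cs)
      then obtain w t where w: "v = w \<oplus>\<^bsub>?V\<^esub> t \<odot>\<^bsub>?V\<^esub> ?p c" "w \<in> V.list_span (map ?p cs)" by auto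
      have cs: "set (map ?p cs) \<subseteq> carrier ?V" "c \<in> B" "c \<in> carrier ?A" using Cons.prems BA by auto
      have wV: "w \<in> carrier ?V" using V.subspace_list_span[OF cs(1)] w(2) by (auto simp: V.subspace_on_def)
      have \<Phi>v: "\<Phi> b v = \<Phi> b w + t * \<phi> b c" if "b \<in> B" for b
        using \<Phi>(1)[OF that] \<Phi>(2)[OF that cs(3)] wV cs(3) w(1) by (simp add: functional_on_def)
      have "V.list_span (map ?p cs) \<subseteq> {v \<in> carrier ?V. \<Phi> c v = 0}"
      proof (rule V.list_span_minimal[OF V.subspace_kernel[OF \<Phi>(1)[OF cs(2)]]])
        show "set (map ?p cs) \<subseteq> {v \<in> carrier ?V. \<Phi> c v = 0}"
          using Cons.prems BA coord[OF cs(2)] \<Phi>(2)[OF cs(2)] by (auto simp: subset_iff)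
      qed
      then have "\<Phi> c w = 0" using w(2) by blast
      then have "t = 0" using \<Phi>v[OF cs(2)] Cons.prems(4) coord[OF cs(2) cs(2)] by simp
      then have "v = w" using w(1) wV cs(3) by simp
      then show ?case using Cons.IH[of v] w(2) Cons.prems by simp
    qed simp
    have "\<exists>s. s \<in> S \<and> abelian_class G s = b" if "b \<in> B" for b using B that by blast
    then obtain \<rho> where \<rho>: "\<And>b. b \<in> B \<Longrightarrow> \<rho> b \<in> S \<and> abelian_class G (\<rho> b) = b" by metis
    define gs where "gs = map \<rho> bs"
    have gs: "map (ab_proj G) gs = map ?p bs" using \<rho> bs by (simp add: gs_def ab_proj_def)
    show thesis
    proof (rule that[of gs])
      show "set gs \<subseteq> carrier G" using \<rho> bs SG by (auto simp: gs_def)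
      show "carrier ?V = V.list_span (map (ab_proj G) gs)" unfolding gs by (rule span)
      show "\<exists>f. functional_on ?V f \<and> f v \<noteq> 0" if "v \<in> carrier ?V" "v \<noteq> \<zero>\<^bsub>?V\<^esub>" for v
        using zero[of v bs] that span bs \<Phi>(1) by blast
      show "finite {a \<in> carrier ?A. nrm (?p a) \<le> K}" if nrm: "normed_space ?V nrm" for nrm K
      proof -
        interpret N: normed_space ?V nrm by (rule nrm)
        \<comment> \<open>Any norm dominates the finitely many \<Phi> b, so bounded norm forces
          bounded coordinates, which only finitely many classes have.\<close>
        have "\<exists>C\<ge>0. \<forall>v\<in>carrier ?V. \<bar>\<Phi> b v\<bar> \<le> C * nrm v" if "b \<in> B" for b
          using N.functional_bounded[OF span psub \<Phi>(1)[OF that]] by metis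
        then obtain C where C: "\<And>b v. b \<in> B \<Longrightarrow> v \<in> carrier ?V \<Longrightarrow> \<bar>\<Phi> b v\<bar> \<le> C b * nrm v"
          "\<And>b. b \<in> B \<Longrightarrow> C b \<ge> 0" by metis
        define D where "D = (\<Sum>b\<in>B. C b) * \<bar>K\<bar>"
        have "\<bar>\<phi> b a\<bar> \<le> D" if "b \<in> B" "a \<in> carrier ?A" "nrm (?p a) \<le> K" for a b
        proof -
          have "\<bar>\<phi> b a\<bar> \<le> C b * nrm (?p a)" using C(1)[OF that(1), of "?p a"] \<Phi>(2) that by simp
          also have "\<dots> \<le> (\<Sum>b\<in>B. C b) * \<bar>K\<bar>"
            using that C(2) finB N.nrm_nonneg[of "?p a"]
            by (intro mult_mono member_le_sum sum_nonneg) auto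
          finally show ?thesis by (simp add: D_def)
        qed
        then have "{a \<in> carrier ?A. nrm (?p a) \<le> K} \<subseteq> {a \<in> carrier ?A. \<forall>b\<in>B. \<bar>\<phi> b a\<bar> \<le> D}" by blast
        then show ?thesis by (rule finite_subset) (rule fin)
      qed
    qed
  qed
qed

text \<open>A seminorm composed with a homomorphism is subadditive, so a bound on the letters gives
  a bound per letter of a word.\<close>

lemma ab_proj_lipschitz:
  assumes S: "finite_generating_set G S" and q: "seminormed_space (real_ab G) q"
  obtains C where "C > 0" "\<And>x. x \<in> carrier G \<Longrightarrow> q (ab_proj G x) \<le> C * real (word_length G S x)"
proof -
  interpret q: seminormed_space "real_ab G" q by (rule q)
  let ?S = "S \<union> m_inv G ` S"
  have SG: "finite ?S" "?S \<subseteq> carrier G" using S by (auto simp: finite_generating_set_def)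
  \<comment> \<open>The sum is a crude bound for the maximum over the letters; the summand 1 makes C
    strictly positive, so that it can later appear in a denominator.\<close>
  define C where "C = 1 + (\<Sum>s\<in>?S. q (ab_proj G s))"
  have nonneg: "q (ab_proj G s) \<ge> 0" if "s \<in> ?S" for s
    using that SG(2) by (intro q.nrm_nonneg ab_proj_closed) blast
  have le: "q (ab_proj G s) \<le> C" if "s \<in> ?S" for s
    unfolding C_def using member_le_sum[OF that _ SG(1), of "\<lambda>s. q (ab_proj G s)"] nonneg by fastforce
  have words: "q (ab_proj G (list_prod G ws)) \<le> C * length ws" if "set ws \<subseteq> ?S" for ws
    using that
  proof (induction ws)
    case (Cons w ws)
    have "set (w # ws) \<subseteq> carrier G" using Cons.prems SG(2) by (rule subset_trans)
    then have c: "w \<in> carrier G" "list_prod G ws \<in> carrier G" by simp_all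
    then have "q (ab_proj G (list_prod G (w # ws))) \<le> q (ab_proj G w) + q (ab_proj G (list_prod G ws))"
      using q.nrm_add by (simp add: ab_proj_mult)
    also have "\<dots> \<le> C + C * length ws" using Cons le[of w] by (intro add_mono) auto
    finally show ?case by (simp add: algebra_simps)
  qed (simp add: ab_proj_one)
  show thesis
  proof
    have "0 \<le> (\<Sum>s\<in>?S. q (ab_proj G s))" using nonneg by (rule sum_nonneg)
    then show "C > 0" unfolding C_def by linarith
    show "q (ab_proj G x) \<le> C * real (word_length G S x)" if "x \<in> carrier G" for x
      using word_length_attained[OF S that] words by metis
  qed
qed

text \<open>Rounding each real coefficient down to an integer gives the projection of a group
  element; the error is at most the seminorm of one projected generator per entry of the
  list.\<close>

lemma ab_proj_coarsely_dense:
  assumes q: "seminormed_space (real_ab G) q" and "set gs \<subseteq> carrier G"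
  shows "\<exists>K. \<forall>v\<in>real_space.list_span (real_ab G) (map (ab_proj G) gs).
    \<exists>y\<in>carrier G. q (ab_proj G y \<ominus>\<^bsub>real_ab G\<^esub> v) \<le> K"
  using assms(2)
proof (induction gs)
  case Nil
  interpret q: seminormed_space "real_ab G" q by (rule q)
  show ?case by (auto intro!: exI[of _ 0] bexI[of _ \<one>] simp: ab_proj_one q.diff_eq_zero_iff[THEN iffD2])
next
  case (Cons g gs)
  interpret q: seminormed_space "real_ab G" q by (rule q)
  let ?V = "real_ab G"
  have g: "g \<in> carrier G" and gs: "set (map (ab_proj G) gs) \<subseteq> carrier ?V" using Cons.prems by auto
  obtain K where K: "\<And>v. v \<in> q.list_span (map (ab_proj G) gs) \<Longrightarrow>
    \<exists>y\<in>carrier G. q (ab_proj G y \<ominus>\<^bsub>?V\<^esub> v) \<le> K" using Cons by auto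
  show ?case
  proof (intro exI ballI)
    fix v assume "v \<in> q.list_span (map (ab_proj G) (g # gs))"
    then obtain w t where w: "v = w \<oplus>\<^bsub>?V\<^esub> t \<odot>\<^bsub>?V\<^esub> ab_proj G g" "w \<in> q.list_span (map (ab_proj G) gs)"
      by auto
    have wV: "w \<in> carrier ?V" using w(2) q.subspace_list_span[OF gs] by (auto simp: q.subspace_on_def)
    obtain y where y: "y \<in> carrier G" "q (ab_proj G y \<ominus>\<^bsub>?V\<^esub> w) \<le> K" using K[OF w(2)] by blast
    have "ab_proj G (y \<otimes> g [^] \<lfloor>t\<rfloor>) \<ominus>\<^bsub>?V\<^esub> v =
        (ab_proj G y \<ominus>\<^bsub>?V\<^esub> w) \<oplus>\<^bsub>?V\<^esub> (of_int \<lfloor>t\<rfloor> - t) \<odot>\<^bsub>?V\<^esub> ab_proj G g"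
      using y g wV w(1) by (simp add: ab_proj_mult ab_proj_int_pow q.add_diff_swap q.smult_diff_left)
    then have "q (ab_proj G (y \<otimes> g [^] \<lfloor>t\<rfloor>) \<ominus>\<^bsub>?V\<^esub> v) \<le> K + \<bar>of_int \<lfloor>t\<rfloor> - t\<bar> * q (ab_proj G g)"
      using q.nrm_add[of "ab_proj G y \<ominus>\<^bsub>?V\<^esub> w" "(of_int \<lfloor>t\<rfloor> - t) \<odot>\<^bsub>?V\<^esub> ab_proj G g"] y g wV
      by (simp add: q.nrm_smult)
    also have "\<dots> \<le> K + 1 * q (ab_proj G g)"
      using q.nrm_nonneg[of "ab_proj G g"] g by (intro add_left_mono mult_right_mono) (linarith, simp)
    finally show "\<exists>y\<in>carrier G. q (ab_proj G y \<ominus>\<^bsub>?V\<^esub> v) \<le> K + 1 * q (ab_proj G g)"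
      using y g by (intro bexI[of _ "y \<otimes> g [^] \<lfloor>t\<rfloor>"]) auto
  qed
qed

text \<open>The exponent of a generator in the \<open>n\<close>-th step of the path is \<open>\<lfloor>(n + 1) t\<rfloor> - \<lfloor>n t\<rfloor>\<close>.\<close>

lemma ab_proj_path:
  assumes q: "seminormed_space (real_ab G) q" and "set gs \<subseteq> carrier G"
    and "v \<in> real_space.list_span (real_ab G) (map (ab_proj G) gs)"
  shows "\<exists>d K. range d \<subseteq> carrier G \<and> finite (range d) \<and>
    (\<forall>n. q (ab_proj G (list_prod G (map d [0..<n])) \<ominus>\<^bsub>real_ab G\<^esub> real n \<odot>\<^bsub>real_ab G\<^esub> v) \<le> K)"
  using assms(2,3)
proof (induction gs arbitrary: v)
  case Nil
  interpret q: seminormed_space "real_ab G" q by (rule q)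
  have "list_prod G (map (\<lambda>n. \<one>) [0..<n]) = \<one>" for n :: nat by (induction n) auto
  then show ?case using Nil
    by (intro exI[of _ "\<lambda>n. \<one>"] exI[of _ 0])
      (simp add: ab_proj_one q.diff_eq_zero_iff[THEN iffD2] q.list_span.simps)
next
  case (Cons g gs)
  interpret q: seminormed_space "real_ab G" q by (rule q)
  let ?V = "real_ab G"
  have g: "g \<in> carrier G" and gs: "set (map (ab_proj G) gs) \<subseteq> carrier ?V" using Cons.prems by auto
  obtain w t where w: "v = w \<oplus>\<^bsub>?V\<^esub> t \<odot>\<^bsub>?V\<^esub> ab_proj G g" "w \<in> q.list_span (map (ab_proj G) gs)"
    using Cons.prems by auto
  have wV: "w \<in> carrier ?V" using w(2) q.subspace_list_span[OF gs] by (auto simp: q.subspace_on_def)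
  obtain d K where d: "range d \<subseteq> carrier G" "finite (range d)"
    and K: "\<And>n. q (ab_proj G (list_prod G (map d [0..<n])) \<ominus>\<^bsub>?V\<^esub> real n \<odot>\<^bsub>?V\<^esub> w) \<le> K"
    using Cons.IH[OF _ w(2)] Cons.prems by auto
  define k where "k n = \<lfloor>real n * t\<rfloor>" for n :: nat
  define d' where "d' n = d n \<otimes> g [^] (k (Suc n) - k n)" for n
  have dG: "d n \<in> carrier G" for n using d(1) by blast
  have d'G: "d' n \<in> carrier G" for n using dG g by (simp add: d'_def)
  have words: "set (map d [0..<n]) \<subseteq> carrier G" "set (map d' [0..<n]) \<subseteq> carrier G" for n
    using dG d'G by auto
  \<comment> \<open>Consecutive values of the rounded multiples differ by the floor of t or by one
    more, so the new steps still form a finite set.\<close>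
  have k: "k (Suc n) - k n \<in> {\<lfloor>t\<rfloor>..\<lfloor>t\<rfloor> + 1}" for n
  proof -
    have "real (Suc n) * t = real n * t + t" by (simp add: algebra_simps)
    then show ?thesis unfolding k_def atLeastAtMost_iff by linarith
  qed
  have "range d' \<subseteq> (\<lambda>(x, j). x \<otimes> g [^] j) ` (range d \<times> {\<lfloor>t\<rfloor>..\<lfloor>t\<rfloor> + 1})"
    using k unfolding d'_def by (intro image_subsetI) (rule image_eqI[OF _ SigmaI], auto)
  then have fin: "finite (range d')" by (rule finite_subset) (use d(2) in auto)
  \<comment> \<open>The factors of different generators are interleaved in the word, but their order
    disappears in the projection; the exponents of g telescope to \<open>k n\<close>, the floor of n
    t.\<close>
  have proj: "ab_proj G (list_prod G (map d' [0..<n])) =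
      ab_proj G (list_prod G (map d [0..<n])) \<oplus>\<^bsub>?V\<^esub> of_int (k n) \<odot>\<^bsub>?V\<^esub> ab_proj G g" for n
  proof (induction n)
    case 0
    then show ?case using g by (simp add: k_def ab_proj_one)
  next
    case (Suc n)
    let ?x = "ab_proj G (list_prod G (map d [0..<n]))" and ?u = "ab_proj G g"
    have x: "?x \<in> carrier ?V" "?u \<in> carrier ?V" "ab_proj G (d n) \<in> carrier ?V"
      using g dG words by auto
    have "ab_proj G (list_prod G (map d' [0..<Suc n])) =
        ab_proj G (list_prod G (map d' [0..<n])) \<oplus>\<^bsub>?V\<^esub> ab_proj G (d' n)"
      using list_prod_upt_Suc[of d' n] list_prod_upt_closed[of d' n] d'G ab_proj_mult by metis
    also have "ab_proj G (d' n) =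
        ab_proj G (d n) \<oplus>\<^bsub>?V\<^esub> of_int (k (Suc n) - k n) \<odot>\<^bsub>?V\<^esub> ?u"
      unfolding d'_def using dG g by (simp add: ab_proj_mult ab_proj_int_pow del: of_int_diff)
    also note Suc
    also have "(?x \<oplus>\<^bsub>?V\<^esub> of_int (k n) \<odot>\<^bsub>?V\<^esub> ?u) \<oplus>\<^bsub>?V\<^esub>
        (ab_proj G (d n) \<oplus>\<^bsub>?V\<^esub> of_int (k (Suc n) - k n) \<odot>\<^bsub>?V\<^esub> ?u) =
        (?x \<oplus>\<^bsub>?V\<^esub> ab_proj G (d n)) \<oplus>\<^bsub>?V\<^esub>
        (of_int (k n) \<odot>\<^bsub>?V\<^esub> ?u \<oplus>\<^bsub>?V\<^esub> of_int (k (Suc n) - k n) \<odot>\<^bsub>?V\<^esub> ?u)"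
      using x by (simp add: q.a_ac del: of_int_diff)
    also have "of_int (k n) \<odot>\<^bsub>?V\<^esub> ?u \<oplus>\<^bsub>?V\<^esub> of_int (k (Suc n) - k n) \<odot>\<^bsub>?V\<^esub> ?u =
        of_int (k (Suc n)) \<odot>\<^bsub>?V\<^esub> ?u"
      using x by (simp flip: q.smult_l_distr)
    also have "?x \<oplus>\<^bsub>?V\<^esub> ab_proj G (d n) = ab_proj G (list_prod G (map d [0..<Suc n]))"
      using list_prod_upt_Suc[of d n] list_prod_upt_closed[of d n] dG ab_proj_mult by metis
    finally show ?case .
  qed
  have "q (ab_proj G (list_prod G (map d' [0..<n])) \<ominus>\<^bsub>?V\<^esub> real n \<odot>\<^bsub>?V\<^esub> v) \<le> K + q (ab_proj G g)" for n
  proof -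
    let ?x = "ab_proj G (list_prod G (map d [0..<n]))" and ?u = "ab_proj G g"
    have x: "?x \<in> carrier ?V" "?u \<in> carrier ?V" using g words by auto
    have "ab_proj G (list_prod G (map d' [0..<n])) \<ominus>\<^bsub>?V\<^esub> real n \<odot>\<^bsub>?V\<^esub> v =
        (?x \<ominus>\<^bsub>?V\<^esub> real n \<odot>\<^bsub>?V\<^esub> w) \<oplus>\<^bsub>?V\<^esub> (of_int (k n) - real n * t) \<odot>\<^bsub>?V\<^esub> ?u"
      using x wV w(1)
      by (simp add: proj q.smult_r_distr q.add_diff_swap q.smult_diff_left flip: q.smult_assoc)
    then have "q (ab_proj G (list_prod G (map d' [0..<n])) \<ominus>\<^bsub>?V\<^esub> real n \<odot>\<^bsub>?V\<^esub> v) \<le>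
        q (?x \<ominus>\<^bsub>?V\<^esub> real n \<odot>\<^bsub>?V\<^esub> w) + \<bar>of_int (k n) - real n * t\<bar> * q ?u"
      using q.nrm_add[of "?x \<ominus>\<^bsub>?V\<^esub> real n \<odot>\<^bsub>?V\<^esub> w" "(of_int (k n) - real n * t) \<odot>\<^bsub>?V\<^esub> ?u"] x wV
      by (simp add: q.nrm_smult)
    also have "\<bar>of_int (k n) - real n * t\<bar> \<le> 1" unfolding k_def by linarith
    then have "\<bar>of_int (k n) - real n * t\<bar> * q ?u \<le> 1 * q ?u"
      using q.nrm_nonneg[OF x(2)] by (rule mult_right_mono)
    finally show ?thesis using K[of n] by simp
  qed
  then show ?case using fin d'G by blast
qed

text \<open>
  Up to finitely many coset representatives, the path lies in the commutator subgroup and its steps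
  there are finitely many elements.
\<close>

lemma bounded_ab_path_sublinear:
  fixes y :: "nat \<Rightarrow> 'a" and \<epsilon> :: real
  assumes nilp: "nilpotent_group G" and S: "finite_generating_set G S" and nrm: "normed_space (real_ab G) nrm"
    and y: "\<And>n. y n \<in> carrier G" and bounded: "\<And>n. nrm (ab_proj G (y n)) \<le> K"
    and steps: "\<And>n. real (word_length G S (inv (y n) \<otimes> y (Suc n))) \<le> D"
    and \<epsilon>: "\<epsilon> > 0"
  obtains A where "\<And>n. real (word_length G S (inv (y 0) \<otimes> y n)) \<le> \<epsilon> * real n + A"
proof -
  let ?len = "\<lambda>x. real (word_length G S x)"
  interpret len: group_length G ?len by (rule group_length_word_length[OF S])
  let ?A0 = "{a \<in> carrier (abelianization G). nrm (pure_tensor (abelianization G) a 1) \<le> K}"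
  have "finite ?A0"
  proof (rule real_ab_coordinates[OF S])
    assume fin: "\<And>nrm K. normed_space (real_ab G) nrm \<Longrightarrow>
      finite {a \<in> carrier (abelianization G). nrm (pure_tensor (abelianization G) a 1) \<le> K}"
    show ?thesis by (rule fin[OF nrm])
  qed
  have "\<exists>x. x \<in> carrier G \<and> abelian_class G x = a" if "a \<in> carrier (abelianization G)" for a
    using that by (auto simp: carrier_abelianization)
  then obtain rep where rep: "\<And>a. a \<in> carrier (abelianization G) \<Longrightarrow> rep a \<in> carrier G \<and> abelian_class G (rep a) = a"
    by metis
  define R where "R = rep ` ?A0"
  have finR: "finite R" and RG: "R \<subseteq> carrier G" using \<open>finite ?A0\<close> rep by (auto simp: R_def)
  \<comment> \<open>The bounded projection puts the class of \<open>y n\<close> into the finite set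
    of classes, so these representatives range over the finite set R.\<close>
  define b where "b n = rep (abelian_class G (y n))" for n
  have b: "b n \<in> R" "abelian_class G (b n) = abelian_class G (y n)" for n
    using y bounded[of n] rep[of "abelian_class G (y n)"] by (auto simp: b_def R_def ab_proj_def)
  have bG: "b n \<in> carrier G" for n using b RG by blast
  define c where "c n = y n \<otimes> inv (b n)" for n
  have c: "c n \<in> lower_central G 1" for n
    unfolding c_def using y bG b by (intro abelian_class_eq_imp) auto
  have cG: "c n \<in> carrier G" for n using y bG by (simp add: c_def)
  define f where "f n = inv (c n) \<otimes> c (Suc n)" for n
  let ?B = "{x \<in> carrier G. ?len x \<le> D}"
  \<comment> \<open>A step of c is a step of y, which lies in a finite ball, multiplied by one
    representative on the left and the inverse of another on the right. The finite set of all such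
    products does not depend on n; intersecting keeps those in the commutator subgroup.\<close>
  define F where "F = (\<lambda>(u, s, w). u \<otimes> s \<otimes> inv w) ` (R \<times> ?B \<times> R) \<inter> lower_central G 1"
  have finF: "finite F" unfolding F_def using finR finite_word_ball[OF S] by auto
  have f: "f n \<in> F" for n
  proof -
    have "f n = b n \<otimes> (inv (y n) \<otimes> y (Suc n)) \<otimes> inv (b (Suc n))"
      using y bG by (simp add: f_def c_def inv_mult_group m_assoc)
    moreover have "inv (y n) \<otimes> y (Suc n) \<in> ?B" using y steps by simp
    ultimately have "f n \<in> (\<lambda>(u, s, w). u \<otimes> s \<otimes> inv w) ` (R \<times> ?B \<times> R)"
      using b by (intro image_eqI[of _ _ "(b n, inv (y n) \<otimes> y (Suc n), b (Suc n))"]) auto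
    moreover have "f n \<in> lower_central G 1"
      unfolding f_def using c normal_imp_subgroup[OF normal_lower_central]
      by (intro subgroup.m_closed subgroup.m_inv_closed)
    ultimately show ?thesis by (simp add: F_def)
  qed
  obtain A where A: "\<And>ws. set ws \<subseteq> F \<Longrightarrow> ?len (list_prod G ws) \<le> \<epsilon> * real (length ws) + A"
    using len.nilpotent_derived_sublinear[OF nilp finF _ \<epsilon>] by (auto simp: F_def)
  have fG: "f n \<in> carrier G" for n using cG by (simp add: f_def)
  have c_prod: "c n = c 0 \<otimes> list_prod G (map f [0..<n])" for n
  proof (induction n)
    case (Suc n)
    have "c 0 \<otimes> list_prod G (map f [0..<Suc n]) = c n \<otimes> f n"
      unfolding list_prod_upt_Suc[of f, OF fG]
      using Suc cG fG list_prod_upt_closed[of f n, OF fG] by (simp add: m_assoc)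
    also have "\<dots> = c (Suc n)" using cG by (simp add: f_def flip: m_assoc)
    finally show ?case by simp
  qed (use cG in simp)
  obtain M where M: "\<And>r. r \<in> R \<Longrightarrow> ?len r \<le> M"
  proof
    show "?len r \<le> Max (?len ` R)" if "r \<in> R" for r using that finR by simp
  qed
  show thesis
  proof
    fix n
    define p where "p = list_prod G (map f [0..<n])"
    have pG: "p \<in> carrier G" unfolding p_def using fG by (rule list_prod_upt_closed)
    have "y n = c n \<otimes> b n" using y bG by (simp add: c_def m_assoc)
    then have "inv (y 0) \<otimes> y n = inv (y 0) \<otimes> (c 0 \<otimes> (p \<otimes> b n))"
      using cG bG pG c_prod[of n] by (simp add: p_def m_assoc)
    also have "?len \<dots> \<le> ?len (inv (y 0)) + (?len (c 0) + (?len p + ?len (b n)))"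
      using y cG bG pG
      by (intro order_trans[OF len.len_mult] add_left_mono order_refl) auto
    \<comment> \<open>Only the product p of the steps grows with n; both endpoints and the last
      representative contribute to the additive constant.\<close>
    also have "\<dots> \<le> ?len (inv (y 0)) + (?len (c 0) + ((\<epsilon> * real n + A) + M))"
      using A[of "map f [0..<n]"] f M[OF b(1)[of n]] by (intro add_left_mono add_mono) (auto simp: p_def)
    finally show "?len (inv (y 0) \<otimes> y n) \<le> \<epsilon> * real n + (?len (inv (y 0)) + ?len (c 0) + A + M)"
      by simp
  qed
qed

end

section \<open>Linearization of quasi-isometries\<close>

lemma (in real_space) normed_space_norm_on: "norm_on V nrm \<Longrightarrow> normed_space V nrm"
  by unfold_locales (auto simp: norm_on_def)

lemma (in real_space) seminormed_space_functional:
  "functional_on V f \<Longrightarrow> seminormed_space V (\<lambda>v. \<bar>f v\<bar>)"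
  by unfold_locales (auto simp: functional_on_def abs_mult)

text \<open>This is the gauge for the path in the injectivity argument: a path close to n v in this
  seminorm is controlled at once by its image under L and by the functional f.\<close>

lemma (in seminormed_space) seminormed_space_comp_add:
  assumes "real_space W" "linear_on W V L" "functional_on W f"
  shows "seminormed_space W (\<lambda>w. nrm (L w) + \<bar>f w\<bar>)"
proof -
  interpret W: real_space W by fact
  show ?thesis
  proof unfold_locales
    fix v a assume v: "v \<in> carrier W"
    then have "L v \<in> carrier V" using assms(2) by (auto simp: linear_on_def)
    then show "nrm (L (a \<odot>\<^bsub>W\<^esub> v)) + \<bar>f (a \<odot>\<^bsub>W\<^esub> v)\<bar> = \<bar>a\<bar> * (nrm (L v) + \<bar>f v\<bar>)"
      using v assms by (simp add: linear_on_def functional_on_def nrm_smult abs_mult distrib_left)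
    fix u assume u: "u \<in> carrier W"
    have "nrm (L u \<oplus> L v) \<le> nrm (L u) + nrm (L v)"
      using u v assms(2) by (intro nrm_add) (auto simp: linear_on_def)
    then show "nrm (L (u \<oplus>\<^bsub>W\<^esub> v)) + \<bar>f (u \<oplus>\<^bsub>W\<^esub> v)\<bar> \<le> nrm (L u) + \<bar>f u\<bar> + (nrm (L v) + \<bar>f v\<bar>)"
      using u v assms by (simp add: linear_on_def functional_on_def)
  qed
qed

lemma (in real_space) functional_diff:
  assumes "functional_on V f" "u \<in> carrier V" "v \<in> carrier V"
  shows "f (u \<ominus> v) = f u - f v"
proof -
  have "u \<ominus> v = u \<oplus> (- 1) \<odot> v" using assms by (simp add: minus_eq minus_eq_smult)
  then show ?thesis using assms by (simp add: functional_on_def)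
qed

lemma (in real_space) linear_diff:
  assumes "linear_on V W L" "real_space W" "u \<in> carrier V" "v \<in> carrier V"
  shows "L (u \<ominus> v) = L u \<ominus>\<^bsub>W\<^esub> L v"
proof -
  interpret W: real_space W by fact
  have "L v \<in> carrier W" using assms by (auto simp: linear_on_def)
  moreover have "u \<ominus> v = u \<oplus> (- 1) \<odot> v" using assms by (simp add: minus_eq minus_eq_smult)
  ultimately show ?thesis using assms by (simp add: linear_on_def W.minus_eq W.minus_eq_smult)
qed

lemma (in group) real_ab_finite_span:
  assumes S: "finite_generating_set G S"
  obtains gs where "set gs \<subseteq> carrier G"
    "carrier (real_ab G) = real_space.list_span (real_ab G) (map (ab_proj G) gs)"
  by (rule real_ab_coordinates[OF S]) (rule that)

lemma (in group) real_ab_separating: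
  assumes S: "finite_generating_set G S"
    and v: "v \<in> carrier (real_ab G)" "v \<noteq> \<zero>\<^bsub>real_ab G\<^esub>"
  obtains f where "functional_on (real_ab G) f" "f v \<noteq> 0"
proof (rule real_ab_coordinates[OF S])
  assume "\<And>v. v \<in> carrier (real_ab G) \<Longrightarrow> v \<noteq> \<zero>\<^bsub>real_ab G\<^esub> \<Longrightarrow>
    \<exists>f. functional_on (real_ab G) f \<and> f v \<noteq> 0"
  from this[OF v] show thesis using that by blast
qed

lemma SUP_ereal_less_top:
  assumes "\<And>x. x \<in> A \<Longrightarrow> f x \<le> B"
  shows "(SUP x\<in>A. ereal (f x)) < \<infinity>"
proof -
  have "(SUP x\<in>A. ereal (f x)) \<le> ereal B" using assms by (intro SUP_least) auto
  then show ?thesis by (rule order.strict_trans1) simp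
qed

lemma SUP_ereal_bounded:
  assumes "(SUP x\<in>A. ereal (f x)) < \<infinity>"
  obtains B where "\<And>x. x \<in> A \<Longrightarrow> f x \<le> B"
proof -
  obtain n where n: "(SUP x\<in>A. ereal (f x)) < ereal (real n)"
    using assms less_PInf_Ex_of_nat[of "SUP x\<in>A. ereal (f x)"] by (metis less_irrefl)
  show thesis
  proof
    fix x assume "x \<in> A"
    then have "ereal (f x) \<le> (SUP x\<in>A. ereal (f x))" by (rule SUP_upper)
    then have "ereal (f x) < ereal (real n)" using n by (rule order.strict_trans1)
    then show "f x \<le> real n" by simp
  qed
qed

lemma linearization_surjective:
  assumes N: "group N" "finite_generating_set N S" and M: "group M" "finite_generating_set M T"
    and qi: "quasi_isometry (carrier N) (word_dist N S) (carrier M) (word_dist M T) \<Psi>"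
    and nrm: "normed_space (real_ab M) nrm" and L: "linear_on (real_ab N) (real_ab M) L"
    and close: "\<And>x. x \<in> carrier N \<Longrightarrow> nrm (ab_proj M (\<Psi> x) \<ominus>\<^bsub>real_ab M\<^esub> L (ab_proj N x)) \<le> C"
  shows "L ` carrier (real_ab N) = carrier (real_ab M)"
proof -
  let ?W = "real_ab M"
  interpret N: group N by fact
  interpret M: group M by fact
  interpret V: real_space "real_ab N" by (rule N.real_space_real_ab)
  interpret W: normed_space ?W nrm by (rule nrm)
  obtain gs where gs: "set gs \<subseteq> carrier N" "carrier (real_ab N) = V.list_span (map (ab_proj N) gs)"
    by (rule N.real_ab_finite_span[OF N(2)])
  obtain hs where hs: "set hs \<subseteq> carrier M" "carrier ?W = W.list_span (map (ab_proj M) hs)"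
    by (rule M.real_ab_finite_span[OF M(2)])
  have gsV: "set (map (ab_proj N) gs) \<subseteq> carrier (real_ab N)" using gs(1) by auto
  have L_closed: "L v \<in> carrier ?W" if "v \<in> carrier (real_ab N)" for v
    using L that by (auto simp: linear_on_def)
  \<comment> \<open>The image is finitely spanned, and therefore closed.\<close>
  have image: "L ` carrier (real_ab N) = W.list_span (map L (map (ab_proj N) gs))"
    unfolding gs(2) by (rule V.linear_on_list_span_image[OF L W.real_space_axioms gsV])
  have LgsW: "set (map L (map (ab_proj N) gs)) \<subseteq> carrier ?W" using gsV L_closed by auto
  obtain K where K: "\<And>v. v \<in> carrier ?W \<Longrightarrow> \<exists>y\<in>carrier M. nrm (ab_proj M y \<ominus>\<^bsub>?W\<^esub> v) \<le> K"
    using M.ab_proj_coarsely_dense[OF W.seminormed_space_axioms hs(1)] unfolding hs(2)[symmetric] by blast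
  obtain B where B: "B > 0" "\<And>y. y \<in> carrier M \<Longrightarrow> nrm (ab_proj M y) \<le> B * real (word_length M T y)"
    by (rule M.ab_proj_lipschitz[OF M(2) W.seminormed_space_axioms]) blast
  obtain c where c: "\<And>y. y \<in> carrier M \<Longrightarrow> \<exists>x\<in>carrier N. word_dist M T y (\<Psi> x) \<le> c"
    and \<Psi>: "\<And>x. x \<in> carrier N \<Longrightarrow> \<Psi> x \<in> carrier M"
    using qi unfolding quasi_isometry_def by blast
  \<comment> \<open>The budget: K from v to the projection of some y, B * c from there to the
    projection of some \<Psi> x because the projection is B-Lipschitz, and C from there to the image
    of L.\<close>
  have "\<exists>w\<in>L ` carrier (real_ab N). nrm (v \<ominus>\<^bsub>?W\<^esub> w) \<le> K + (B * c + C)" if v: "v \<in> carrier ?W" for v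
  proof -
    obtain y where y: "y \<in> carrier M" "nrm (ab_proj M y \<ominus>\<^bsub>?W\<^esub> v) \<le> K" using K[OF v] by blast
    obtain x where x: "x \<in> carrier N" "word_dist M T y (\<Psi> x) \<le> c" using c[OF y(1)] by blast
    let ?y = "ab_proj M y" and ?z = "ab_proj M (\<Psi> x)" and ?w = "L (ab_proj N x)"
    have cl: "?y \<in> carrier ?W" "?z \<in> carrier ?W" "?w \<in> carrier ?W"
      using x y \<Psi> L_closed by auto
    have "ab_proj M (inv\<^bsub>M\<^esub> y \<otimes>\<^bsub>M\<^esub> \<Psi> x) = ?z \<ominus>\<^bsub>?W\<^esub> ?y"
      using y(1) \<Psi>[OF x(1)] by (simp add: M.ab_proj_mult M.ab_proj_inv W.minus_eq W.a_comm)
    then have "nrm (?z \<ominus>\<^bsub>?W\<^esub> ?y) \<le> B * word_dist M T y (\<Psi> x)"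
      using B(2)[of "inv\<^bsub>M\<^esub> y \<otimes>\<^bsub>M\<^esub> \<Psi> x"] y(1) \<Psi>[OF x(1)] by (simp add: word_dist_def)
    also have "\<dots> \<le> B * c" using B x by (intro mult_left_mono) auto
    finally have "nrm (?y \<ominus>\<^bsub>?W\<^esub> ?z) \<le> B * c" using cl by (simp add: W.nrm_diff_commute)
    moreover have "nrm (v \<ominus>\<^bsub>?W\<^esub> ?y) \<le> K" using y cl v by (simp add: W.nrm_diff_commute)
    moreover have "nrm (v \<ominus>\<^bsub>?W\<^esub> ?w) \<le> nrm (v \<ominus>\<^bsub>?W\<^esub> ?y) + nrm (?y \<ominus>\<^bsub>?W\<^esub> ?w)"
      using v cl by (intro W.nrm_diff_triangle)
    moreover have "nrm (?y \<ominus>\<^bsub>?W\<^esub> ?w) \<le> nrm (?y \<ominus>\<^bsub>?W\<^esub> ?z) + nrm (?z \<ominus>\<^bsub>?W\<^esub> ?w)"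
      using cl by (intro W.nrm_diff_triangle)
    ultimately have "nrm (v \<ominus>\<^bsub>?W\<^esub> ?w) \<le> K + (B * c + C)" using close[OF x(1)] by linarith
    then show ?thesis using x(1) N.ab_proj_closed by blast
  qed
  then show ?thesis
    using W.subspace_list_span[OF LgsW] W.nrm_closed_list_span[OF LgsW]
    unfolding image by (intro W.coarsely_dense_subspace)
qed

lemma linearization_injective:
  assumes N: "group N" "finite_generating_set N S"
    and M: "group M" "nilpotent_group M" "finite_generating_set M T"
    and qi: "quasi_isometry (carrier N) (word_dist N S) (carrier M) (word_dist M T) \<Psi>"
    and nrm: "normed_space (real_ab M) nrm" and L: "linear_on (real_ab N) (real_ab M) L"
    and close: "\<And>x. x \<in> carrier N \<Longrightarrow> nrm (ab_proj M (\<Psi> x) \<ominus>\<^bsub>real_ab M\<^esub> L (ab_proj N x)) \<le> C"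
    and v: "v \<in> carrier (real_ab N)" "L v = \<zero>\<^bsub>real_ab M\<^esub>"
  shows "v = \<zero>\<^bsub>real_ab N\<^esub>"
proof (rule ccontr)
  assume "v \<noteq> \<zero>\<^bsub>real_ab N\<^esub>"
  let ?V = "real_ab N" and ?W = "real_ab M"
  interpret N: group N by fact
  interpret M: group M by fact
  interpret V: real_space ?V by (rule N.real_space_real_ab)
  interpret W: normed_space ?W nrm by (rule nrm)
  obtain gs where gs: "set gs \<subseteq> carrier N" "carrier ?V = V.list_span (map (ab_proj N) gs)"
    by (rule N.real_ab_finite_span[OF N(2)])
  obtain f where f: "functional_on ?V f" "f v \<noteq> 0"
    by (rule N.real_ab_separating[OF N(2) v(1) \<open>v \<noteq> \<zero>\<^bsub>?V\<^esub>\<close>])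
  obtain k c where k: "k \<ge> 1" and c: "c \<ge> 0"
    and lower: "\<And>x x'. x \<in> carrier N \<Longrightarrow> x' \<in> carrier N \<Longrightarrow>
      word_dist N S x x' / k - c \<le> word_dist M T (\<Psi> x) (\<Psi> x')"
    and upper: "\<And>x x'. x \<in> carrier N \<Longrightarrow> x' \<in> carrier N \<Longrightarrow>
      word_dist M T (\<Psi> x) (\<Psi> x') \<le> k * word_dist N S x x' + c"
    and \<Psi>: "\<And>x. x \<in> carrier N \<Longrightarrow> \<Psi> x \<in> carrier M"
    using qi unfolding quasi_isometry_def by blast
  have "seminormed_space ?V (\<lambda>w. nrm (L w) + \<bar>f w\<bar>)"
    by (rule W.seminormed_space_comp_add[OF V.real_space_axioms L f(1)])
  then obtain d K where d: "range d \<subseteq> carrier N" "finite (range d)"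
    and K: "\<And>n. nrm (L (ab_proj N (list_prod N (map d [0..<n])) \<ominus>\<^bsub>?V\<^esub> real n \<odot>\<^bsub>?V\<^esub> v)) +
      \<bar>f (ab_proj N (list_prod N (map d [0..<n])) \<ominus>\<^bsub>?V\<^esub> real n \<odot>\<^bsub>?V\<^esub> v)\<bar> \<le> K"
    using N.ab_proj_path[OF _ gs(1)] v(1) gs(2) by blast
  define x where "x n = list_prod N (map d [0..<n])" for n
  have dN: "d n \<in> carrier N" for n using d(1) by blast
  have xN: "x n \<in> carrier N" for n unfolding x_def using dN by (rule N.list_prod_upt_closed)
  have x_Suc: "x (Suc n) = x n \<otimes>\<^bsub>N\<^esub> d n" for n unfolding x_def using dN by (rule N.list_prod_upt_Suc)
  have L_closed: "L w \<in> carrier ?W" if "w \<in> carrier ?V" for w using L that by (auto simp: linear_on_def)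
  \<comment> \<open>As L v = 0, the drift n v is invisible to L and only the bounded error remains,
    whereas f registers it as n \<bar>f v\<bar>.\<close>
  have Lx: "nrm (L (ab_proj N (x n))) \<le> K" and fx: "real n * \<bar>f v\<bar> - K \<le> \<bar>f (ab_proj N (x n))\<bar>" for n
  proof -
    let ?u = "ab_proj N (x n)"
    have u: "?u \<in> carrier ?V" using xN by simp
    have "L (?u \<ominus>\<^bsub>?V\<^esub> real n \<odot>\<^bsub>?V\<^esub> v) = L ?u \<ominus>\<^bsub>?W\<^esub> real n \<odot>\<^bsub>?W\<^esub> L v"
      using V.linear_diff[OF L W.real_space_axioms u V.smult_closed[OF v(1)]] L v(1)
      by (simp add: linear_on_def)
    then have L_eq: "L (?u \<ominus>\<^bsub>?V\<^esub> real n \<odot>\<^bsub>?V\<^esub> v) = L ?u"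
      using v(2) L_closed[OF u] by (simp add: W.minus_eq W.minus_eq_smult)
    have f_eq: "f (?u \<ominus>\<^bsub>?V\<^esub> real n \<odot>\<^bsub>?V\<^esub> v) = f ?u - real n * f v"
      using V.functional_diff[OF f(1) u V.smult_closed[OF v(1)]] f(1) v(1) by (simp add: functional_on_def)
    have *: "nrm (L ?u) + \<bar>f ?u - real n * f v\<bar> \<le> K" using K[of n] L_eq f_eq by (simp add: x_def)
    then show "nrm (L ?u) \<le> K" by linarith
    have "\<bar>real n * f v\<bar> = real n * \<bar>f v\<bar>" by (simp add: abs_mult)
    then show "real n * \<bar>f v\<bar> - K \<le> \<bar>f ?u\<bar>"
      using * W.nrm_nonneg[OF L_closed[OF u]] by linarith
  qed
  obtain B where B: "B > 0" "\<And>x. x \<in> carrier N \<Longrightarrow> \<bar>f (ab_proj N x)\<bar> \<le> B * real (word_length N S x)"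
    by (rule N.ab_proj_lipschitz[OF N(2) V.seminormed_space_functional[OF f(1)]]) blast
  define D where "D = Max ((\<lambda>g. real (word_length N S g)) ` range d)"
  have D: "real (word_length N S (d n)) \<le> D" for n
    unfolding D_def using d(2) by (intro Max_ge) auto
  \<comment> \<open>The functional f is B-Lipschitz for the word length, and going back through the
    quasi-isometry costs a factor k. So \<epsilon> n in M permits f to grow by B k \<epsilon> n = n
    \<bar>f v\<bar> / 2, half of its actual growth.\<close>
  define \<epsilon> where "\<epsilon> = \<bar>f v\<bar> / (2 * B * k)"
  have \<epsilon>: "\<epsilon> > 0" using f(2) B(1) k by (simp add: \<epsilon>_def)
  \<comment> \<open>The projection of \<Psi> (x n) has norm at most C + K, being within C of a
    vector of norm at most K. Steps of length at most D become steps of length at most k * D +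
    c.\<close>
  have "\<exists>A. \<forall>n. real (word_length M T (inv\<^bsub>M\<^esub> \<Psi> (x 0) \<otimes>\<^bsub>M\<^esub> \<Psi> (x n))) \<le> \<epsilon> * real n + A"
  proof (rule M.bounded_ab_path_sublinear[OF M(2,3) nrm _ _ _ \<epsilon>, of "\<lambda>n. \<Psi> (x n)" "C + K" "k * D + c"])
    fix n
    show "\<Psi> (x n) \<in> carrier M" using \<Psi> xN by blast
    let ?z = "ab_proj M (\<Psi> (x n))" and ?w = "L (ab_proj N (x n))"
    have cl: "?z \<in> carrier ?W" "?w \<in> carrier ?W" using \<Psi> xN L_closed by auto
    then have "nrm ?z \<le> nrm (?z \<ominus>\<^bsub>?W\<^esub> ?w) + nrm ?w"
      using W.nrm_add[of "?z \<ominus>\<^bsub>?W\<^esub> ?w" ?w] by (simp add: W.diff_add_cancel)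
    then show "nrm ?z \<le> C + K" using close[OF xN, of n] Lx[of n] by linarith
    have "inv\<^bsub>N\<^esub> x n \<otimes>\<^bsub>N\<^esub> x (Suc n) = d n"
      using xN[of n] dN[of n] by (simp add: x_Suc flip: N.m_assoc)
    then have "word_dist N S (x n) (x (Suc n)) \<le> D" using D by (simp add: word_dist_def)
    then have "k * word_dist N S (x n) (x (Suc n)) + c \<le> k * D + c"
      using k by (intro add_right_mono mult_left_mono) auto
    then show "real (word_length M T (inv\<^bsub>M\<^esub> \<Psi> (x n) \<otimes>\<^bsub>M\<^esub> \<Psi> (x (Suc n)))) \<le> k * D + c"
      using upper[OF xN xN, of n "Suc n"] by (simp add: word_dist_def)
  qed blast
  then obtain A where A: "\<And>n. real (word_length M T (inv\<^bsub>M\<^esub> \<Psi> (x 0) \<otimes>\<^bsub>M\<^esub> \<Psi> (x n))) \<le> \<epsilon> * real n + A"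
    by blast
  have bound: "real n * \<bar>f v\<bar> \<le> 2 * (K + B * k * (A + c))" for n
  proof -
    have "word_dist N S (x 0) (x n) / k - c \<le> \<epsilon> * real n + A"
      using lower[OF xN xN, of 0 n] A[of n] by (simp add: word_dist_def)
    moreover have "x 0 = \<one>\<^bsub>N\<^esub>" by (simp add: x_def)
    then have "word_dist N S (x 0) (x n) = real (word_length N S (x n))"
      using xN[of n] by (simp add: word_dist_def)
    ultimately have "real (word_length N S (x n)) / k \<le> \<epsilon> * real n + (A + c)" by simp
    then have "real (word_length N S (x n)) \<le> k * (\<epsilon> * real n + (A + c))"
      using k by (simp add: field_simps)
    then have "B * real (word_length N S (x n)) \<le> B * (k * (\<epsilon> * real n + (A + c)))"
      using B(1) by (intro mult_left_mono) auto
    also have "\<dots> = real n * \<bar>f v\<bar> / 2 + B * k * (A + c)"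
      using B(1) k by (simp add: \<epsilon>_def field_simps)
    finally have "real n * \<bar>f v\<bar> - K \<le> real n * \<bar>f v\<bar> / 2 + B * k * (A + c)"
      using fx[of n] B(2)[OF xN, of n] by linarith
    then show ?thesis by (simp only: distrib_left)
  qed
  obtain n where "2 * (K + B * k * (A + c)) < real n * \<bar>f v\<bar>"
    using reals_Archimedean3[of "\<bar>f v\<bar>"] f(2) by auto
  then show False using bound[of n] by linarith
qed

section \<open>Norms on coordinate space and transport of functionals\<close>

lemma real_space_coord_space: "real_space (coord_space r)"
proof -
  have "abelian_group (coord_space r)"
  proof (rule abelian_groupI)
    fix f assume "f \<in> carrier (coord_space r)"
    then show "\<exists>g\<in>carrier (coord_space r). g \<oplus>\<^bsub>coord_space r\<^esub> f = \<zero>\<^bsub>coord_space r\<^esub>"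
      by (intro bexI[of _ "\<lambda>i. - f i"]) (auto simp: coord_space_def)
  qed (auto simp: coord_space_def algebra_simps)
  then show ?thesis
    by (auto simp: real_space_def real_space_axioms_def coord_space_def algebra_simps)
qed

lemma coord_space_simps [simp]:
  "f \<in> carrier (coord_space r) \<longleftrightarrow> (\<forall>i\<ge>r. f i = 0)"
  "f \<oplus>\<^bsub>coord_space r\<^esub> g = (\<lambda>i. f i + g i)"
  "a \<odot>\<^bsub>coord_space r\<^esub> f = (\<lambda>i. a * f i)"
  by (simp_all add: coord_space_def)

lemma coord_vec_diff:
  "coord_vec r a \<ominus>\<^bsub>coord_space r\<^esub> coord_vec r b = coord_vec r (\<lambda>i. a i - b i)"
proof -
  interpret C: real_space "coord_space r" by (rule real_space_coord_space)
  have "coord_vec r b \<in> carrier (coord_space r)" by (simp add: coord_vec_def)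
  then show ?thesis by (simp add: C.minus_eq C.minus_eq_smult) (auto simp: coord_vec_def)
qed

text \<open>Triangle inequality over the unit vectors, with e i the norm of the i-th one. The
  induction runs over k \<le> r, so that the partial vectors stay in the carrier.\<close>

lemma coord_space_norm_le:
  assumes "norm_on (coord_space r) nrm"
  obtains e where "\<And>i. i < r \<Longrightarrow> e i \<ge> 0" "\<And>a. nrm (coord_vec r a) \<le> (\<Sum>i<r. \<bar>a i\<bar> * e i)"
proof -
  interpret C: real_space "coord_space r" by (rule real_space_coord_space)
  interpret C: normed_space "coord_space r" nrm by (rule C.normed_space_norm_on[OF assms])
  define e where "e i = nrm (\<lambda>j. if j = i then 1 else 0)" for i :: nat
  have "nrm (coord_vec k a) \<le> (\<Sum>i<k. \<bar>a i\<bar> * e i)" if "k \<le> r" for k a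
    using that
  proof (induction k)
    case 0
    have "coord_vec 0 a = \<zero>\<^bsub>coord_space r\<^esub>" by (simp add: coord_vec_def coord_space_def)
    then show ?case by simp
  next
    case (Suc k)
    let ?u = "\<lambda>j. if j = k then 1 else 0 :: real"
    have eq: "coord_vec (Suc k) a = coord_vec k a \<oplus>\<^bsub>coord_space r\<^esub> a k \<odot>\<^bsub>coord_space r\<^esub> ?u"
      by (simp add: coord_vec_def) (auto simp: fun_eq_iff less_Suc_eq)
    have cl: "coord_vec k a \<in> carrier (coord_space r)" "?u \<in> carrier (coord_space r)"
      using Suc.prems by (auto simp: coord_vec_def)
    have "nrm (coord_vec (Suc k) a) \<le> nrm (coord_vec k a) + \<bar>a k\<bar> * e k"
      unfolding eq e_def using C.nrm_add[OF cl(1) C.smult_closed[OF cl(2)]] C.nrm_smult[OF cl(2)] by metis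
    then show ?case using Suc by simp
  qed
  moreover have "e i \<ge> 0" if "i < r" for i unfolding e_def using that by (intro C.nrm_nonneg) auto
  ultimately show thesis using that[of e] by blast
qed

lemma dual_transport_apply:
  "inj_on L (carrier V) \<Longrightarrow> v \<in> carrier V \<Longrightarrow> dual_transport V L f (L v) = f v"
  by (simp add: dual_transport_def)

text \<open>Every vector of the target is some L v, where the transported functional takes the value
  f v; its linearity is thus that of f.\<close>

lemma functional_on_dual_transport:
  assumes "linear_iso_on V W L" "functional_on V f" "real_space V"
  shows "functional_on W (dual_transport V L f)"
proof -
  interpret V: real_space V by fact
  have L: "linear_on V W L" "inj_on L (carrier V)" "carrier W = L ` carrier V"
    using assms(1) by (auto simp: linear_iso_on_def bij_betw_def)
  have *: "dual_transport V L f (L v) = f v" if "v \<in> carrier V" for v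
    using L(2) that by (rule dual_transport_apply)
  have "dual_transport V L f (L u \<oplus>\<^bsub>W\<^esub> L v) = f u + f v" if "u \<in> carrier V" "v \<in> carrier V" for u v
    using *[of "u \<oplus>\<^bsub>V\<^esub> v"] L(1) assms(2) that by (simp add: linear_on_def functional_on_def)
  moreover have "dual_transport V L f (a \<odot>\<^bsub>W\<^esub> L v) = a * f v" if "v \<in> carrier V" for v a
    using *[of "a \<odot>\<^bsub>V\<^esub> v"] L(1) assms(2) that by (simp add: linear_on_def functional_on_def)
  ultimately show ?thesis using * unfolding functional_on_def L(3) by auto
qed

text \<open>The difference of two homomorphisms into an abelian group is a homomorphism, so at the
  n-th power of x it is n times its value w at x. A bound independent of n forces w = 0.\<close>

lemma (in normed_space) hom_close_unique:
  assumes G: "group G" and H: "H \<in> hom G (add_monoid V)" "H' \<in> hom G (add_monoid V)"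
    and close: "\<And>x. x \<in> carrier G \<Longrightarrow> nrm (H' x \<ominus> H x) \<le> B" and x: "x \<in> carrier G"
  shows "H' x = H x"
proof -
  interpret G: group G by fact
  have cl: "H x \<in> carrier V" "H' x \<in> carrier V" if "x \<in> carrier G" for x
    using hom_in_carrier[OF H(1) that] hom_in_carrier[OF H(2) that] by auto
  have mult: "H (x \<otimes>\<^bsub>G\<^esub> y) = H x \<oplus> H y" "H' (x \<otimes>\<^bsub>G\<^esub> y) = H' x \<oplus> H' y"
    if "x \<in> carrier G" "y \<in> carrier G" for x y
    using hom_mult[OF H(1) that] hom_mult[OF H(2) that] by auto
  define w where "w = H' x \<ominus> H x"
  have w: "w \<in> carrier V" using cl[OF x] by (simp add: w_def)
  have pow: "H' (x [^]\<^bsub>G\<^esub> n) \<ominus> H (x [^]\<^bsub>G\<^esub> n) = real n \<odot> w" for n :: nat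
  proof (induction n)
    case 0
    have "H \<one>\<^bsub>G\<^esub> = \<zero>" "H' \<one>\<^bsub>G\<^esub> = \<zero>"
      using hom_one[OF H(1) G] hom_one[OF H(2) G] a_group by auto
    then show ?case using w by (simp add: diff_eq_zero_iff)
  next
    case (Suc n)
    have "H' (x [^]\<^bsub>G\<^esub> Suc n) \<ominus> H (x [^]\<^bsub>G\<^esub> Suc n) = (H' (x [^]\<^bsub>G\<^esub> n) \<ominus> H (x [^]\<^bsub>G\<^esub> n)) \<oplus> w"
      using x cl by (simp add: mult add_diff_swap w_def)
    also have "\<dots> = (real n + 1) \<odot> w" using w by (simp add: Suc smult_l_distr)
    finally show ?case by (simp add: add.commute)
  qed
  have "nrm w = 0"
  proof (rule ccontr)
    assume "nrm w \<noteq> 0"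
    then have pos: "nrm w > 0" using nrm_nonneg[OF w] by simp
    obtain n where n: "B < real n * nrm w" using reals_Archimedean3[OF pos] by auto
    then show False using close[of "x [^]\<^bsub>G\<^esub> n"] x pow[of n] nrm_smult[OF w, of "real n"] by simp
  qed
  then have "w = \<zero>" using nrm_eq_zero w by blast
  then show ?thesis using cl[OF x] by (simp add: w_def diff_eq_zero_iff)
qed

text \<open>The witnesses come from the data: H is L after the projection of N, and
  \<open>L\<^sub>a\<^sub>b\<close> is L. Uniqueness of H is the rigidity of homomorphisms at bounded
  distance, that of the linear map the spanning by projections; both are equalities on carriers,
  since the functions have arbitrary values elsewhere.\<close>

theorem theorem7p7:
  fixes N :: "('a, 'x) monoid_scheme" and M :: "('b, 'y) monoid_scheme"
    and S :: "'a set" and T :: "'b set"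
    and \<Psi> :: "'a \<Rightarrow> 'b"
    and nrm :: "('b set \<times> real \<Rightarrow>\<^sub>0 int) set \<Rightarrow> real"
    and L :: "('a set \<times> real \<Rightarrow>\<^sub>0 int) set \<Rightarrow> ('b set \<times> real \<Rightarrow>\<^sub>0 int) set"
    and v0 :: "('b set \<times> real \<Rightarrow>\<^sub>0 int) set"
    and C :: real
  assumes "group N" "torsion_free_group N" "nilpotent_group N" "finite_generating_set N S"
    and "group M" "torsion_free_group M" "nilpotent_group M" "finite_generating_set M T"
    and "quasi_isometry (carrier N) (word_dist N S) (carrier M) (word_dist M T) \<Psi>"
    and "norm_on (real_ab M) nrm"
    and "linear_on (real_ab N) (real_ab M) L" "v0 \<in> carrier (real_ab M)" "0 \<le> C"
    and "\<forall>x\<in>carrier N. nrm (ab_proj M (\<Psi> x) \<ominus>\<^bsub>real_ab M\<^esub> (L (ab_proj N x) \<oplus>\<^bsub>real_ab M\<^esub> v0)) \<le> C"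
  shows "abelian_defect N M nrm \<Psi> < \<infinity> \<and>
    (\<exists>H \<in> hom N (add_monoid (real_ab M)).
       (SUP x\<in>carrier N. ereal (nrm (ab_proj M (\<Psi> x) \<ominus>\<^bsub>real_ab M\<^esub> H x))) < \<infinity> \<and>
       (\<forall>H' \<in> hom N (add_monoid (real_ab M)).
          (SUP x\<in>carrier N. ereal (nrm (ab_proj M (\<Psi> x) \<ominus>\<^bsub>real_ab M\<^esub> H' x))) < \<infinity> \<longrightarrow>
          (\<forall>x\<in>carrier N. H' x = H x)) \<and>
       (\<exists>h \<in> hom (abelianization N) (add_monoid (real_ab M)). \<forall>x\<in>carrier N. H x = h (abelian_class N x)) \<and>
       (\<exists>L\<^sub>a\<^sub>b. linear_on (real_ab N) (real_ab M) L\<^sub>a\<^sub>b \<and> (\<forall>x\<in>carrier N. H x = L\<^sub>a\<^sub>b (ab_proj N x)) \<and>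
          (\<forall>L'. linear_on (real_ab N) (real_ab M) L' \<and> (\<forall>x\<in>carrier N. H x = L' (ab_proj N x)) \<longrightarrow>
             (\<forall>v\<in>carrier (real_ab N). L' v = L\<^sub>a\<^sub>b v)) \<and>
          (SUP x\<in>carrier N. ereal (nrm (ab_proj M (\<Psi> x) \<ominus>\<^bsub>real_ab M\<^esub> L\<^sub>a\<^sub>b (ab_proj N x)))) < \<infinity> \<and>
          linear_iso_on (real_ab N) (real_ab M) L\<^sub>a\<^sub>b \<and>
          (\<forall>\<phi>. functional_on (real_ab N) \<phi> \<longrightarrow> functional_on (real_ab M) (dual_transport (real_ab N) L\<^sub>a\<^sub>b \<phi>)) \<and>
          (\<forall>r \<phi> nrm'. dual_basis (real_ab N) r \<phi> \<and> norm_on (coord_space r) nrm' \<longrightarrow>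
             (SUP x\<in>carrier N. ereal (nrm'
                (harmonic_coords M r (\<lambda>i. dual_transport (real_ab N) L\<^sub>a\<^sub>b (\<phi> i)) (\<Psi> x)
                 \<ominus>\<^bsub>coord_space r\<^esub> harmonic_coords N r \<phi> x))) < \<infinity>)))"
proof -
  let ?V = "real_ab N" and ?W = "real_ab M"
  let ?\<pi> = "ab_proj N" and ?\<rho> = "ab_proj M"
  note N = \<open>group N\<close> and S = \<open>finite_generating_set N S\<close> and M = \<open>group M\<close>
    and T = \<open>finite_generating_set M T\<close> and nilp = \<open>nilpotent_group M\<close>
    and qi = \<open>quasi_isometry (carrier N) (word_dist N S) (carrier M) (word_dist M T) \<Psi>\<close>
    and L = \<open>linear_on ?V ?W L\<close> and v0 = \<open>v0 \<in> carrier ?W\<close>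
    and affine = \<open>\<forall>x\<in>carrier N. nrm (?\<rho> (\<Psi> x) \<ominus>\<^bsub>?W\<^esub> (L (?\<pi> x) \<oplus>\<^bsub>?W\<^esub> v0)) \<le> C\<close>
  interpret N: group N by (rule N)
  interpret M: group M by (rule M)
  interpret V: real_space ?V by (rule N.real_space_real_ab)
  interpret W: real_space ?W by (rule M.real_space_real_ab)
  interpret W: normed_space ?W nrm by (rule W.normed_space_norm_on) fact
  have \<Psi>: "\<Psi> x \<in> carrier M" if "x \<in> carrier N" for x
    using qi that unfolding quasi_isometry_def by blast
  have L_closed: "L w \<in> carrier ?W" if "w \<in> carrier ?V" for w using L that by (auto simp: linear_on_def)
  have cl: "?\<pi> x \<in> carrier ?V" "?\<rho> (\<Psi> x) \<in> carrier ?W" "L (?\<pi> x) \<in> carrier ?W"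
    if "x \<in> carrier N" for x using that \<Psi> L_closed by auto
  \<comment> \<open>Passing from the affine to the linear comparison costs the norm of the
    translation v0.\<close>
  define D where "D = C + nrm v0"
  have close: "nrm (?\<rho> (\<Psi> x) \<ominus>\<^bsub>?W\<^esub> L (?\<pi> x)) \<le> D" if x: "x \<in> carrier N" for x
  proof -
    have "(?\<rho> (\<Psi> x) \<ominus>\<^bsub>?W\<^esub> (L (?\<pi> x) \<oplus>\<^bsub>?W\<^esub> v0)) \<oplus>\<^bsub>?W\<^esub> v0 = ?\<rho> (\<Psi> x) \<ominus>\<^bsub>?W\<^esub> L (?\<pi> x)"
      using cl[OF x] v0 by (simp add: W.minus_eq W.minus_add W.a_assoc W.l_neg)
    then show ?thesis
      using W.nrm_add[of "?\<rho> (\<Psi> x) \<ominus>\<^bsub>?W\<^esub> (L (?\<pi> x) \<oplus>\<^bsub>?W\<^esub> v0)" v0] cl[OF x] v0 affine x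
      by (fastforce simp: D_def)
  qed
  define H where "H x = L (?\<pi> x)" for x
  have H_mult: "H (x \<otimes>\<^bsub>N\<^esub> y) = H x \<oplus>\<^bsub>?W\<^esub> H y" if "x \<in> carrier N" "y \<in> carrier N" for x y
    using that L by (simp add: H_def N.ab_proj_mult linear_on_def)
  have H_hom: "H \<in> hom N (add_monoid ?W)"
    by (rule homI) (simp_all add: H_mult, simp add: H_def cl)
  have defect: "abelian_defect N M nrm \<Psi> < \<infinity>"
  proof -
    \<comment> \<open>Each of the three terms is within D of the corresponding value of H, and the
      values of H cancel by additivity.\<close>
    have "nrm (?\<rho> (\<Psi> (x \<otimes>\<^bsub>N\<^esub> y)) \<ominus>\<^bsub>?W\<^esub> ?\<rho> (\<Psi> x) \<ominus>\<^bsub>?W\<^esub> ?\<rho> (\<Psi> y)) \<le> 3 * D"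
      if x: "x \<in> carrier N" and y: "y \<in> carrier N" for x y
    proof -
      let ?a = "?\<rho> (\<Psi> (x \<otimes>\<^bsub>N\<^esub> y))" and ?b = "?\<rho> (\<Psi> x)" and ?c = "?\<rho> (\<Psi> y)"
      have xy: "x \<otimes>\<^bsub>N\<^esub> y \<in> carrier N" using x y by simp
      have c: "?a \<in> carrier ?W" "?b \<in> carrier ?W" "?c \<in> carrier ?W" "H x \<in> carrier ?W" "H y \<in> carrier ?W"
        using cl xy x y by (simp_all add: H_def)
      have "?a \<ominus>\<^bsub>?W\<^esub> ?b \<ominus>\<^bsub>?W\<^esub> ?c = ?a \<ominus>\<^bsub>?W\<^esub> (?b \<oplus>\<^bsub>?W\<^esub> ?c)"
        using c by (simp add: W.minus_eq W.minus_add W.a_assoc)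
      then have "nrm (?a \<ominus>\<^bsub>?W\<^esub> ?b \<ominus>\<^bsub>?W\<^esub> ?c) \<le>
          nrm (?a \<ominus>\<^bsub>?W\<^esub> (H x \<oplus>\<^bsub>?W\<^esub> H y)) + nrm ((H x \<oplus>\<^bsub>?W\<^esub> H y) \<ominus>\<^bsub>?W\<^esub> (?b \<oplus>\<^bsub>?W\<^esub> ?c))"
        using c W.nrm_diff_triangle[of ?a "H x \<oplus>\<^bsub>?W\<^esub> H y" "?b \<oplus>\<^bsub>?W\<^esub> ?c"] by simp
      also have "nrm ((H x \<oplus>\<^bsub>?W\<^esub> H y) \<ominus>\<^bsub>?W\<^esub> (?b \<oplus>\<^bsub>?W\<^esub> ?c)) \<le> nrm (H x \<ominus>\<^bsub>?W\<^esub> ?b) + nrm (H y \<ominus>\<^bsub>?W\<^esub> ?c)"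
        using c W.nrm_add[of "H x \<ominus>\<^bsub>?W\<^esub> ?b" "H y \<ominus>\<^bsub>?W\<^esub> ?c"] by (simp add: W.add_diff_swap)
      also have "nrm (H x \<ominus>\<^bsub>?W\<^esub> ?b) \<le> D"
        using close[OF x] W.nrm_diff_commute[OF c(4,2)] by (simp add: H_def)
      also have "nrm (H y \<ominus>\<^bsub>?W\<^esub> ?c) \<le> D"
        using close[OF y] W.nrm_diff_commute[OF c(5,3)] by (simp add: H_def)
      also have "nrm (?a \<ominus>\<^bsub>?W\<^esub> (H x \<oplus>\<^bsub>?W\<^esub> H y)) \<le> D"
        using close[OF xy] H_mult[OF x y] by (simp add: H_def)
      finally show ?thesis by simp
    qed
    then have "(SUP p\<in>carrier N \<times> carrier N. ereal (case p of (x, y) \<Rightarrow>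
        nrm (?\<rho> (\<Psi> (x \<otimes>\<^bsub>N\<^esub> y)) \<ominus>\<^bsub>?W\<^esub> ?\<rho> (\<Psi> x) \<ominus>\<^bsub>?W\<^esub> ?\<rho> (\<Psi> y)))) < \<infinity>"
      by (intro SUP_ereal_less_top[of _ _ "3 * D"]) auto
    then show ?thesis by (simp add: abelian_defect_def case_prod_beta)
  qed
  have close_sup: "(SUP x\<in>carrier N. ereal (nrm (?\<rho> (\<Psi> x) \<ominus>\<^bsub>?W\<^esub> H x))) < \<infinity>"
    using close by (intro SUP_ereal_less_top[of _ _ D]) (simp add: H_def)
  have unique: "\<forall>x\<in>carrier N. H' x = H x"
    if H': "H' \<in> hom N (add_monoid ?W)"
      and sup: "(SUP x\<in>carrier N. ereal (nrm (?\<rho> (\<Psi> x) \<ominus>\<^bsub>?W\<^esub> H' x))) < \<infinity>" for H'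
  proof -
    obtain B where B: "\<And>x. x \<in> carrier N \<Longrightarrow> nrm (?\<rho> (\<Psi> x) \<ominus>\<^bsub>?W\<^esub> H' x) \<le> B"
      by (rule SUP_ereal_bounded[OF sup]) blast
    have "nrm (H' x \<ominus>\<^bsub>?W\<^esub> H x) \<le> B + D" if x: "x \<in> carrier N" for x
    proof -
      have "H' x \<in> carrier ?W" using hom_in_carrier[OF H' x] by simp
      then show ?thesis
        using W.nrm_diff_triangle[of "H' x" "?\<rho> (\<Psi> x)" "H x"] W.nrm_diff_commute[of "H' x" "?\<rho> (\<Psi> x)"]
          cl[OF x] B[OF x] close[OF x] by (simp add: H_def)
    qed
    then show ?thesis using W.hom_close_unique[OF N H_hom H'] by blast
  qed
  have factors: "\<exists>h\<in>hom (abelianization N) (add_monoid ?W). \<forall>x\<in>carrier N. H x = h (abelian_class N x)"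
  proof
    let ?h = "\<lambda>a. L (pure_tensor (abelianization N) a 1)"
    show "\<forall>x\<in>carrier N. H x = ?h (abelian_class N x)" by (simp add: H_def ab_proj_def)
    show "?h \<in> hom (abelianization N) (add_monoid ?W)"
    proof (rule homI)
      fix a b assume "a \<in> carrier (abelianization N)" "b \<in> carrier (abelianization N)"
      then obtain x y where xy: "x \<in> carrier N" "y \<in> carrier N" "a = abelian_class N x" "b = abelian_class N y"
        by (auto simp: N.carrier_abelianization)
      then show "?h (a \<otimes>\<^bsub>abelianization N\<^esub> b) = ?h a \<otimes>\<^bsub>add_monoid ?W\<^esub> ?h b"
        using H_mult[OF xy(1,2)] by (simp add: H_def ab_proj_def N.abelian_class_mult)
      show "?h a \<in> carrier (add_monoid ?W)" using xy cl by (simp add: ab_proj_def)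
    qed
  qed
  have L_unique: "\<forall>v\<in>carrier ?V. L' v = L v"
    if "linear_on ?V ?W L' \<and> (\<forall>x\<in>carrier N. H x = L' (?\<pi> x))" for L'
  proof -
    have L': "linear_on ?V ?W L'" "\<And>x. x \<in> carrier N \<Longrightarrow> L' (?\<pi> x) = L (?\<pi> x)"
      using that by (auto simp: H_def)
    \<comment> \<open>The vectors on which the two linear maps agree form a subspace containing all
      projections, hence everything.\<close>
    have "V.subspace_on {v \<in> carrier ?V. L' v = L v}"
      using L L'(1) V.linear_on_zero[OF L W.real_space_axioms] V.linear_on_zero[OF L'(1) W.real_space_axioms]
      by (auto simp: V.subspace_on_def linear_on_def)
    then have "{v \<in> carrier ?V. L' v = L v} = carrier ?V"
      by (rule N.real_ab_minimal) (simp add: L'(2))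
    then show ?thesis by blast
  qed
  have inj: "inj_on L (carrier ?V)"
  proof (rule inj_onI)
    fix u v assume uv: "u \<in> carrier ?V" "v \<in> carrier ?V" "L u = L v"
    have "L (u \<ominus>\<^bsub>?V\<^esub> v) = \<zero>\<^bsub>?W\<^esub>"
      using V.linear_diff[OF L W.real_space_axioms uv(1,2)] uv L_closed by (simp add: W.diff_eq_zero_iff)
    then have "u \<ominus>\<^bsub>?V\<^esub> v = \<zero>\<^bsub>?V\<^esub>"
      using uv by (intro linearization_injective[OF N S M nilp T qi W.normed_space_axioms L close]) auto
    then show "u = v" using uv by (simp add: V.diff_eq_zero_iff)
  qed
  have iso: "linear_iso_on ?V ?W L"
    using L inj linearization_surjective[OF N S M T qi W.normed_space_axioms L close]
    by (simp add: linear_iso_on_def bij_betw_def)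
  have transport: "functional_on ?W (dual_transport ?V L \<phi>)" if "functional_on ?V \<phi>" for \<phi>
    using iso that V.real_space_axioms by (rule functional_on_dual_transport)
  have coords: "(SUP x\<in>carrier N. ereal (nrm'
      (harmonic_coords M r (\<lambda>i. dual_transport ?V L (\<phi> i)) (\<Psi> x)
       \<ominus>\<^bsub>coord_space r\<^esub> harmonic_coords N r \<phi> x))) < \<infinity>"
    if basis: "dual_basis ?V r \<phi> \<and> norm_on (coord_space r) nrm'" for r \<phi> nrm'
  proof -
    have \<phi>: "functional_on ?V (\<phi> i)" if "i < r" for i using basis that by (simp add: dual_basis_def)
    let ?\<psi> = "\<lambda>i. dual_transport ?V L (\<phi> i)"
    obtain hs where hs: "set hs \<subseteq> carrier M" "carrier ?W = W.list_span (map ?\<rho> hs)"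
      by (rule M.real_ab_finite_span[OF T])
    have hsW: "set (map ?\<rho> hs) \<subseteq> carrier ?W" using hs(1) by auto
    have "\<exists>B\<ge>0. \<forall>w\<in>carrier ?W. \<bar>?\<psi> i w\<bar> \<le> B * nrm w" if "i < r" for i
      by (rule W.functional_bounded[OF hs(2) hsW transport[OF \<phi>[OF that]]]) blast
    then obtain B where B: "\<And>i. i < r \<Longrightarrow> B i \<ge> 0"
      "\<And>i w. i < r \<Longrightarrow> w \<in> carrier ?W \<Longrightarrow> \<bar>?\<psi> i w\<bar> \<le> B i * nrm w" by metis
    obtain e where e: "\<And>i. i < r \<Longrightarrow> e i \<ge> 0" "\<And>a. nrm' (coord_vec r a) \<le> (\<Sum>i<r. \<bar>a i\<bar> * e i)"
      by (rule coord_space_norm_le[OF conjunct2[OF basis]]) blast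
    show ?thesis
    proof (rule SUP_ereal_less_top)
      fix x assume x: "x \<in> carrier N"
      let ?a = "\<lambda>i. ?\<psi> i (?\<rho> (\<Psi> x)) - \<phi> i (?\<pi> x)"
      have a: "\<bar>?a i\<bar> \<le> B i * D" if i: "i < r" for i
      proof -
        \<comment> \<open>Since the transported functional composed with L is the original one, the
          i-th coordinate difference is a single bounded functional applied to a vector of norm at
          most D.\<close>
        have "?\<psi> i (?\<rho> (\<Psi> x) \<ominus>\<^bsub>?W\<^esub> L (?\<pi> x)) = ?a i"
          using W.functional_diff[OF transport[OF \<phi>[OF i]] cl(2,3)[OF x]]
            dual_transport_apply[OF inj cl(1)[OF x]] by simp
        then have "\<bar>?a i\<bar> \<le> B i * nrm (?\<rho> (\<Psi> x) \<ominus>\<^bsub>?W\<^esub> L (?\<pi> x))"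
          using B(2)[OF i, of "?\<rho> (\<Psi> x) \<ominus>\<^bsub>?W\<^esub> L (?\<pi> x)"] cl[OF x] by simp
        also have "\<dots> \<le> B i * D" using B(1)[OF i] close[OF x] by (rule mult_left_mono[rotated])
        finally show ?thesis .
      qed
      have "harmonic_coords M r ?\<psi> (\<Psi> x) \<ominus>\<^bsub>coord_space r\<^esub> harmonic_coords N r \<phi> x = coord_vec r ?a"
        unfolding harmonic_coords_def by (rule coord_vec_diff)
      then have "nrm' (harmonic_coords M r ?\<psi> (\<Psi> x) \<ominus>\<^bsub>coord_space r\<^esub> harmonic_coords N r \<phi> x) \<le>
          (\<Sum>i<r. \<bar>?a i\<bar> * e i)" using e(2)[of ?a] by simp
      also have "\<dots> \<le> (\<Sum>i<r. B i * D * e i)"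
        using a e(1) by (intro sum_mono mult_right_mono) auto
      finally show "nrm' (harmonic_coords M r ?\<psi> (\<Psi> x) \<ominus>\<^bsub>coord_space r\<^esub> harmonic_coords N r \<phi> x) \<le>
          (\<Sum>i<r. B i * D * e i)" .
    qed
  qed
  show ?thesis
  proof (rule conjI[OF defect], rule bexI[OF _ H_hom], intro conjI)
    show "(SUP x\<in>carrier N. ereal (nrm (?\<rho> (\<Psi> x) \<ominus>\<^bsub>?W\<^esub> H x))) < \<infinity>" by (rule close_sup)
    show "\<forall>H'\<in>hom N (add_monoid ?W). (SUP x\<in>carrier N. ereal (nrm (?\<rho> (\<Psi> x) \<ominus>\<^bsub>?W\<^esub> H' x))) < \<infinity> \<longrightarrow>
        (\<forall>x\<in>carrier N. H' x = H x)"
      using unique by blast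
    show "\<exists>h\<in>hom (abelianization N) (add_monoid ?W). \<forall>x\<in>carrier N. H x = h (abelian_class N x)"
      by (rule factors)
  next
    show "\<exists>L\<^sub>a\<^sub>b. linear_on ?V ?W L\<^sub>a\<^sub>b \<and> (\<forall>x\<in>carrier N. H x = L\<^sub>a\<^sub>b (?\<pi> x)) \<and>
      (\<forall>L'. linear_on ?V ?W L' \<and> (\<forall>x\<in>carrier N. H x = L' (?\<pi> x)) \<longrightarrow>
         (\<forall>v\<in>carrier ?V. L' v = L\<^sub>a\<^sub>b v)) \<and>
      (SUP x\<in>carrier N. ereal (nrm (?\<rho> (\<Psi> x) \<ominus>\<^bsub>?W\<^esub> L\<^sub>a\<^sub>b (?\<pi> x)))) < \<infinity> \<and>
      linear_iso_on ?V ?W L\<^sub>a\<^sub>b \<and>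
      (\<forall>\<phi>. functional_on ?V \<phi> \<longrightarrow> functional_on ?W (dual_transport ?V L\<^sub>a\<^sub>b \<phi>)) \<and>
      (\<forall>r \<phi> nrm'. dual_basis ?V r \<phi> \<and> norm_on (coord_space r) nrm' \<longrightarrow>
         (SUP x\<in>carrier N. ereal (nrm'
            (harmonic_coords M r (\<lambda>i. dual_transport ?V L\<^sub>a\<^sub>b (\<phi> i)) (\<Psi> x)
             \<ominus>\<^bsub>coord_space r\<^esub> harmonic_coords N r \<phi> x))) < \<infinity>)"
      by (intro exI[of _ L] conjI allI impI L L_unique iso transport coords ballI close_sup[unfolded H_def])
        (simp_all add: H_def)
  qed
qed

end
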